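(* For $n=2q$ even and sufficiently large, among all connected outerplanar graphs on $n$ vertices, the graph maximizing $\lambda_2$ is unique (up to isomorphism) and isomorphic to $(K_1\vee P_{q-1})\!-\!(K_1\vee P_{q-1})$.
   Context: For a graph $G$, $\lambda_1(G)\ge\lambda_2(G)\ge\cdots$ denote the eigenvalues of its adjacency matrix in non-increasing order. A graph is outerplanar if it can be drawn in the plane without crossing edges such that each vertex lies on the outer face. $P_m$ is the path on $m$ vertices, and $K_1\vee P_{m}$ is the fan graph, obtained from $P_m$ by adding a new vertex adjacent to every vertex of $P_m$. The graph $(K_1\vee P_{q-1})\!-\!(K_1\vee P_{q-1})$ is obtained from two disjoint copies of the fan graph $K_1\vee P_{q-1}$ by adding one edge joining a vertex of smallest degree in the first copy (an endpoint of its path $P_{q-1}$) to a vertex of smallest degree in the second copy (an endpoint of its path $P_{q-1}$). *)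

theory Defs
  imports
    "HOL-Analysis.Analysis"
    "Graph_Theory.Graph_Theory"
    "Jordan_Normal_Form.Char_Poly"
begin

text \<open>
  Finite simple graphs are the symmetric loop-free pair digraphs of \<^locale>\<open>pair_graph\<close>;
  an undirected edge \<open>uv\<close> is the pair of arcs \<open>(u,v)\<close> and \<open>(v,u)\<close>.
  Spectra are taken for graphs whose vertex set is an initial segment of the naturals,
  so that vertices directly serve as matrix indices.
\<close>

subsection \<open>Adjacency eigenvalues\<close>

definition adjacency_mat :: "nat pair_pre_digraph \<Rightarrow> real mat" where
  "adjacency_mat G =
     mat (card (pverts G)) (card (pverts G)) (\<lambda>(i, j). if (i, j) \<in> parcs G then 1 else 0)"

text \<open>
  The real roots of the characteristic polynomial, repeated according to multiplicity, in
  non-increasing order. The adjacency matrix of a graph is symmetric, so all its eigenvalues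
  are real and none is missed.
\<close>

definition adjacency_eigenvalues :: "nat pair_pre_digraph \<Rightarrow> real list" where
  "adjacency_eigenvalues G =
     rev (sorted_list_of_multiset (proots (char_poly (adjacency_mat G))))"

text \<open>The index \<open>k\<close> starts at 1.\<close>

definition graph_eigenvalue :: "nat \<Rightarrow> nat pair_pre_digraph \<Rightarrow> real" where
  "graph_eigenvalue k G = adjacency_eigenvalues G ! (k - 1)"


subsection \<open>Outerplanar graphs\<close>

text \<open>
  A drawing places the vertices at distinct points \<open>p v\<close> of the plane and draws each edge as
  a simple curve between its ends. The two arcs of an edge carry the same curve, traversed in
  opposite directions. A curve passes through no vertex other than its ends, and the curves
  of distinct edges meet in vertices only, hence only in common ends.
\<close>

definition plane_drawing ::
  "'v pair_pre_digraph \<Rightarrow> ('v \<Rightarrow> complex) \<Rightarrow> ('v \<times> 'v \<Rightarrow> real \<Rightarrow> complex) \<Rightarrow> bool" where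
  "plane_drawing G p \<gamma> \<longleftrightarrow>
     inj_on p (pverts G) \<and>
     (\<forall>(u, v) \<in> parcs G.
        arc (\<gamma> (u, v)) \<and> pathstart (\<gamma> (u, v)) = p u \<and> pathfinish (\<gamma> (u, v)) = p v \<and>
        \<gamma> (v, u) = reversepath (\<gamma> (u, v)) \<and>
        path_image (\<gamma> (u, v)) \<inter> p ` pverts G = {p u, p v}) \<and>
     (\<forall>(u, v) \<in> parcs G. \<forall>(x, y) \<in> parcs G. {u, v} \<noteq> {x, y} \<longrightarrow>
        path_image (\<gamma> (u, v)) \<inter> path_image (\<gamma> (x, y)) \<subseteq> p ` pverts G)"

definition drawing_image ::
  "'v pair_pre_digraph \<Rightarrow> ('v \<Rightarrow> complex) \<Rightarrow> ('v \<times> 'v \<Rightarrow> real \<Rightarrow> complex) \<Rightarrow> complex set" where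
  "drawing_image G p \<gamma> = p ` pverts G \<union> (\<Union>e \<in> parcs G. path_image (\<gamma> e))"

text \<open>
  The outer face is the unbounded component of the complement of the drawing, which is
  \<^const>\<open>outside\<close> of the (compact) drawing. Faces are open, so a vertex lies on a face
  if it belongs to the frontier of that face.
\<close>

definition outerplanar :: "'v pair_pre_digraph \<Rightarrow> bool" where
  "outerplanar G \<longleftrightarrow>
     (\<exists>p \<gamma>. plane_drawing G p \<gamma> \<and> p ` pverts G \<subseteq> frontier (outside (drawing_image G p \<gamma>)))"

definition connected_outerplanar_graphs :: "nat \<Rightarrow> nat pair_pre_digraph set" where
  "connected_outerplanar_graphs n =
     {G. pair_graph G \<and> pverts G = {..<n} \<and>
         Digraph_Component.connected (with_proj G) \<and> outerplanar G}"


subsection \<open>Two fans joined by an edge\<close>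

definition path_graph :: "nat \<Rightarrow> nat pair_pre_digraph" where
  "path_graph m =
     \<lparr> pverts = {..<m}, parcs = {(i, j). i < m \<and> j < m \<and> (j = i + 1 \<or> i = j + 1)} \<rparr>"

text \<open>\<open>K\<^sub>1 \<or> P\<^sub>m\<close>, with the added vertex numbered \<open>m\<close>.\<close>

definition fan_graph :: "nat \<Rightarrow> nat pair_pre_digraph" where
  "fan_graph m =
     \<lparr> pverts = insert m (pverts (path_graph m)),
       parcs = parcs (path_graph m) \<union>
         {m} \<times> pverts (path_graph m) \<union> pverts (path_graph m) \<times> {m} \<rparr>"

text \<open>
  The second copy of \<open>K\<^sub>1 \<or> P\<^bsub>q-1\<^esub>\<close> is the first one shifted by \<open>q\<close>. Vertex 0 is an endpoint
  of the path of the first copy, hence \<open>q\<close> is one for the second copy.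
\<close>

definition joined_fans :: "nat \<Rightarrow> nat pair_pre_digraph" where
  "joined_fans q =
     (let F = fan_graph (q - 1) in
      \<lparr> pverts = pverts F \<union> (\<lambda>i. i + q) ` pverts F,
        parcs = parcs F \<union> (\<lambda>(i, j). (i + q, j + q)) ` parcs F \<union> {(0, q), (q, 0)} \<rparr>)"

end

theory Submission
  imports Defs "Jordan_Normal_Form.Schur_Decomposition"
begin

text \<open>
  Let \<open>x\<close> be an eigenvector of the second eigenvalue \<open>\<mu>\<close> of a connected outerplanar graph on \<open>2q\<close>
  vertices that takes both signs, \<open>P\<close> and \<open>N\<close> the sets of vertices where it is positive and
  negative. On \<open>P\<close>, the adjacency matrix of the induced subgraph maps \<open>x\<close> to at least \<open>\<mu> x\<close>,
  because edges between \<open>P\<close> and \<open>N\<close> only lower the sum over neighbours; likewise for \<open>-x\<close> on \<open>N\<close>.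
  So both parts have spectral radius at least \<open>\<mu>\<close>, while one of them has at most \<open>q\<close> vertices.

  The benchmark is the largest eigenvalue \<open>\<theta>\<close> of the fan on \<open>q\<close> vertices with its adjacency
  matrix reduced by 1 in the diagonal entry of a path end, with Perron vector \<open>w\<close> (locale
  \<open>hooked_fan\<close>). On the span of the two copies of \<open>w\<close> the quadratic form of the joined fans is at least \<open>\<theta>\<close> times the squared
  norm, whence their second eigenvalue is at least \<open>\<theta>\<close>. Moreover \<open>\<theta>\<^sup>2 - 2\<theta>\<close> is at least \<open>q - 5/4\<close>. It remains to show that
  \<open>\<mu> \<ge> \<theta>\<close> forces the graph to be the joined fans, and \<open>\<mu> = \<theta>\<close> (\<open>extremal_graph\<close>).

  Outerplanarity enters through two properties of graphs (locale \<open>outer_graph\<close>): two vertices have at most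
  two common neighbours, and every nonempty set of vertices contains one with at most two neighbours in it.
  They express that a plane graph with all vertices on the outer face has no theta subgraph
  with a vertex inside each of its three paths and no cycle with two crossing chords; both follow from the fact that
  of the three arcs of a theta curve one lies inside the curve formed by the other two
  (\<open>theta_curve_middle_arc\<close>), whereas no vertex lies inside a cycle.

  For a set of at most \<open>q\<close> vertices and a positive vector with \<open>A y \<ge> \<mu> y\<close>, where
  \<open>\<mu>\<^sup>2 - 2\<mu> \<ge> q - 5/4\<close>, counting walks of length two from the largest entry shows that this vertex is adjacent
  to all others and that the set has exactly \<open>q\<close> elements (\<open>spectral_hub\<close>). Its neighbourhood induces a
  linear forest, so each of \<open>P\<close> and \<open>N\<close> induces a spanning subgraph of the fan.

  The comparison with \<open>w\<close> is an exact identity (\<open>fan_side.pairing\<close>): \<open>(\<mu> - \<theta>) \<langle>w, y\<rangle>\<close> equals \<open>w 0 * y 0\<close>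
  minus the contribution of every missing path edge and of every edge to the other side. All
  entries of \<open>w\<close> and of the normalised \<open>y\<close> on the path are \<open>1/\<mu>\<close> up to a factor close to 1, so
  a missing edge costs about twice what \<open>w 0 * y 0\<close> pays for, an edge at a hub far more, and
  two crossing edges again about twice. So both sides are complete fans joined by one edge.
  Multiplying the identities of the two sides compares \<open>w u * y u\<close> for the end \<open>u\<close> of this
  edge with \<open>w 0 * y 0\<close>: the former is larger by a relative amount of order \<open>1/\<theta>\<close> if \<open>u\<close> is not
  an end of the path. Hence the edge joins two path ends, and adding the identities gives \<open>\<mu> = \<theta>\<close>.
\<close>

section \<open>Theta curves and crossing chords\<close>

lemma endpoints_in_closure_interior:
  fixes c :: "real \<Rightarrow> complex"
  assumes "arc c"
  shows "pathstart c \<in> closure (path_image c - {pathstart c, pathfinish c})"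
    and "pathfinish c \<in> closure (path_image c - {pathstart c, pathfinish c})"
proof -
  have eq: "path_image c - {pathstart c, pathfinish c} = c ` {0<..<1}"
    using assms by (simp add: arc_imp_simple_path simple_path_endless)
  have "c ` closure {0<..<1::real} \<subseteq> closure (c ` {0<..<1})"
    using assms closure_subset[of "c ` {0<..<1}"]
    by (intro image_closure_subset) (simp_all add: arc_def path_def)
  then have "c ` {0..1} \<subseteq> closure (path_image c - {pathstart c, pathfinish c})"
    using eq by simp
  then show "pathstart c \<in> closure (path_image c - {pathstart c, pathfinish c})"
    "pathfinish c \<in> closure (path_image c - {pathstart c, pathfinish c})"
    unfolding pathstart_def pathfinish_def by auto
qed

lemma arc_interior:
  assumes "arc c" "pathstart c = a" "pathfinish c = b"
  shows "Topological_Spaces.connected (path_image c - {a, b})" "path_image c - {a, b} \<noteq> {}"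
  using assms connected_simple_path_endless[of c] nonempty_simple_path_endless[of c]
  by (auto dest: arc_imp_simple_path)

text \<open>
  The Jordan curve theorem in the form used below, for a closed curve given as two arcs with
  common ends.
\<close>

lemma two_arcs_Jordan:
  fixes c d :: "real \<Rightarrow> complex"
  assumes "arc c" "pathstart c = a" "pathfinish c = b"
    and "arc d" "pathstart d = a" "pathfinish d = b"
    and "path_image c \<inter> path_image d = {a, b}"
  defines "S \<equiv> path_image c \<union> path_image d"
  shows "inside S \<noteq> {}" "open (inside S)" "Topological_Spaces.connected (inside S)" "open (outside S)"
    "Topological_Spaces.connected (outside S)" "bounded (inside S)" "\<not> bounded (outside S)" "frontier (inside S) = S"
    "closed S" "bounded S"
proof -
  let ?c = "c +++ reversepath d"
  have "simple_path ?c"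
    using assms by (intro simple_path_join_loop) (auto simp: arc_reversepath)
  moreover have "path_image ?c = S"
    using assms by (simp add: path_image_join)
  moreover have "pathfinish ?c = pathstart ?c"
    using assms by simp
  ultimately show "inside S \<noteq> {}" "open (inside S)" "Topological_Spaces.connected (inside S)" "open (outside S)"
    "Topological_Spaces.connected (outside S)" "bounded (inside S)" "\<not> bounded (outside S)" "frontier (inside S) = S"
    using Jordan_inside_outside[of ?c] by auto
  show "closed S" "bounded S"
    using assms by (auto simp: S_def arc_imp_path closed_path_image bounded_path_image)
qed

lemma connected_misses_inside_or_outside:
  fixes S X :: "complex set"
  assumes "Topological_Spaces.connected X" "X \<inter> S = {}" "closed S"
  shows "X \<subseteq> inside S \<or> X \<subseteq> outside S"
proof -
  have "X \<subseteq> inside S \<union> outside S" using assms(2) by auto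
  then have "inside S \<inter> X = {} \<or> outside S \<inter> X = {}"
    using assms(1,3) connectedD[of X "inside S" "outside S"]
    by (auto simp: open_inside open_outside)
  with \<open>X \<subseteq> inside S \<union> outside S\<close> show ?thesis by blast
qed

text \<open>
  If the interior of each arc lay outside the closed curve of the other two, Janiszewski's theorem
  would apply to the curves through \<open>c2\<close>: they meet in the connected set \<open>c2\<close>, and a point \<open>x\<close>
  inside the curve of \<open>c1\<close> and \<open>c3\<close> lies outside both of them. So \<open>x\<close> could be joined to a remote point
  in the complement of all three arcs, although the curve of \<open>c1\<close> and \<open>c3\<close> separates the two.
\<close>

lemma theta_curve_middle_arc:
  fixes c1 c2 c3 :: "real \<Rightarrow> complex"
  assumes c1: "arc c1" "pathstart c1 = a" "pathfinish c1 = b"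
    and c2: "arc c2" "pathstart c2 = a" "pathfinish c2 = b"
    and c3: "arc c3" "pathstart c3 = a" "pathfinish c3 = b"
    and i12: "path_image c1 \<inter> path_image c2 = {a, b}"
    and i13: "path_image c1 \<inter> path_image c3 = {a, b}"
    and i23: "path_image c2 \<inter> path_image c3 = {a, b}"
  shows "path_image c1 - {a, b} \<subseteq> inside (path_image c2 \<union> path_image c3) \<or>
    path_image c2 - {a, b} \<subseteq> inside (path_image c1 \<union> path_image c3) \<or>
    path_image c3 - {a, b} \<subseteq> inside (path_image c1 \<union> path_image c2)"
proof (rule ccontr)
  assume neg: "\<not> ?thesis"
  let ?A = "path_image c1" and ?B = "path_image c2" and ?C = "path_image c3"
  note J12 = two_arcs_Jordan[OF c1 c2 i12] and J13 = two_arcs_Jordan[OF c1 c3 i13]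
    and J23 = two_arcs_Jordan[OF c2 c3 i23]
  have conn: "Topological_Spaces.connected (?A - {a,b})" "Topological_Spaces.connected (?B - {a,b})" "Topological_Spaces.connected (?C - {a,b})"
    using arc_interior(1)[OF c1] arc_interior(1)[OF c2] arc_interior(1)[OF c3] by simp_all
  have neg': "\<not> ?A - {a,b} \<subseteq> inside (?B \<union> ?C)" "\<not> ?B - {a,b} \<subseteq> inside (?A \<union> ?C)"
    "\<not> ?C - {a,b} \<subseteq> inside (?A \<union> ?B)"
    using neg by simp_all
  have disj: "(?A - {a,b}) \<inter> (?B \<union> ?C) = {}" "(?B - {a,b}) \<inter> (?A \<union> ?C) = {}"
    "(?C - {a,b}) \<inter> (?A \<union> ?B) = {}"
    using i12 i13 i23 by blast+
  have oA: "?A - {a,b} \<subseteq> outside (?B \<union> ?C)"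
    using connected_misses_inside_or_outside[OF conn(1) disj(1) J23(9)] neg' by simp
  have oB: "?B - {a,b} \<subseteq> outside (?A \<union> ?C)"
    using connected_misses_inside_or_outside[OF conn(2) disj(2) J13(9)] neg' by simp
  have oC: "?C - {a,b} \<subseteq> outside (?A \<union> ?B)"
    using connected_misses_inside_or_outside[OF conn(3) disj(3) J12(9)] neg' by simp
  have ab: "a \<in> ?A" "b \<in> ?A" "a \<in> ?B" "b \<in> ?B" "a \<in> ?C" "b \<in> ?C"
    using i12 i13 by auto
  let ?I = "inside (?A \<union> ?C)"
  have no_B: "?I \<inter> ?B = {}"
  proof -
    have "?I \<inter> (?A \<union> ?C) = {}" by simp
    moreover have "?I \<inter> outside (?A \<union> ?C) = {}" by simp
    ultimately show ?thesis using oB ab by blast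
  qed
  have nAB: "\<not> ?I \<subseteq> inside (?A \<union> ?B)"
  proof
    assume "?I \<subseteq> inside (?A \<union> ?B)"
    then have "closure ?I \<subseteq> closure (inside (?A \<union> ?B))" by (rule closure_mono)
    also have "\<dots> \<subseteq> (?A \<union> ?B) \<union> inside (?A \<union> ?B)"
      using closure_inside_subset[OF J12(9)] .
    finally have "?A \<union> ?C \<subseteq> (?A \<union> ?B) \<union> inside (?A \<union> ?B)"
      using J13(8) by (auto simp: frontier_def)
    then have "?C - {a,b} \<subseteq> inside (?A \<union> ?B)" using disj(3) by blast
    with neg' show False by simp
  qed
  have nBC: "\<not> ?I \<subseteq> inside (?B \<union> ?C)"
  proof
    assume "?I \<subseteq> inside (?B \<union> ?C)"
    then have "closure ?I \<subseteq> closure (inside (?B \<union> ?C))" by (rule closure_mono)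
    also have "\<dots> \<subseteq> (?B \<union> ?C) \<union> inside (?B \<union> ?C)"
      using closure_inside_subset[OF J23(9)] .
    finally have "?A \<union> ?C \<subseteq> (?B \<union> ?C) \<union> inside (?B \<union> ?C)"
      using J13(8) by (auto simp: frontier_def)
    then have "?A - {a,b} \<subseteq> inside (?B \<union> ?C)" using disj(1) by blast
    with neg' show False by simp
  qed
  have "?I \<inter> (?A \<union> ?C) = {}" by simp
  with no_B have disj_I: "?I \<inter> (?A \<union> ?B) = {}" "?I \<inter> (?B \<union> ?C) = {}"
    by (simp_all add: Int_Un_distrib)
  have I_AB: "?I \<subseteq> outside (?A \<union> ?B)"
    using connected_misses_inside_or_outside[OF J13(3) disj_I(1) J12(9)] nAB by simp
  have I_BC: "?I \<subseteq> outside (?B \<union> ?C)"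
    using connected_misses_inside_or_outside[OF J13(3) disj_I(2) J23(9)] nBC by simp
  obtain x where x: "x \<in> ?I" using J13(1) by auto
  have "bounded (?A \<union> ?B \<union> ?C)" using J12(10) J13(10) by auto
  then have "outside (?A \<union> ?B \<union> ?C) \<noteq> {}"
    using unbounded_outside by fastforce
  then obtain y where y: "y \<in> outside (?A \<union> ?B \<union> ?C)" by auto
  have yAB: "y \<in> outside (?A \<union> ?B)" and yBC: "y \<in> outside (?B \<union> ?C)"
    and yAC: "y \<in> outside (?A \<union> ?C)"
    using y outside_mono[of "?A \<union> ?B" "?A \<union> ?B \<union> ?C"] outside_mono[of "?B \<union> ?C" "?A \<union> ?B \<union> ?C"]
      outside_mono[of "?A \<union> ?C" "?A \<union> ?B \<union> ?C"] by auto
  have outside_sub: "outside S \<subseteq> - S" for S :: "complex set"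
    using outside_no_overlap[of S] by blast
  have cAB: "connected_component (- (?A \<union> ?B)) x y"
    unfolding connected_component_def
    using J12(5) I_AB x yAB by (intro exI[of _ "outside (?A \<union> ?B)"] conjI outside_sub) auto
  have cBC: "connected_component (- (?B \<union> ?C)) x y"
    unfolding connected_component_def
    using J23(5) I_BC x yBC by (intro exI[of _ "outside (?B \<union> ?C)"] conjI outside_sub) auto
  have "?A \<inter> ?C \<subseteq> ?B" using i13 ab by simp
  then have "(?A \<union> ?B) \<inter> (?B \<union> ?C) = ?B" by blast
  moreover have "Topological_Spaces.connected ?B" using c2 by (simp add: arc_imp_path connected_path_image)
  ultimately have "Topological_Spaces.connected ((?A \<union> ?B) \<inter> (?B \<union> ?C))" by simp
  moreover have "compact (?A \<union> ?B)" using J12 by (simp add: compact_eq_bounded_closed)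
  ultimately have "connected_component (- ((?A \<union> ?B) \<union> (?B \<union> ?C))) x y"
    using Janiszewski[OF _ J23(9) _ cAB cBC] by blast
  then have "connected_component (- (?A \<union> ?C)) x y"
    by (rule connected_component_of_subset) auto
  from inside_same_component[OF this x] yAC show False
    using inside_Int_outside by blast
qed

text \<open>
  Shrinking a set enlarges its outside, so points of the outer face of a drawing stay in the
  closure of the outside of every curve of the drawing.
\<close>

lemma frontier_outside_not_inside:
  fixes D S :: "complex set"
  assumes "z \<in> frontier (outside D)" "S \<subseteq> D" "closed S"
  shows "z \<notin> inside S"
proof -
  have "z \<in> closure (outside D)" using assms(1) by (simp add: frontier_def)
  then have "z \<in> closure (outside S)"
    using outside_mono[OF assms(2)] closure_mono by blast
  then have "z \<in> S \<union> outside S" using closure_outside_subset[OF assms(3)] by auto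
  then show ?thesis using inside_no_overlap[of S] inside_Int_outside[of S] by blast
qed

lemma no_theta_with_three_outer_points:
  fixes c1 c2 c3 :: "real \<Rightarrow> complex"
  assumes c1: "arc c1" "pathstart c1 = a" "pathfinish c1 = b"
    and c2: "arc c2" "pathstart c2 = a" "pathfinish c2 = b"
    and c3: "arc c3" "pathstart c3 = a" "pathfinish c3 = b"
    and i12: "path_image c1 \<inter> path_image c2 = {a, b}"
    and i13: "path_image c1 \<inter> path_image c3 = {a, b}"
    and i23: "path_image c2 \<inter> path_image c3 = {a, b}"
    and D: "path_image c1 \<union> path_image c2 \<union> path_image c3 \<subseteq> D"
    and x: "x1 \<in> path_image c1 - {a, b}" "x2 \<in> path_image c2 - {a, b}" "x3 \<in> path_image c3 - {a, b}"
    and outer: "{x1, x2, x3} \<subseteq> frontier (outside D)"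
  shows False
proof -
  have "x1 \<notin> inside (path_image c2 \<union> path_image c3)"
    "x2 \<notin> inside (path_image c1 \<union> path_image c3)"
    "x3 \<notin> inside (path_image c1 \<union> path_image c2)"
    using outer D
    by (intro frontier_outside_not_inside[of _ D] two_arcs_Jordan(9)[OF c1 c2 i12]
        two_arcs_Jordan(9)[OF c1 c3 i13] two_arcs_Jordan(9)[OF c2 c3 i23]; simp)+
  then show False
    using theta_curve_middle_arc[OF c1 c2 c3 i12 i13 i23] x by blast
qed

text \<open>
  By the theta curve lemma both chords run inside the cycle, as the other two arcs of the theta
  curves contain outer points. The chord \<open>ac\<close> cuts the inside of the cycle in two parts, and the chord
  \<open>bd\<close> stays in one of them; but then one of \<open>b\<close> and \<open>d\<close> lies inside a closed curve of the drawing.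
\<close>

lemma no_crossing_chords_with_outer_ends:
  fixes ab bc cd da ac bd :: "real \<Rightarrow> complex"
  assumes dist: "distinct [a, b, c, d]"
    and ab: "arc ab" "pathstart ab = a" "pathfinish ab = b"
    and bc: "arc bc" "pathstart bc = b" "pathfinish bc = c"
    and cd: "arc cd" "pathstart cd = c" "pathfinish cd = d"
    and da: "arc da" "pathstart da = d" "pathfinish da = a"
    and ac: "arc ac" "pathstart ac = a" "pathfinish ac = c"
    and bd: "arc bd" "pathstart bd = b" "pathfinish bd = d"
    and adj: "path_image ab \<inter> path_image bc = {b}" "path_image bc \<inter> path_image cd = {c}"
      "path_image cd \<inter> path_image da = {d}" "path_image da \<inter> path_image ab = {a}"
      "path_image ac \<inter> path_image ab = {a}" "path_image ac \<inter> path_image da = {a}"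
      "path_image ac \<inter> path_image bc = {c}" "path_image ac \<inter> path_image cd = {c}"
      "path_image bd \<inter> path_image ab = {b}" "path_image bd \<inter> path_image bc = {b}"
      "path_image bd \<inter> path_image cd = {d}" "path_image bd \<inter> path_image da = {d}"
    and opp: "path_image ab \<inter> path_image cd = {}" "path_image bc \<inter> path_image da = {}"
      "path_image ac \<inter> path_image bd = {}"
    and D: "path_image ab \<union> path_image bc \<union> path_image cd \<union> path_image da \<union>
      path_image ac \<union> path_image bd \<subseteq> D"
    and outer: "{a, b, c, d} \<subseteq> frontier (outside D)"
  shows False
proof -
  let ?abc = "ab +++ bc" and ?adc = "reversepath da +++ reversepath cd"
  let ?bad = "reversepath ab +++ reversepath da" and ?bcd = "bc +++ cd"
  have im: "path_image ?abc = path_image ab \<union> path_image bc"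
    "path_image ?adc = path_image da \<union> path_image cd"
    "path_image ?bad = path_image ab \<union> path_image da"
    "path_image ?bcd = path_image bc \<union> path_image cd"
    using ab bc cd da by (simp_all add: path_image_join)
  have abc: "arc ?abc" "pathstart ?abc = a" "pathfinish ?abc = c"
    and adc: "arc ?adc" "pathstart ?adc = a" "pathfinish ?adc = c"
    and bad: "arc ?bad" "pathstart ?bad = b" "pathfinish ?bad = d"
    and bcd: "arc ?bcd" "pathstart ?bcd = b" "pathfinish ?bcd = d"
    using ab bc cd da adj(1-4) by (simp_all add: arc_join arc_reversepath Int_commute)
  have i1: "path_image ac \<inter> path_image ?abc = {a, c}"
    unfolding im using adj(5,7) by blast
  have i2: "path_image ac \<inter> path_image ?adc = {a, c}"
    unfolding im using adj(6,8) by blast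
  have i3: "path_image ?abc \<inter> path_image ?adc = {a, c}"
    unfolding im using adj(2,4) opp(1,2) by blast
  have i4: "path_image bd \<inter> path_image ?bad = {b, d}"
    unfolding im using adj(9,12) by blast
  have i5: "path_image bd \<inter> path_image ?bcd = {b, d}"
    unfolding im using adj(10,11) by blast
  have i6: "path_image ?bad \<inter> path_image ?bcd = {b, d}"
    unfolding im using adj(1,3) opp(1,2) by blast
  let ?S = "path_image ab \<union> path_image bc \<union> path_image cd \<union> path_image da"
  have S1: "path_image ?abc \<union> path_image ?adc = ?S" and S2: "path_image ?bad \<union> path_image ?bcd = ?S"
    unfolding im by auto
  have mem: "a \<in> path_image ?bad" "c \<in> path_image ?bcd" "b \<in> path_image ?abc" "d \<in> path_image ?adc"
    unfolding im using ab(1,2,3) cd(1,2,3) pathstart_in_path_image[of ab] pathfinish_in_path_image[of ab]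
      pathstart_in_path_image[of cd] pathfinish_in_path_image[of cd] by simp_all
  have sub: "path_image ?abc \<subseteq> D" "path_image ?adc \<subseteq> D" "path_image ?bad \<subseteq> D" "path_image ?bcd \<subseteq> D"
    "path_image ac \<subseteq> D" "path_image bd \<subseteq> D"
    unfolding im using D by simp_all
  have b_out: "b \<notin> inside (path_image ac \<union> path_image ?adc)"
    using outer sub two_arcs_Jordan(9)[OF ac adc i2]
    by (intro frontier_outside_not_inside[of _ D]) simp_all
  have d_out: "d \<notin> inside (path_image ac \<union> path_image ?abc)"
    using outer sub two_arcs_Jordan(9)[OF ac abc i1]
    by (intro frontier_outside_not_inside[of _ D]) simp_all
  have a_out: "a \<notin> inside (path_image bd \<union> path_image ?bcd)"
    using outer sub two_arcs_Jordan(9)[OF bd bcd i5]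
    by (intro frontier_outside_not_inside[of _ D]) simp_all
  have c_out: "c \<notin> inside (path_image bd \<union> path_image ?bad)"
    using outer sub two_arcs_Jordan(9)[OF bd bad i4]
    by (intro frontier_outside_not_inside[of _ D]) simp_all
  have ac_in: "path_image ac - {a, c} \<subseteq> inside ?S"
    using theta_curve_middle_arc[OF ac abc adc i1 i2 i3] b_out d_out mem(3,4) dist unfolding S1 by auto
  have bd_in: "path_image bd - {b, d} \<subseteq> inside ?S"
    using theta_curve_middle_arc[OF bd bad bcd i4 i5 i6] a_out c_out mem(1,2) dist unfolding S2 by auto
  have ne: "path_image ac - {a, c} \<noteq> {}" "path_image bd - {b, d} \<noteq> {}"
    using arc_interior(2)[OF ac] arc_interior(2)[OF bd] by simp_all
  have ne': "path_image ac \<inter> inside (path_image ?abc \<union> path_image ?adc) \<noteq> {}"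
    using ne(1) ac_in unfolding S1 by blast
  let ?I1 = "inside (path_image ?abc \<union> path_image ac)" and ?I2 = "inside (path_image ?adc \<union> path_image ac)"
  have "a \<noteq> c" using dist by simp
  obtain d12: "?I1 \<inter> ?I2 = {}" and u12: "?I1 \<union> ?I2 \<union> (path_image ac - {a, c}) = inside ?S"
    using split_inside_simple_closed_curve[OF arc_imp_simple_path[OF abc(1)] abc(2,3)
        arc_imp_simple_path[OF adc(1)] adc(2,3) arc_imp_simple_path[OF ac(1)] ac(2,3)
        \<open>a \<noteq> c\<close> i3 i1[unfolded Int_commute[of "path_image ac"]] i2[unfolded Int_commute[of "path_image ac"]] ne']
    unfolding S1 by blast
  have cl1: "closed (path_image ?abc \<union> path_image ac)"
    and cl2: "closed (path_image ?adc \<union> path_image ac)"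
    using two_arcs_Jordan(9)[OF ac abc i1] two_arcs_Jordan(9)[OF ac adc i2] by (simp_all add: Un_commute)
  have "path_image bd - {b, d} \<subseteq> ?I1 \<union> ?I2"
    using bd_in u12 opp(3) by blast
  moreover have "Topological_Spaces.connected (path_image bd - {b, d})"
    by (rule arc_interior(1)[OF bd])
  moreover have "open ?I1" "open ?I2" using cl1 cl2 by (auto intro: open_inside)
  ultimately have "path_image bd - {b, d} \<subseteq> ?I1 \<or> path_image bd - {b, d} \<subseteq> ?I2"
    using connectedD[of "path_image bd - {b, d}" ?I1 ?I2] d12 by blast
  then show False
  proof
    assume "path_image bd - {b, d} \<subseteq> ?I1"
    then have "closure (path_image bd - {b, d}) \<subseteq> closure ?I1" by (rule closure_mono)
    also have "\<dots> \<subseteq> (path_image ?abc \<union> path_image ac) \<union> ?I1"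
      using closure_inside_subset[OF cl1] .
    finally have "d \<in> (path_image ?abc \<union> path_image ac) \<union> ?I1"
      using endpoints_in_closure_interior(2)[OF bd(1)] bd by auto
    moreover have "d \<notin> path_image ?abc \<union> path_image ac"
      using i3 i2 mem(4) dist by auto
    ultimately show False using d_out by (simp add: Un_commute)
  next
    assume "path_image bd - {b, d} \<subseteq> ?I2"
    then have "closure (path_image bd - {b, d}) \<subseteq> closure ?I2" by (rule closure_mono)
    also have "\<dots> \<subseteq> (path_image ?adc \<union> path_image ac) \<union> ?I2"
      using closure_inside_subset[OF cl2] .
    finally have "b \<in> (path_image ?adc \<union> path_image ac) \<union> ?I2"
      using endpoints_in_closure_interior(1)[OF bd(1)] bd by auto
    moreover have "b \<notin> path_image ?adc \<union> path_image ac"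
      using i3 i1 mem(3) dist by auto
    ultimately show False using b_out by (simp add: Un_commute)
  qed
qed

section \<open>Forbidden configurations in outerplanar graphs\<close>

text \<open>
  A cycle \<open>a A b B c C d D\<close> with the crossing chords \<open>ac\<close> and \<open>bd\<close>.
\<close>

definition crossed_cycle :: "('v \<Rightarrow> 'v \<Rightarrow> bool) \<Rightarrow> 'v list \<Rightarrow> bool" where
  "crossed_cycle E vs \<longleftrightarrow> (\<exists>a A b B c C d D. vs = a # A @ b # B @ c # C @ d # D \<and> distinct vs \<and>
     successively E (a # A @ [b]) \<and> successively E (b # B @ [c]) \<and>
     successively E (c # C @ [d]) \<and> successively E (d # D @ [a]) \<and> E a c \<and> E b d)"

lemma crossed_cycleI:
  assumes "distinct (a # A @ b # B @ c # C @ d # D)"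
    and "successively E (a # A @ [b])" "successively E (b # B @ [c])"
    and "successively E (c # C @ [d])" "successively E (d # D @ [a])" "E a c" "E b d"
  shows "crossed_cycle E (a # A @ b # B @ c # C @ d # D)"
  unfolding crossed_cycle_def using assms by blast

lemma successively_infix: "successively E (xs @ ys @ zs) \<Longrightarrow> successively E ys"
  by (simp add: successively_append_iff)

text \<open>
  Among all longest paths \<open>x A c R\<close> with a chord from the first vertex \<open>x\<close> to \<open>c\<close>, take one with \<open>A\<close> as
  short as possible. All neighbours of \<open>x\<close> lie on the path, and by minimality a third one lies in \<open>R\<close>.
  Reversing the initial segment \<open>x A\<close> gives another longest path, which starts in the last
  vertex \<open>b\<close> of \<open>A\<close> and has the same minimal length; so \<open>b\<close> has a neighbour in \<open>R\<close> as well. The four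
  edges found are chords or edges of a cycle, and two of them cross.
\<close>

lemma crossed_cycle_if_degrees_ge_3:
  fixes E :: "'v \<Rightarrow> 'v \<Rightarrow> bool"
  assumes sym: "\<And>u v. E u v \<Longrightarrow> E v u" and irrefl: "\<And>u. \<not> E u u"
    and fin: "finite S" and ne: "S \<noteq> {}" and deg: "\<And>v. v \<in> S \<Longrightarrow> card {w \<in> S. E v w} \<ge> 3"
  shows "\<exists>vs. set vs \<subseteq> S \<and> crossed_cycle E vs"
proof -
  define path where "path = (\<lambda>vs. distinct vs \<and> set vs \<subseteq> S \<and> successively E vs)"
  have bound: "length vs \<le> card S" if "path vs" for vs
    using that fin by (metis path_def card_mono distinct_card)
  obtain s where "s \<in> S" using ne by auto
  then have "path [s]" by (simp add: path_def)
  define longest where "longest = (\<lambda>vs. path vs \<and> (\<forall>us. path us \<longrightarrow> length us \<le> length vs))"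
  have "\<exists>vs. longest vs"
    unfolding longest_def using ex_has_greatest_nat[of path "[s]" length "Suc (card S)"] \<open>path [s]\<close> bound
    by (metis less_Suc_eq_le)
  have same_length: "longest us" if "longest vs" "path us" "length us = length vs" for us vs
    using that by (simp add: longest_def)
  have closed: "w \<in> set vs" if "longest (x # vs)" "E x w" "w \<in> S" "w \<noteq> x" for x vs w
  proof (rule ccontr)
    assume "w \<notin> set vs"
    then have "path (w # x # vs)"
      using that sym by (auto simp: longest_def path_def)
    then show False using that(1) by (auto simp: longest_def)
  qed
  define chord where "chord = (\<lambda>x A c R. longest (x # A @ c # R) \<and> A \<noteq> [] \<and> E x c)"
  have nbr3: "\<not> {w \<in> S. E x w} \<subseteq> {u, v}" if "x \<in> S" for x u v
    using deg[OF that] card_mono[of "{u, v}" "{w \<in> S. E x w}"] card_insert_le_m1[of 2 "{v}" u]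
    by (auto simp: card_insert_if split: if_splits)
  have "\<exists>x A c R. chord x A c R"
  proof -
    obtain vs where vs: "longest vs" using \<open>\<exists>vs. longest vs\<close> by auto
    then have "vs \<noteq> []" using \<open>path [s]\<close> by (auto simp: longest_def)
    then obtain x ws where ws: "vs = x # ws" by (cases vs) auto
    have "x \<in> S" using vs ws by (auto simp: longest_def path_def)
    then obtain w where w: "w \<in> S" "E x w" "w \<noteq> hd ws" using nbr3[of x "hd ws" "hd ws"] by auto
    then have "w \<in> set ws" using closed vs ws irrefl by metis
    then obtain A R where "ws = A @ w # R" by (meson split_list)
    then show ?thesis using w vs ws by (intro exI[of _ x] exI[of _ A] exI[of _ w] exI[of _ R]) (auto simp: chord_def)
  qed
  then have "\<exists>n x A c R. chord x A c R \<and> length A = n" by blast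
  \<comment> \<open>The chord of the chosen path spans as few vertices as possible.\<close>
  define n where "n = (LEAST n. \<exists>x A c R. chord x A c R \<and> length A = n)"
  obtain x A c R where xA: "chord x A c R" "length A = n"
    using LeastI_ex[OF \<open>\<exists>n x A c R. chord x A c R \<and> length A = n\<close>] unfolding n_def by blast
  have least: "length A \<ge> n" if "chord x A c R" for x A c R
    unfolding n_def using that by (intro Least_le) blast
  have far: "\<exists>d \<in> set R. E x d" if ch: "chord x A c R" "length A = n" for x A c R
  proof -
    have lo: "longest (x # A @ c # R)" "A \<noteq> []" "E x c" using ch by (auto simp: chord_def)
    then have "x \<in> S" by (auto simp: longest_def path_def)
    then obtain d where d: "d \<in> S" "E x d" "d \<noteq> hd A" "d \<noteq> c" using nbr3[of x "hd A" c] by auto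
    have "d \<in> set (A @ c # R)" using closed[OF lo(1) d(2,1)] d irrefl by auto
    moreover have "d \<notin> set A"
    proof
      assume "d \<in> set A"
      then obtain A1 A2 where A: "A = A1 @ d # A2" by (meson split_list)
      with d have "A1 \<noteq> []" by auto
      then have "chord x A1 d (A2 @ c # R)" using lo A d by (simp add: chord_def)
      then show False using least A that(2) by fastforce
    qed
    ultimately show ?thesis using d by auto
  qed
  have lo: "longest (x # A @ c # R)" "A \<noteq> []" "E x c" using xA by (auto simp: chord_def)
  obtain A0 b where A: "A = A0 @ [b]" using lo(2) by (metis rev_exhaust)
  have p: "path (x # A0 @ b # c # R)" using lo(1) A by (simp add: longest_def)
  have sE: "(\<lambda>x y. E y x) = E" using sym by blast
  have succ: "successively E (x # A0 @ [b])" "E b c" "successively E (c # R)"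
    using p successively_infix[of E "[]" "x # A0 @ [b]" "c # R"]
      successively_infix[of E "x # A0" "[b, c]" R] successively_infix[of E "x # A0 @ [b]" "c # R" "[]"]
    by (simp_all add: path_def)
  have revs: "successively E (rev ys)" if "successively E ys" for ys
    using that by (simp only: successively_rev sE)
  have "successively E (rev (x # A0 @ [b]))" using succ revs by blast
  then have "path (b # rev A0 @ x # c # R)"
    using p succ(3) lo(3) successively_append_iff[of E "b # rev A0 @ [x]" "c # R"]
    by (auto simp: path_def)
  then have "longest (b # (rev A0 @ [x]) @ c # R)"
    using same_length[OF lo(1)] A by simp
  then have "chord b (rev A0 @ [x]) c R" using succ by (simp add: chord_def)
  moreover have "length (rev A0 @ [x]) = n" using xA A by simp
  ultimately obtain d' where d': "d' \<in> set R" "E b d'" using far by blast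
  obtain d where d: "d \<in> set R" "E x d" using far[OF xA] by blast
  obtain R1 R2 where R: "R = R1 @ d # R2" using d by (meson split_list)
  have dist: "distinct (x # A0 @ b # c # R)" "set (x # A0 @ b # c # R) \<subseteq> S"
    using p by (auto simp: path_def)
  consider "d' \<in> set (R1 @ [d])" | "d' \<in> set R2" using d' R by auto
  then show ?thesis
  proof cases
    case 1
    then obtain R3 R4 where R34: "R1 @ [d] = R3 @ d' # R4" by (meson split_list)
    let ?vs = "x # A0 @ b # [] @ c # R3 @ d' # R4"
    have R': "R = R3 @ d' # R4 @ R2" using R R34 by (metis append.assoc append_Cons append_Nil)
    have "last (d' # R4) = d" using R34 by (metis last_appendR last_snoc list.discI)
    have "successively E ([] @ (c # R3 @ [d']) @ (R4 @ R2))" "successively E ((c # R3) @ (d' # R4) @ R2)"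
      using succ(3) unfolding R' by simp_all
    then have w: "successively E (c # R3 @ [d'])" "successively E (d' # R4)"
      by (blast dest: successively_infix)+
    have "successively E ((d' # R4) @ [x])"
      unfolding successively_append_iff using w(2) sym[OF d(2)] \<open>last (d' # R4) = d\<close> by simp
    with w have "successively E (c # R3 @ [d'])" "successively E (d' # R4 @ [x])" by simp_all
    moreover have "distinct ?vs" "set ?vs \<subseteq> S" using dist R' by auto
    ultimately have "crossed_cycle E ?vs"
      using succ(1,2) lo(3) d'(2) by (intro crossed_cycleI) simp_all
    then show ?thesis using \<open>set ?vs \<subseteq> S\<close> by blast
  next
    case 2
    then obtain R3 R4 where R34: "R2 = R3 @ d' # R4" by (meson split_list)
    let ?vs = "x # A0 @ b # (d' # rev R3) @ d # rev R1 @ c # []"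
    have "successively E ([] @ (c # R1 @ [d]) @ R2)" "successively E ((c # R1) @ (d # R3 @ [d']) @ R4)" 
      using succ(3) unfolding R R34 by simp_all
    then have "successively E (c # R1 @ [d])" "successively E (d # R3 @ [d'])" 
      by (blast dest: successively_infix)+
    then have "successively E (d # rev R1 @ [c])" "successively E (d' # rev R3 @ [d])"
      using revs by fastforce+
    then have "successively E (d # rev R1 @ [c])" "successively E (b # (d' # rev R3) @ [d])"
      using d'(2) by simp_all
    moreover have "distinct ?vs" "set ?vs \<subseteq> S" using dist R R34 by auto
    ultimately have "crossed_cycle E ?vs"
      using succ(1,2) sym[OF lo(3)] d(2) by (intro crossed_cycleI) simp_all
    then show ?thesis using \<open>set ?vs \<subseteq> S\<close> by blast
  qed
qed

locale outer_drawing =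
  fixes G :: "'v pair_pre_digraph" and p :: "'v \<Rightarrow> complex" and \<gamma> :: "'v \<times> 'v \<Rightarrow> real \<Rightarrow> complex"
  assumes graph: "pair_graph G"
    and drawing: "plane_drawing G p \<gamma>"
    and outer: "p ` pverts G \<subseteq> frontier (outside (drawing_image G p \<gamma>))"
begin

definition walk_image :: "'v list \<Rightarrow> complex set" where
  "walk_image vs = (\<Union>e \<in> set (zip vs (tl vs)). path_image (\<gamma> e))"

abbreviation adj :: "'v \<Rightarrow> 'v \<Rightarrow> bool" where
  "adj u v \<equiv> (u, v) \<in> parcs G"

lemma adj_verts: "adj u v \<Longrightarrow> u \<in> pverts G \<and> v \<in> pverts G"
  using graph by (auto simp: pair_graph_def pair_digraph_def pair_fin_digraph_def pair_wf_digraph_def)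

lemma adj_irrefl: "\<not> adj u u"
  using graph by (auto simp: pair_graph_def pair_digraph_def pair_loopfree_digraph_def
      pair_loopfree_digraph_axioms_def)

lemma edge_arc:
  assumes "adj u v"
  shows "arc (\<gamma> (u, v))" "pathstart (\<gamma> (u, v)) = p u" "pathfinish (\<gamma> (u, v)) = p v"
    "path_image (\<gamma> (u, v)) \<inter> p ` pverts G = {p u, p v}"
proof -
  have "\<forall>(u, v) \<in> parcs G. arc (\<gamma> (u, v)) \<and> pathstart (\<gamma> (u, v)) = p u \<and> pathfinish (\<gamma> (u, v)) = p v \<and>
      \<gamma> (v, u) = reversepath (\<gamma> (u, v)) \<and> path_image (\<gamma> (u, v)) \<inter> p ` pverts G = {p u, p v}"
    using drawing unfolding plane_drawing_def by (elim conjE)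
  from bspec[OF this assms] show "arc (\<gamma> (u, v))" "pathstart (\<gamma> (u, v)) = p u"
    "pathfinish (\<gamma> (u, v)) = p v" "path_image (\<gamma> (u, v)) \<inter> p ` pverts G = {p u, p v}"
    by simp_all
qed

lemma inj_p: "inj_on p (pverts G)"
  using drawing by (simp add: plane_drawing_def)

lemma edge_images_meet:
  assumes "adj u v" "adj x y" "{u, v} \<noteq> {x, y}"
  shows "path_image (\<gamma> (u, v)) \<inter> path_image (\<gamma> (x, y)) = p ` ({u, v} \<inter> {x, y})"
proof -
  have "path_image (\<gamma> (u, v)) \<inter> path_image (\<gamma> (x, y)) \<subseteq> p ` pverts G"
    using drawing assms unfolding plane_drawing_def by blast
  then have "path_image (\<gamma> (u, v)) \<inter> path_image (\<gamma> (x, y)) = {p u, p v} \<inter> {p x, p y}"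
    using edge_arc(4)[OF assms(1)] edge_arc(4)[OF assms(2)] by blast
  also have "\<dots> = p ` ({u, v} \<inter> {x, y})"
    using inj_on_image_Int[OF inj_p, of "{u, v}" "{x, y}"] adj_verts[OF assms(1)] adj_verts[OF assms(2)]
    by simp
  finally show ?thesis .
qed

lemma walk_image_Cons: "walk_image (u # v # vs) = path_image (\<gamma> (u, v)) \<union> walk_image (v # vs)"
  by (simp add: walk_image_def)

lemma zip_tl_adj:
  assumes "successively adj vs" "e \<in> set (zip vs (tl vs))"
  shows "e \<in> parcs G" "fst e \<in> set vs" "snd e \<in> set vs"
proof -
  obtain i where "i < length (zip vs (tl vs))" "e = zip vs (tl vs) ! i"
    using assms(2) by (metis in_set_conv_nth)
  then have i: "Suc i < length vs" "e = (vs ! i, vs ! Suc i)"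
    by (auto simp: nth_tl)
  then show "e \<in> parcs G" using assms(1) by (simp add: successively_conv_nth)
  show "fst e \<in> set vs" "snd e \<in> set vs" using i by auto
qed

lemma vertex_in_walk_image:
  assumes "successively adj vs" "length vs \<ge> 2" "v \<in> set vs"
  shows "p v \<in> walk_image vs"
  using assms
proof (induction vs)
  case (Cons x vs)
  then obtain y ws where vs: "vs = y # ws" by (cases vs) auto
  with Cons have "adj x y" by simp
  then have xy: "p x \<in> path_image (\<gamma> (x, y))" "p y \<in> path_image (\<gamma> (x, y))"
    using edge_arc[OF \<open>adj x y\<close>] by blast+
  show ?case
  proof (cases "v = x \<or> v = y")
    case True
    then show ?thesis using xy vs by (auto simp: walk_image_Cons)
  next
    case False
    then have "v \<in> set vs" "length vs \<ge> 2" using Cons.prems vs by (auto, cases ws, auto)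
    then show ?thesis using Cons vs by (simp add: walk_image_Cons)
  qed
qed simp

text \<open>
  Curves of distinct edges meet only in common ends, so edge-disjoint walks meet only in common
  vertices.
\<close>

lemma walk_images_meet:
  assumes "successively adj vs" "length vs \<ge> 2" "successively adj ws" "length ws \<ge> 2"
    and "\<And>u v x y. (u, v) \<in> set (zip vs (tl vs)) \<Longrightarrow> (x, y) \<in> set (zip ws (tl ws)) \<Longrightarrow> {u, v} \<noteq> {x, y}"
  shows "walk_image vs \<inter> walk_image ws = p ` (set vs \<inter> set ws)"
proof
  show "walk_image vs \<inter> walk_image ws \<subseteq> p ` (set vs \<inter> set ws)"
  proof
    fix z assume "z \<in> walk_image vs \<inter> walk_image ws"
    then obtain u v x y where uv: "(u, v) \<in> set (zip vs (tl vs))" "z \<in> path_image (\<gamma> (u, v))"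
      and xy: "(x, y) \<in> set (zip ws (tl ws))" "z \<in> path_image (\<gamma> (x, y))"
      unfolding walk_image_def by auto
    have "z \<in> p ` ({u, v} \<inter> {x, y})"
      using edge_images_meet[of u v x y] uv xy assms zip_tl_adj(1) by blast
    then show "z \<in> p ` (set vs \<inter> set ws)"
      using zip_tl_adj(2,3)[OF assms(1) uv(1)] zip_tl_adj(2,3)[OF assms(3) xy(1)] by auto
  qed
  show "p ` (set vs \<inter> set ws) \<subseteq> walk_image vs \<inter> walk_image ws"
    using vertex_in_walk_image assms by auto
qed

lemma walk_images_meet_single:
  assumes "successively adj vs" "length vs \<ge> 2" "successively adj ws" "length ws \<ge> 2"
    and "set vs \<inter> set ws \<subseteq> {z}"
  shows "walk_image vs \<inter> walk_image ws = p ` (set vs \<inter> set ws)"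
proof (rule walk_images_meet[OF assms(1-4)])
  fix u v x y assume uv: "(u, v) \<in> set (zip vs (tl vs))" and xy: "(x, y) \<in> set (zip ws (tl ws))"
  have "u \<noteq> v" using zip_tl_adj(1)[OF assms(1) uv] adj_irrefl by auto
  then show "{u, v} \<noteq> {x, y}"
    using zip_tl_adj(2,3)[OF assms(1) uv] zip_tl_adj(2,3)[OF assms(3) xy] assms(5)
    by (auto simp: doubleton_eq_iff)
qed

lemma walk_arc:
  assumes "successively adj vs" "length vs \<ge> 2" "distinct vs"
  obtains g where "arc g" "pathstart g = p (hd vs)" "pathfinish g = p (last vs)"
    "path_image g = walk_image vs"
proof -
  have "\<exists>g. arc g \<and> pathstart g = p (hd vs) \<and> pathfinish g = p (last vs) \<and> path_image g = walk_image vs"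
    using assms
  proof (induction vs)
    case (Cons x vs)
    then obtain y ws where vs: "vs = y # ws" by (cases vs) auto
    with Cons have "adj x y" by simp
    note e = edge_arc[OF this]
    show ?case
    proof (cases ws)
      case Nil
      then show ?thesis using e vs by (intro exI[of _ "\<gamma> (x, y)"]) (simp add: walk_image_def)
    next
      case (Cons w ws')
      then have prem: "successively adj vs" "length vs \<ge> 2" "distinct vs" using Cons.prems vs by auto
      from Cons.IH[OF this] obtain g where g: "arc g" "pathstart g = p y" "pathfinish g = p (last vs)"
        "path_image g = walk_image vs"
        using vs by auto
      have "walk_image [x, y] \<inter> walk_image vs = p ` (set [x, y] \<inter> set vs)"
        using Cons.prems vs prem \<open>adj x y\<close>
        by (intro walk_images_meet_single[where z = y]) auto
      also have "\<dots> = {p y}" using Cons.prems vs by auto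
      finally have "path_image (\<gamma> (x, y)) \<inter> path_image g = {p y}"
        using g by (simp add: walk_image_def)
      then have "arc (\<gamma> (x, y) +++ g)" using e g by (intro arc_join) auto
      then show ?thesis using e g vs
        by (intro exI[of _ "\<gamma> (x, y) +++ g"]) (simp add: path_image_join walk_image_Cons)
    qed
  qed simp
  then show ?thesis using that by blast
qed

lemma walk_image_subset:
  assumes "successively adj vs"
  shows "walk_image vs \<subseteq> drawing_image G p \<gamma>"
  using zip_tl_adj(1)[OF assms] by (fastforce simp: walk_image_def drawing_image_def)

lemma no_crossed_cycle: "\<not> crossed_cycle adj vs"
proof
  assume "crossed_cycle adj vs"
  then obtain a A b B c C d D where vs: "vs = a # A @ b # B @ c # C @ d # D" "distinct vs"
    and w4: "successively adj (a # A @ [b])" "successively adj (b # B @ [c])"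
      "successively adj (c # C @ [d])" "successively adj (d # D @ [a])"
    and ac: "adj a c" and bd: "adj b d"
    unfolding crossed_cycle_def by blast
  let ?ab = "a # A @ [b]" and ?bc = "b # B @ [c]" and ?cd = "c # C @ [d]" and ?da = "d # D @ [a]"
  let ?ac = "[a, c]" and ?bd = "[b, d]"
  have w: "successively adj ?ab" "successively adj ?bc" "successively adj ?cd" "successively adj ?da"
    "successively adj ?ac" "successively adj ?bd"
    using w4 ac bd by simp_all
  have len: "length ?ab \<ge> 2" "length ?bc \<ge> 2" "length ?cd \<ge> 2" "length ?da \<ge> 2"
    "length ?ac \<ge> 2" "length ?bd \<ge> 2" by auto
  have dist: "distinct ?ab" "distinct ?bc" "distinct ?cd" "distinct ?da" "distinct ?ac" "distinct ?bd"
    using vs(2) unfolding vs(1) by auto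
  note arcs = walk_arc[OF w(1) len(1) dist(1)] walk_arc[OF w(2) len(2) dist(2)]
    walk_arc[OF w(3) len(3) dist(3)] walk_arc[OF w(4) len(4) dist(4)]
    walk_arc[OF w(5) len(5) dist(5)] walk_arc[OF w(6) len(6) dist(6)]
  obtain gab where gab: "arc gab" "pathstart gab = p a" "pathfinish gab = p b" "path_image gab = walk_image ?ab"
    using arcs(1) by auto
  obtain gbc where gbc: "arc gbc" "pathstart gbc = p b" "pathfinish gbc = p c" "path_image gbc = walk_image ?bc"
    using arcs(2) by auto
  obtain gcd where gcd: "arc gcd" "pathstart gcd = p c" "pathfinish gcd = p d" "path_image gcd = walk_image ?cd"
    using arcs(3) by auto
  obtain gda where gda: "arc gda" "pathstart gda = p d" "pathfinish gda = p a" "path_image gda = walk_image ?da"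
    using arcs(4) by auto
  obtain gac where gac: "arc gac" "pathstart gac = p a" "pathfinish gac = p c" "path_image gac = walk_image ?ac"
    using arcs(5) by auto
  obtain gbd where gbd: "arc gbd" "pathstart gbd = p b" "pathfinish gbd = p d" "path_image gbd = walk_image ?bd"
    using arcs(6) by auto
  have verts: "{a, b, c, d} \<subseteq> pverts G" using adj_verts[OF ac] adj_verts[OF bd] by auto
  have abcd: "distinct [a, b, c, d]" using vs(2) unfolding vs(1) by auto
  have pd: "distinct [p a, p b, p c, p d]"
    using abcd verts inj_p by (auto simp: inj_on_def)
  let ?W = "{?ab, ?bc, ?cd, ?da, ?ac, ?bd}"
  have W: "successively adj us \<and> length us \<ge> 2" if "us \<in> ?W" for us
    using that w len by blast
  have meet: "walk_image us \<inter> walk_image ws = {p z}"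
    if "set us \<inter> set ws = {z}" "us \<in> ?W" "ws \<in> ?W" for us ws z
    using walk_images_meet_single[of us ws z] W[OF that(2)] W[OF that(3)] that(1) by simp
  have disj: "walk_image us \<inter> walk_image ws = {}"
    if "set us \<inter> set ws = {}" "us \<in> ?W" "ws \<in> ?W" for us ws
    using walk_images_meet_single[of us ws a] W[OF that(2)] W[OF that(3)] that(1) by simp
  have sets: "set ?ab \<inter> set ?bc = {b}" "set ?bc \<inter> set ?cd = {c}" "set ?cd \<inter> set ?da = {d}"
    "set ?da \<inter> set ?ab = {a}" "set ?ac \<inter> set ?ab = {a}" "set ?ac \<inter> set ?da = {a}"
    "set ?ac \<inter> set ?bc = {c}" "set ?ac \<inter> set ?cd = {c}" "set ?bd \<inter> set ?ab = {b}"
    "set ?bd \<inter> set ?bc = {b}" "set ?bd \<inter> set ?cd = {d}" "set ?bd \<inter> set ?da = {d}"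
    "set ?ab \<inter> set ?cd = {}" "set ?bc \<inter> set ?da = {}" "set ?ac \<inter> set ?bd = {}"
    using vs(2) unfolding vs(1) by auto
  show False
  proof (rule no_crossing_chords_with_outer_ends[OF pd gab(1-3) gbc(1-3) gcd(1-3) gda(1-3)
        gac(1-3) gbd(1-3)])
    show "path_image gab \<inter> path_image gbc = {p b}"
      unfolding gab gbc by (rule meet[OF sets(1)]) simp_all
    show "path_image gbc \<inter> path_image gcd = {p c}"
      unfolding gbc gcd by (rule meet[OF sets(2)]) simp_all
    show "path_image gcd \<inter> path_image gda = {p d}"
      unfolding gcd gda by (rule meet[OF sets(3)]) simp_all
    show "path_image gda \<inter> path_image gab = {p a}"
      unfolding gda gab by (rule meet[OF sets(4)]) simp_all
    show "path_image gac \<inter> path_image gab = {p a}"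
      unfolding gac gab by (rule meet[OF sets(5)]) simp_all
    show "path_image gac \<inter> path_image gda = {p a}"
      unfolding gac gda by (rule meet[OF sets(6)]) simp_all
    show "path_image gac \<inter> path_image gbc = {p c}"
      unfolding gac gbc by (rule meet[OF sets(7)]) simp_all
    show "path_image gac \<inter> path_image gcd = {p c}"
      unfolding gac gcd by (rule meet[OF sets(8)]) simp_all
    show "path_image gbd \<inter> path_image gab = {p b}"
      unfolding gbd gab by (rule meet[OF sets(9)]) simp_all
    show "path_image gbd \<inter> path_image gbc = {p b}"
      unfolding gbd gbc by (rule meet[OF sets(10)]) simp_all
    show "path_image gbd \<inter> path_image gcd = {p d}"
      unfolding gbd gcd by (rule meet[OF sets(11)]) simp_all
    show "path_image gbd \<inter> path_image gda = {p d}"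
      unfolding gbd gda by (rule meet[OF sets(12)]) simp_all
    show "path_image gab \<inter> path_image gcd = {}"
      unfolding gab gcd by (rule disj[OF sets(13)]) simp_all
    show "path_image gbc \<inter> path_image gda = {}"
      unfolding gbc gda by (rule disj[OF sets(14)]) simp_all
    show "path_image gac \<inter> path_image gbd = {}"
      unfolding gac gbd by (rule disj[OF sets(15)]) simp_all
    show "path_image gab \<union> path_image gbc \<union> path_image gcd \<union> path_image gda \<union>
      path_image gac \<union> path_image gbd \<subseteq> drawing_image G p \<gamma>"
      unfolding gab gbc gcd gda gac gbd using walk_image_subset w by (simp only: Un_subset_iff)
    show "{p a, p b, p c, p d} \<subseteq> frontier (outside (drawing_image G p \<gamma>))"
      using outer verts by auto
  qed
qed

text \<open>
  Three paths of length two between \<open>u\<close> and \<open>v\<close> form a theta curve with a vertex inside each arc.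
\<close>

lemma no_K23:
  assumes "u \<noteq> v" "distinct [x, y, z]" "\<And>w. w \<in> {x, y, z} \<Longrightarrow> adj u w \<and> adj w v"
  shows False
proof -
  have ne: "x \<noteq> u" "y \<noteq> u" "z \<noteq> u" "x \<noteq> v" "y \<noteq> v" "z \<noteq> v"
    using assms(3) adj_irrefl by blast+
  have w: "successively adj [u, w, v] \<and> distinct [u, w, v] \<and> length [u, w, v] \<ge> 2"
    if "w \<in> {x, y, z}" for w
    using assms(1,3) ne that by auto
  have "\<exists>g. arc g \<and> pathstart g = p u \<and> pathfinish g = p v \<and> path_image g = walk_image [u, w, v]"
    if "w \<in> {x, y, z}" for w
    using walk_arc[of "[u, w, v]"] w[OF that] by (metis last.simps list.sel(1) list.simps(3))
  then obtain g where g: "\<And>w. w \<in> {x, y, z} \<Longrightarrow>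
      arc (g w) \<and> pathstart (g w) = p u \<and> pathfinish (g w) = p v \<and> path_image (g w) = walk_image [u, w, v]"
    by metis
  have meet: "path_image (g w) \<inter> path_image (g w') = {p u, p v}"
    if "w \<in> {x, y, z}" "w' \<in> {x, y, z}" "w \<noteq> w'" for w w'
  proof -
    have "walk_image [u, w, v] \<inter> walk_image [u, w', v] = p ` (set [u, w, v] \<inter> set [u, w', v])"
      using w[OF that(1)] w[OF that(2)] that(3)
      by (intro walk_images_meet) (auto simp: doubleton_eq_iff)
    also have "set [u, w, v] \<inter> set [u, w', v] = {u, v}" using that(3) w[OF that(1)] w[OF that(2)] by auto
    finally show ?thesis using g that by simp
  qed
  have verts: "u \<in> pverts G" "v \<in> pverts G" "w \<in> {x, y, z} \<Longrightarrow> w \<in> pverts G" for w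
    using assms(3) adj_verts by blast+
  have mid: "p w \<in> path_image (g w) - {p u, p v}" if "w \<in> {x, y, z}" for w
  proof -
    have "p w \<in> path_image (g w)"
      using vertex_in_walk_image[of "[u, w, v]" w] w[OF that] g[OF that] by simp
    moreover have "w \<noteq> u" "w \<noteq> v" using w[OF that] by auto
    then have "p w \<noteq> p u" "p w \<noteq> p v"
      using inj_onD[OF inj_p _ verts(3)[OF that]] verts(1,2) by blast+
    ultimately show ?thesis by simp
  qed
  have D: "path_image (g w) \<subseteq> drawing_image G p \<gamma>" if "w \<in> {x, y, z}" for w
    using walk_image_subset[of "[u, w, v]"] w[OF that] g[OF that] by simp
  have mem: "x \<in> {x, y, z}" "y \<in> {x, y, z}" "z \<in> {x, y, z}" by simp_all
  have "x \<noteq> y" "x \<noteq> z" "y \<noteq> z" using assms(2) by simp_all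
  note gx = g[OF mem(1)] and gy = g[OF mem(2)] and gz = g[OF mem(3)]
  show False
  proof (rule no_theta_with_three_outer_points)
    show "arc (g x)" "pathstart (g x) = p u" "pathfinish (g x) = p v"
      "arc (g y)" "pathstart (g y) = p u" "pathfinish (g y) = p v"
      "arc (g z)" "pathstart (g z) = p u" "pathfinish (g z) = p v"
      using gx gy gz by simp_all
    show "path_image (g x) \<inter> path_image (g y) = {p u, p v}"
      by (rule meet[OF mem(1,2) \<open>x \<noteq> y\<close>])
    show "path_image (g x) \<inter> path_image (g z) = {p u, p v}"
      by (rule meet[OF mem(1,3) \<open>x \<noteq> z\<close>])
    show "path_image (g y) \<inter> path_image (g z) = {p u, p v}"
      by (rule meet[OF mem(2,3) \<open>y \<noteq> z\<close>])
    show "path_image (g x) \<union> path_image (g y) \<union> path_image (g z) \<subseteq> drawing_image G p \<gamma>"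
      using D[OF mem(1)] D[OF mem(2)] D[OF mem(3)] by (simp only: Un_subset_iff)
    show "p x \<in> path_image (g x) - {p u, p v}" "p y \<in> path_image (g y) - {p u, p v}"
      "p z \<in> path_image (g z) - {p u, p v}"
      by (rule mid[OF mem(1)] mid[OF mem(2)] mid[OF mem(3)])+
    show "{p x, p y, p z} \<subseteq> frontier (outside (drawing_image G p \<gamma>))"
      using outer verts(3)[OF mem(1)] verts(3)[OF mem(2)] verts(3)[OF mem(3)] by auto
  qed
qed

end

text \<open>
  All that is needed of an outerplanar graph. The two counting conditions are inherited by induced subgraphs.
\<close>

locale outer_graph =
  fixes V :: "'v set" and E :: "'v \<Rightarrow> 'v \<Rightarrow> bool"
  assumes finite_V: "finite V"
    and E_sym: "E u v \<Longrightarrow> E v u"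
    and E_irrefl: "\<not> E u u"
    and common_nbrs: "u \<noteq> v \<Longrightarrow> card {w \<in> V. E u w \<and> E v w} \<le> 2"
    and low_degree: "S \<subseteq> V \<Longrightarrow> S \<noteq> {} \<Longrightarrow> \<exists>v \<in> S. card {w \<in> S. E v w} \<le> 2"

lemma outer_graph_if_outerplanar:
  assumes "pair_graph G" "outerplanar G"
  shows "outer_graph (pverts G) (\<lambda>u v. (u, v) \<in> parcs G)"
proof -
  obtain p \<gamma> where "outer_drawing G p \<gamma>"
    using assms by (auto simp: outerplanar_def outer_drawing_def)
  then interpret outer_drawing G p \<gamma> .
  have sym: "adj v u" if "adj u v" for u v
    using graph that by (auto simp: pair_graph_def pair_pseudo_graph_def pair_sym_digraph_def
        pair_sym_digraph_axioms_def symmetric_def sym_def)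
  show ?thesis
  proof
    show fin: "finite (pverts G)"
      using graph by (simp add: pair_graph_def pair_digraph_def pair_fin_digraph_def
          pair_fin_digraph_axioms_def)
    show "adj u v \<Longrightarrow> adj v u" for u v by (rule sym)
    show "\<not> adj u u" for u by (rule adj_irrefl)
    show "card {w \<in> pverts G. adj u w \<and> adj v w} \<le> 2" if "u \<noteq> v" for u v
    proof (rule ccontr)
      assume "\<not> ?thesis"
      then have "3 \<le> card {w \<in> pverts G. adj u w \<and> adj v w}" by simp
      then obtain T where T: "T \<subseteq> {w \<in> pverts G. adj u w \<and> adj v w}" "card T = 3"
        by (meson obtain_subset_with_card_n)
      then obtain x y z where "T = {x, y, z}" "x \<noteq> y" "x \<noteq> z" "y \<noteq> z" by (auto simp: card_3_iff)
      then show False using no_K23[OF that, of x y z] T sym by auto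
    qed
    show "\<exists>v \<in> S. card {w \<in> S. adj v w} \<le> 2" if "S \<subseteq> pverts G" "S \<noteq> {}" for S
    proof (rule ccontr)
      assume "\<not> ?thesis"
      then have "card {w \<in> S. adj v w} \<ge> 3" if "v \<in> S" for v using that by force
      then show False
        using crossed_cycle_if_degrees_ge_3[of adj S] sym adj_irrefl that fin finite_subset
          no_crossed_cycle by blast
    qed
  qed
qed

section \<open>The spectral theorem for real symmetric matrices\<close>

text \<open>
  Gram--Schmidt applied to a basis starting with \<open>v\<close>, normalised afterwards.
\<close>

lemma orthonormal_completion:
  fixes v :: "real Matrix.vec"
  assumes v: "v \<in> carrier_vec n" and v0: "v \<noteq> 0\<^sub>v n"
  obtains W c where "W \<in> carrier_mat n n" "transpose_mat W * W = 1\<^sub>m n" "W * transpose_mat W = 1\<^sub>m n"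
    "Matrix.col W 0 = c \<cdot>\<^sub>v v"
proof -
  interpret cof_vec_space n "TYPE(real)" .
  have n: "n > 0" using v v0 by (cases n) auto
  define b where "b = basis_completion v"
  define ws where "ws = gram_schmidt n b"
  have span_b: "span (set b) = carrier_vec n" and dist_b: "distinct b" 
    and indep: "\<not> lin_dep (set b)" and b: "set b \<subseteq> carrier_vec n" and hdb: "hd b = v" 
    and len_b: "length b = n"
    using basis_completion[OF v v0] by (auto simp: b_def)
  obtain vs where bv: "b = v # vs" using hdb len_b n by (cases b) auto
  have ws: "set ws \<subseteq> carrier_vec n" "corthogonal ws" "length ws = n"
    using gram_schmidt_result[OF b dist_b indep ws_def] by (auto simp: len_b)
  have "hd ws = v" using gram_schmidt_hd[OF v, of vs] by (simp add: ws_def bv)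
  then have hdws: "ws ! 0 = v" using ws(3) n hd_conv_nth[of ws] by (cases ws) auto
  have wsi: "ws ! i \<in> carrier_vec n" if "i < n" for i using ws that by auto
  have orth: "ws ! i \<bullet> ws ! j = 0 \<longleftrightarrow> i \<noteq> j" if "i < n" "j < n" for i j
    using corthogonalD[OF ws(2), of i j] that ws(3) by simp
  have pos: "ws ! i \<bullet> ws ! i > 0" if "i < n" for i
    using orth[OF that that] sum_nonneg[of "{0..<n}" "\<lambda>k. ws ! i $ k * ws ! i $ k"] wsi[OF that]
    by (simp add: scalar_prod_def order_less_le)
  define us where "us = map (\<lambda>w. (1 / sqrt (w \<bullet> w)) \<cdot>\<^sub>v w) ws"
  define W where "W = mat_of_cols n us"
  have len: "length us = n" using ws by (simp add: us_def)
  have usi: "us ! i = (1 / sqrt (ws ! i \<bullet> ws ! i)) \<cdot>\<^sub>v ws ! i" "us ! i \<in> carrier_vec n" if "i < n" for i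
    using that ws wsi[OF that] by (simp_all add: us_def)
  have Wc: "W \<in> carrier_mat n n" using mat_of_cols_carrier(1)[of n us] by (simp add: W_def len)
  have colW: "Matrix.col W i = us ! i" if "i < n" for i
    using that len usi(2)[OF that] by (simp add: W_def)
  have uu: "us ! i \<bullet> us ! j = (if i = j then 1 else 0)" if "i < n" "j < n" for i j
    using usi[OF that(1)] usi[OF that(2)] orth[OF that] pos[OF that(1)] wsi that
    by (auto simp: smult_scalar_prod_distrib[of _ n] scalar_prod_smult_distrib[of _ n])
  have WW: "transpose_mat W * W = 1\<^sub>m n"
    using Wc colW uu by (intro eq_matI) (auto simp: scalar_prod_def)
  moreover have "W * transpose_mat W = 1\<^sub>m n"
    using mat_mult_left_right_inverse[OF _ Wc WW] Wc by simp
  moreover have "Matrix.col W 0 = (1 / sqrt (v \<bullet> v)) \<cdot>\<^sub>v v"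
    using colW[OF n] usi(1)[OF n] hdws by simp
  ultimately show ?thesis using that Wc by blast
qed

text \<open>
  Conjugating with an orthogonal matrix whose first column is a multiple of an eigenvector clears
  the first column; by symmetry the first row is cleared as well, and the remaining
  block is again symmetric. The eigenvalues may be prescribed in any order.
\<close>

lemma symmetric_orthogonal_diagonalization:
  fixes A :: "real Matrix.mat"
  assumes "A \<in> carrier_mat n n" "transpose_mat A = A" "char_poly A = (\<Prod>e \<leftarrow> es. [:- e, 1:])"
  shows "\<exists>P. P \<in> carrier_mat n n \<and> transpose_mat P * P = 1\<^sub>m n \<and>
    A * P = P * Matrix.mat n n (\<lambda>(i, j). if i = j then es ! i else 0)"
  using assms
proof (induction es arbitrary: n A)
  case Nil
  then have "n = 0" using degree_monic_char_poly[of A n] by simp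
  then show ?case using Nil by (intro exI[of _ "1\<^sub>m 0"]) auto
next
  case (Cons e es n A)
  note A = Cons.prems(1) and sym = Cons.prems(2)
  have cp: "char_poly A = [:- e, 1:] * (\<Prod>e \<leftarrow> es. [:- e, 1:])" using Cons.prems(3) by simp
  have "monic (\<Prod>e\<leftarrow> es. [:- e, 1:])" by (rule monic_prod_list) auto
  then have "degree (char_poly A) = Suc (degree (\<Prod>e\<leftarrow> es. [:- e, 1:]))"
    unfolding cp by (subst degree_mult_eq) auto
  then obtain m where n: "n = Suc m" using degree_monic_char_poly[OF A] by (cases n) auto
  have "eigenvalue A e" unfolding eigenvalue_root_char_poly[OF A] cp by simp
  then obtain v where v: "v \<in> carrier_vec n" "v \<noteq> 0\<^sub>v n" "A *\<^sub>v v = e \<cdot>\<^sub>v v"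
    using A unfolding eigenvalue_def eigenvector_def by auto
  obtain W c where W: "W \<in> carrier_mat n n" "transpose_mat W * W = 1\<^sub>m n" "W * transpose_mat W = 1\<^sub>m n"
    "Matrix.col W 0 = c \<cdot>\<^sub>v v"
    using orthonormal_completion[OF v(1,2)] by blast
  let ?Wt = "transpose_mat W"
  have Wt: "?Wt \<in> carrier_mat n n" using W by simp
  define A' where "A' = ?Wt * A * W"
  have A': "A' \<in> carrier_mat n n" using A W by (simp add: A'_def)
  have AW: "A * W = W * A'"
  proof -
    have "W * A' = W * (?Wt * (A * W))" using A W Wt by (simp add: A'_def)
    also have "\<dots> = (W * ?Wt) * (A * W)" using A W(1) Wt assoc_mult_mat[OF W(1) Wt, of "A * W" n] by simp
    finally show ?thesis using W A by simp
  qed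
  have sym': "transpose_mat A' = A'"
    using A W Wt sym by (simp add: A'_def transpose_mult[of _ n n _ n])
  have "A *\<^sub>v Matrix.col W 0 = e \<cdot>\<^sub>v Matrix.col W 0"
    using A v W by (simp add: mult_mat_vec[OF A v(1)] smult_smult_assoc mult.commute)
  then have colAW: "Matrix.col (A * W) 0 = e \<cdot>\<^sub>v Matrix.col W 0"
    using col_mult2[OF A W(1), of 0] n by (simp only: zero_less_Suc)
  have AWc: "A * W \<in> carrier_mat n n" using A W by simp
  have "Matrix.col A' 0 = Matrix.col (?Wt * (A * W)) 0"
    using assoc_mult_mat[OF Wt A W(1)] by (simp only: A'_def)
  also have "\<dots> = ?Wt *\<^sub>v Matrix.col (A * W) 0"
    using n by (intro col_mult2[OF Wt AWc]) simp
  also have "\<dots> = ?Wt *\<^sub>v (e \<cdot>\<^sub>v Matrix.col W 0)" by (simp only: colAW)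
  also have "\<dots> = e \<cdot>\<^sub>v (?Wt *\<^sub>v Matrix.col W 0)"
    using Wt col_dim[of W 0] W(1) by (intro mult_mat_vec[of _ n n]) (simp_all only: carrier_matD)
  also have "?Wt *\<^sub>v Matrix.col W 0 = Matrix.col (?Wt * W) 0" using col_mult2[OF Wt W(1), of 0] n by simp
  also have "\<dots> = unit_vec n 0" using W n by simp
  finally have col0: "Matrix.col A' 0 = e \<cdot>\<^sub>v unit_vec n 0" .
  have A'0: "A' $$ (i, 0) = (if i = 0 then e else 0)" if "i < n" for i
  proof -
    have "A' $$ (i, 0) = Matrix.col A' 0 $ i" using A' that n by simp
    then show ?thesis using col0 that n by (simp add: unit_vec_def)
  qed
  have A'0': "A' $$ (0, i) = (if i = 0 then e else 0)" if "i < n" for i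
  proof -
    have "A' $$ (0, i) = transpose_mat A' $$ (i, 0)" using A' that n by simp
    then show ?thesis using A'0[OF that] sym' by simp
  qed
  define B where "B = Matrix.mat m m (\<lambda>(i, j). A' $$ (Suc i, Suc j))"
  let ?e = "Matrix.mat 1 1 (\<lambda>_. e)"
  have B: "B \<in> carrier_mat m m" by (simp add: B_def)
  have A'_block: "A' = four_block_mat ?e (0\<^sub>m 1 m) (0\<^sub>m m 1) B"
    using A' A'0 A'0' n by (intro eq_matI) (auto simp: B_def)
  have symB: "transpose_mat B = B"
  proof (intro eq_matI)
    fix i j assume ij: "i < dim_row B" "j < dim_col B"
    have "A' $$ (Suc j, Suc i) = transpose_mat A' $$ (Suc i, Suc j)"
      using A' n ij B by (subst index_transpose_mat) auto
    then show "transpose_mat B $$ (i, j) = B $$ (i, j)"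
      using ij sym' by (simp add: B_def)
  qed (simp_all add: B_def)
  have "similar_mat A' A"
    unfolding similar_mat_def
    by (intro exI[of _ ?Wt] exI[of _ W] similar_mat_witI[of _ _ n]) (use A W Wt A' in \<open>auto simp: A'_def\<close>)
  then have "char_poly A' = char_poly A" by (rule char_poly_similar)
  moreover have "char_poly A' = char_poly ?e * char_poly B"
    unfolding A'_block by (rule char_poly_four_block_zeros_col) (use B in auto)
  moreover have "char_poly ?e = [:- e, 1:]"
    by (simp add: char_poly_defs det_def sign_def)
  ultimately have "char_poly B = (\<Prod>e\<leftarrow>es. [:- e, 1:])"
    using cp by (metis mult_cancel_left pCons_eq_0_iff zero_neq_one)
  from Cons.IH[OF B symB this] obtain Q where Q: "Q \<in> carrier_mat m m"
    "transpose_mat Q * Q = 1\<^sub>m m" "B * Q = Q * Matrix.mat m m (\<lambda>(i, j). if i = j then es ! i else 0)" by auto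
  let ?D = "Matrix.mat m m (\<lambda>(i, j). if i = j then es ! i else 0)"
  let ?F = "Matrix.mat n n (\<lambda>(i, j). if i = j then (e # es) ! i else 0)"
  let ?P = "four_block_mat (1\<^sub>m 1) (0\<^sub>m 1 m) (0\<^sub>m m 1) Q"
  have P: "?P \<in> carrier_mat n n" using four_block_carrier_mat[of "1\<^sub>m 1" 1 1 Q m m] Q(1) n by simp
  have F: "?F = four_block_mat ?e (0\<^sub>m 1 m) (0\<^sub>m m 1) ?D"
    using n by (intro eq_matI) (auto simp: nth_Cons')
  have PtP: "transpose_mat ?P * ?P = 1\<^sub>m n"
  proof -
    have "transpose_mat ?P = four_block_mat (1\<^sub>m 1) (0\<^sub>m 1 m) (0\<^sub>m m 1) (transpose_mat Q)"
      using Q by (subst transpose_four_block_mat[of _ 1 1 _ m _ m]) auto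
    then have "transpose_mat ?P * ?P = four_block_mat (1\<^sub>m 1) (0\<^sub>m 1 m) (0\<^sub>m m 1) (1\<^sub>m m)"
      using Q by (simp add: mult_four_block_mat[of _ 1 1 _ m _ m _ _ 1 _ m])
    then show ?thesis using n by simp
  qed
  have AP: "A' * ?P = ?P * ?F"
    unfolding A'_block F using Q B
    by (simp add: mult_four_block_mat[of _ 1 1 _ m _ m _ _ 1 _ m])
  have Fc: "?F \<in> carrier_mat n n" by simp
  have "transpose_mat (W * X) * (W * X) = transpose_mat X * X" if X: "X \<in> carrier_mat n n" for X
  proof -
    have XT: "transpose_mat X \<in> carrier_mat n n" and WX: "W * X \<in> carrier_mat n n" using X W(1) by simp_all
    have "transpose_mat (W * X) * (W * X) = (transpose_mat X * ?Wt) * (W * X)"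
      by (simp only: transpose_mult[OF W(1) X])
    also have "\<dots> = transpose_mat X * (?Wt * (W * X))" by (rule assoc_mult_mat[OF XT Wt WX])
    also have "?Wt * (W * X) = (?Wt * W) * X" by (rule assoc_mult_mat[OF Wt W(1) X, symmetric])
    also have "\<dots> = X" using W(2) X by simp
    finally show ?thesis .
  qed
  from this[OF P] PtP have "transpose_mat (W * ?P) * (W * ?P) = 1\<^sub>m n" by (simp only:)
  moreover have "A * (W * ?P) = (W * ?P) * ?F"
  proof -
    have "A * (W * ?P) = A * W * ?P" by (rule assoc_mult_mat[OF A W(1) P, symmetric])
    also have "\<dots> = W * A' * ?P" by (simp only: AW)
    also have "\<dots> = W * (A' * ?P)" by (rule assoc_mult_mat[OF W(1) A' P])
    also have "\<dots> = W * (?P * ?F)" by (simp only: AP)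
    also have "\<dots> = (W * ?P) * ?F" by (rule assoc_mult_mat[OF W(1) P Fc, symmetric])
    finally show ?thesis .
  qed
  moreover have "W * ?P \<in> carrier_mat n n" by (rule mult_carrier_mat[OF W(1) P])
  ultimately show ?case by (intro exI[of _ "W * ?P"]) blast
qed

lemma real_poly_splits_if_complex_roots_real:
  fixes p :: "real poly"
  assumes "monic p" "\<And>z. poly (map_poly complex_of_real p) z = 0 \<Longrightarrow> z \<in> \<real>"
  shows "\<exists>es. p = (\<Prod>e \<leftarrow> es. [:- e, 1:])"
  using assms
proof (induction "degree p" arbitrary: p)
  case 0
  then have "p = 1" by (simp add: monic_degree_0)
  then show ?case by (intro exI[of _ "[]"]) simp
next
  case (Suc d)
  interpret h: map_poly_inj_idom_hom complex_of_real ..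
  have "degree (map_poly complex_of_real p) \<noteq> 0" using Suc(2) by simp
  then have "\<not> constant (poly (map_poly complex_of_real p))" by (simp add: constant_degree)
  then obtain z where z: "poly (map_poly complex_of_real p) z = 0"
    using fundamental_theorem_of_algebra by blast
  then obtain r where r: "z = complex_of_real r" using Suc(4) by (auto elim: Reals_cases)
  then have "poly p r = 0" using z by simp
  then obtain q where q: "p = [:- r, 1:] * q" by (auto simp: poly_eq_0_iff_dvd)
  have "monic q" using Suc(3) unfolding q by (simp only: lead_coeff_mult) simp
  moreover from this have "d = degree q" using Suc(2) q by (subst (asm) q, subst (asm) degree_mult_eq) auto
  moreover have "z \<in> \<real>" if "poly (map_poly complex_of_real q) z = 0" for z
    using that Suc(4)[of z] unfolding q by (simp only: h.hom_mult poly_mult) simp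
  ultimately obtain es where "q = (\<Prod>e \<leftarrow> es. [:- e, 1:])" using Suc(1) by blast
  then show ?case using q by (intro exI[of _ "r # es"]) simp
qed

text \<open>
  The Hermitian form of \<open>A\<close> at an eigenvector is real and equals the eigenvalue times the
  squared norm.
\<close>

lemma symmetric_complex_eigenvalue_real:
  fixes A :: "real Matrix.mat"
  assumes A: "A \<in> carrier_mat n n" and sym: "transpose_mat A = A"
    and ev: "eigenvalue (map_mat complex_of_real A) z"
  shows "z \<in> \<real>"
proof -
  let ?A = "map_mat complex_of_real A"
  obtain v where v: "v \<in> carrier_vec n" "v \<noteq> 0\<^sub>v n" "?A *\<^sub>v v = z \<cdot>\<^sub>v v"
    using A ev unfolding eigenvalue_def eigenvector_def by auto
  have eq: "(\<Sum>j<n. of_real (A $$ (i, j)) * v $ j) = z * v $ i" if "i < n" for i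
  proof -
    have "(?A *\<^sub>v v) $ i = (\<Sum>j<n. of_real (A $$ (i, j)) * v $ j)"
      using A v(1) that by (simp add: scalar_prod_def atLeast0LessThan)
    then show ?thesis using v that by simp
  qed
  have symA: "A $$ (i, j) = A $$ (j, i)" if "i < n" "j < n" for i j
    using arg_cong[OF sym, of "\<lambda>M. M $$ (i, j)"] A that by simp
  define s where "s = (\<Sum>i<n. \<Sum>j<n. cnj (v $ i) * of_real (A $$ (i, j)) * v $ j)"
  have "s = (\<Sum>i<n. cnj (v $ i) * (z * v $ i))"
    unfolding s_def using eq by (intro sum.cong refl) (simp add: mult.assoc flip: sum_distrib_left)
  also have "\<dots> = z * (\<Sum>i<n. of_real ((cmod (v $ i))\<^sup>2))"
    by (simp only: complex_norm_square sum_distrib_left) (simp add: mult_ac)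
  finally have s: "s = z * of_real (\<Sum>i<n. (cmod (v $ i))\<^sup>2)" by simp
  have "cnj s = (\<Sum>i<n. \<Sum>j<n. v $ i * of_real (A $$ (i, j)) * cnj (v $ j))"
    by (simp add: s_def cnj_sum)
  also have "\<dots> = (\<Sum>j<n. \<Sum>i<n. v $ i * of_real (A $$ (i, j)) * cnj (v $ j))" by (rule sum.swap)
  also have "\<dots> = s" unfolding s_def using symA by (intro sum.cong refl) (simp add: mult_ac)
  finally have "s \<in> \<real>" using Reals_cnj_iff by auto
  obtain i where "i < n" "v $ i \<noteq> 0" using v by (metis carrier_vecD eq_vecI index_zero_vec)
  then have "(\<Sum>i<n. (cmod (v $ i))\<^sup>2) > 0"
    by (intro sum_pos2[of _ i]) auto
  then have "complex_of_real (\<Sum>i<n. (cmod (v $ i))\<^sup>2) \<noteq> 0"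
    by (metis less_irrefl of_real_eq_0_iff)
  then have "z = s / of_real (\<Sum>i<n. (cmod (v $ i))\<^sup>2)"
    using s by (metis nonzero_mult_div_cancel_right)
  then show ?thesis using \<open>s \<in> \<real>\<close> by (metis Reals_divide Reals_of_real)
qed

lemma symmetric_char_poly_splits:
  fixes A :: "real Matrix.mat"
  assumes A: "A \<in> carrier_mat n n" and sym: "transpose_mat A = A"
  shows "\<exists>es. char_poly A = (\<Prod>e \<leftarrow> es. [:- e, 1:])"
proof (rule real_poly_splits_if_complex_roots_real)
  show "monic (char_poly A)" using degree_monic_char_poly[OF A] by simp
  fix z assume "poly (map_poly complex_of_real (char_poly A)) z = 0"
  then have "eigenvalue (map_mat complex_of_real A) z"
    using A by (subst eigenvalue_root_char_poly[of _ n]) (auto simp: of_real_hom.char_poly_hom)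
  then show "z \<in> \<real>" by (rule symmetric_complex_eigenvalue_real[OF A sym])
qed

lemma spectral_theorem:
  fixes a :: "nat \<Rightarrow> nat \<Rightarrow> real" and n :: nat
  assumes sym: "\<And>i j. i < n \<Longrightarrow> j < n \<Longrightarrow> a i j = a j i"
  defines "L \<equiv> rev (sorted_list_of_multiset (proots (char_poly (Matrix.mat n n (\<lambda>(i, j). a i j)))))"
  shows "length L = n" "sorted_wrt (\<ge>) L"
    and "\<exists>u. (\<forall>k<n. \<forall>l<n. (\<Sum>i<n. u k i * u l i) = (if k = l then 1 else 0)) \<and>
      (\<forall>i<n. \<forall>j<n. (\<Sum>k<n. u k i * u k j) = (if i = j then 1 else 0)) \<and>
      (\<forall>k<n. \<forall>i<n. (\<Sum>j<n. a i j * u k j) = L ! k * u k i)"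
proof -
  define A where "A = Matrix.mat n n (\<lambda>(i, j). a i j)"
  have A: "A \<in> carrier_mat n n" by (simp add: A_def)
  have symA: "transpose_mat A = A" using sym by (intro eq_matI) (auto simp: A_def)
  obtain es where es: "char_poly A = (\<Prod>e \<leftarrow> es. [:- e, 1:])"
    using symmetric_char_poly_splits[OF A symA] by blast
  have "proots (\<Prod>e \<leftarrow> xs. [:- e, 1:]) = mset xs" for xs :: "real list"
  proof (induction xs)
    case (Cons x xs)
    have "(\<Prod>e \<leftarrow> xs. [:- e, 1:]) \<noteq> 0" by (auto simp: prod_list_zero_iff)
    then show ?case using Cons by (simp add: proots_mult del: mult_pCons_left)
  qed simp
  then have L: "mset L = mset es" by (simp add: L_def es flip: A_def)
  then have cpL: "char_poly A = (\<Prod>e \<leftarrow> L. [:- e, 1:])"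
    using es by (metis mset_map prod_mset_prod_list)
  have "degree (\<Prod>e \<leftarrow> L. [:- e, 1:]) = length L"
  proof (induction L)
    case (Cons x xs)
    have "(\<Prod>e \<leftarrow> xs. [:- e, 1:]) \<noteq> 0" by (auto simp: prod_list_zero_iff)
    then show ?case using Cons by (simp add: degree_mult_eq del: mult_pCons_left)
  qed simp
  then show "length L = n" using degree_monic_char_poly[OF A] cpL by simp
  show "sorted_wrt (\<ge>) L" unfolding L_def by (simp add: sorted_wrt_rev)
  obtain P where P: "P \<in> carrier_mat n n" "transpose_mat P * P = 1\<^sub>m n"
    "A * P = P * Matrix.mat n n (\<lambda>(i, j). if i = j then L ! i else 0)"
    using symmetric_orthogonal_diagonalization[OF A symA cpL] by blast
  have PPt: "P * transpose_mat P = 1\<^sub>m n"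
    using mat_mult_left_right_inverse[OF _ P(1,2)] P(1) by simp
  have 1: "(\<Sum>i<n. P $$ (i, k) * P $$ (i, l)) = (if k = l then 1 else 0)" if "k < n" "l < n" for k l
    using arg_cong[OF P(2), of "\<lambda>M. M $$ (k, l)"] P(1) that
    by (simp add: scalar_prod_def atLeast0LessThan)
  have 2: "(\<Sum>k<n. P $$ (i, k) * P $$ (j, k)) = (if i = j then 1 else 0)" if "i < n" "j < n" for i j
    using arg_cong[OF PPt, of "\<lambda>M. M $$ (i, j)"] P(1) that
    by (simp add: scalar_prod_def atLeast0LessThan)
  have 3: "(\<Sum>j<n. a i j * P $$ (j, k)) = L ! k * P $$ (i, k)" if "k < n" "i < n" for k i
  proof -
    have "(A * P) $$ (i, k) = (\<Sum>j<n. a i j * P $$ (j, k))"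
      using A P(1) that by (simp add: scalar_prod_def atLeast0LessThan) (simp add: A_def)
    moreover have "(P * Matrix.mat n n (\<lambda>(i, j). if i = j then L ! i else 0)) $$ (i, k) = L ! k * P $$ (i, k)"
      using P(1) that by (simp add: scalar_prod_def atLeast0LessThan if_distrib sum.delta cong: if_cong)
    ultimately show ?thesis using P(3) by simp
  qed
  show "\<exists>u. (\<forall>k<n. \<forall>l<n. (\<Sum>i<n. u k i * u l i) = (if k = l then 1 else 0)) \<and>
      (\<forall>i<n. \<forall>j<n. (\<Sum>k<n. u k i * u k j) = (if i = j then 1 else 0)) \<and>
      (\<forall>k<n. \<forall>i<n. (\<Sum>j<n. a i j * u k j) = L ! k * u k i)"
    using 1 2 3 by (intro exI[of _ "\<lambda>k i. P $$ (i, k)"]) auto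
qed

section \<open>Rayleigh quotients and sign patterns of eigenvectors\<close>

text \<open>
  Expansion in an orthonormal basis of eigenvectors: here \<open>c x k\<close> is the \<open>k\<close>-th coordinate of \<open>x\<close>.
\<close>

lemma rayleigh_expansion:
  fixes a :: "nat \<Rightarrow> nat \<Rightarrow> real"
  assumes complete: "\<And>i j. i < n \<Longrightarrow> j < n \<Longrightarrow> (\<Sum>k<n. u k i * u k j) = (if i = j then 1 else 0)"
    and eig: "\<And>k i. k < n \<Longrightarrow> i < n \<Longrightarrow> (\<Sum>j<n. a i j * u k j) = l k * u k i"
  defines "c \<equiv> (\<lambda>x k. \<Sum>i<n. u k i * x i)"
  shows "i < n \<Longrightarrow> x i = (\<Sum>k<n. c x k * u k i)"
    and "i < n \<Longrightarrow> (\<Sum>j<n. a i j * x j) = (\<Sum>k<n. l k * c x k * u k i)"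
    and "(\<Sum>i<n. (x i)\<^sup>2) = (\<Sum>k<n. (c x k)\<^sup>2)"
    and "(\<Sum>i<n. x i * (\<Sum>j<n. a i j * x j)) = (\<Sum>k<n. l k * (c x k)\<^sup>2)"
proof -
  show 1: "x i = (\<Sum>k<n. c x k * u k i)" if "i < n" for i
  proof -
    have "(\<Sum>k<n. c x k * u k i) = (\<Sum>k<n. \<Sum>j<n. u k i * u k j * x j)"
      by (simp add: c_def sum_distrib_left sum_distrib_right mult_ac)
    also have "\<dots> = (\<Sum>j<n. (\<Sum>k<n. u k i * u k j) * x j)"
      by (subst sum.swap) (simp add: sum_distrib_right)
    also have "\<dots> = (\<Sum>j<n. if i = j then x j else 0)"
      using complete that by (intro sum.cong) auto
    finally show ?thesis using that by simp
  qed
  show 2: "(\<Sum>j<n. a i j * x j) = (\<Sum>k<n. l k * c x k * u k i)" if "i < n" for i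
  proof -
    have "(\<Sum>j<n. a i j * x j) = (\<Sum>j<n. \<Sum>k<n. c x k * (a i j * u k j))"
      using 1 by (intro sum.cong refl) (simp add: sum_distrib_left mult_ac)
    also have "\<dots> = (\<Sum>k<n. c x k * (\<Sum>j<n. a i j * u k j))"
      by (subst sum.swap) (simp add: sum_distrib_left)
    also have "\<dots> = (\<Sum>k<n. l k * c x k * u k i)"
      using eig that by (intro sum.cong refl) simp
    finally show ?thesis .
  qed
  have inner: "(\<Sum>i<n. x i * (\<Sum>k<n. d k * u k i)) = (\<Sum>k<n. d k * c x k)" for d
  proof -
    have "(\<Sum>i<n. x i * (\<Sum>k<n. d k * u k i)) = (\<Sum>i<n. \<Sum>k<n. d k * (u k i * x i))"
      by (simp add: sum_distrib_left mult_ac)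
    also have "\<dots> = (\<Sum>k<n. d k * c x k)" by (subst sum.swap) (simp add: c_def sum_distrib_left)
    finally show ?thesis .
  qed
  have "(\<Sum>i<n. (x i)\<^sup>2) = (\<Sum>i<n. x i * (\<Sum>k<n. c x k * u k i))"
    using 1 by (intro sum.cong refl) (simp add: power2_eq_square)
  then show "(\<Sum>i<n. (x i)\<^sup>2) = (\<Sum>k<n. (c x k)\<^sup>2)"
    using inner[of "c x"] by (simp add: power2_eq_square)
  have "(\<Sum>i<n. x i * (\<Sum>j<n. a i j * x j)) = (\<Sum>i<n. x i * (\<Sum>k<n. l k * c x k * u k i))"
    using 2 by (intro sum.cong refl) simp
  then show "(\<Sum>i<n. x i * (\<Sum>j<n. a i j * x j)) = (\<Sum>k<n. l k * (c x k)\<^sup>2)"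
    using inner[of "\<lambda>k. l k * c x k"] by (simp add: power2_eq_square mult_ac)
qed

definition matrix_eigenvalues :: "nat \<Rightarrow> (nat \<Rightarrow> nat \<Rightarrow> real) \<Rightarrow> real list" where
  "matrix_eigenvalues n a =
     rev (sorted_list_of_multiset (proots (char_poly (Matrix.mat n n (\<lambda>(i, j). a i j)))))"

text \<open>
  The list of eigenvalues is descending: index 0 belongs to the largest eigenvalue, index 1 to the
  second one.
\<close>

locale eigenbasis =
  fixes n :: nat and a :: "nat \<Rightarrow> nat \<Rightarrow> real" and u :: "nat \<Rightarrow> nat \<Rightarrow> real" and L :: "real list"
  assumes L: "L = matrix_eigenvalues n a"
    and desc: "k \<le> l \<Longrightarrow> l < n \<Longrightarrow> L ! l \<le> L ! k"
    and orthonormal: "k < n \<Longrightarrow> l < n \<Longrightarrow> (\<Sum>i<n. u k i * u l i) = (if k = l then 1 else 0)"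
    and complete: "i < n \<Longrightarrow> j < n \<Longrightarrow> (\<Sum>k<n. u k i * u k j) = (if i = j then 1 else 0)"
    and eigenvector: "k < n \<Longrightarrow> i < n \<Longrightarrow> (\<Sum>j<n. a i j * u k j) = L ! k * u k i"

lemma eigenbasis_exists:
  fixes a :: "nat \<Rightarrow> nat \<Rightarrow> real"
  assumes "\<And>i j. i < n \<Longrightarrow> j < n \<Longrightarrow> a i j = a j i"
  obtains u where "eigenbasis n a u (matrix_eigenvalues n a)"
proof -
  note sp = spectral_theorem[of n a, OF assms, folded matrix_eigenvalues_def]
  obtain u where u: "\<forall>k<n. \<forall>l<n. (\<Sum>i<n. u k i * u l i) = (if k = l then 1 else 0)"
    "\<forall>i<n. \<forall>j<n. (\<Sum>k<n. u k i * u k j) = (if i = j then 1 else 0)"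
    "\<forall>k<n. \<forall>i<n. (\<Sum>j<n. a i j * u k j) = matrix_eigenvalues n a ! k * u k i"
    using sp(3) by auto
  have "matrix_eigenvalues n a ! l \<le> matrix_eigenvalues n a ! k" if "k \<le> l" "l < n" for k l
    using sp(1,2) that by (cases "k = l") (auto simp: sorted_wrt_iff_nth_less)
  then have "eigenbasis n a u (matrix_eigenvalues n a)"
    using u by unfold_locales simp_all
  then show ?thesis by (rule that)
qed

text \<open>
  The span of \<open>x\<close> and \<open>y\<close> contains a nonzero vector orthogonal to the first eigenvector; its
  Rayleigh quotient is at most the second eigenvalue.
\<close>

lemma second_eigenvalue_ge:
  fixes a :: "nat \<Rightarrow> nat \<Rightarrow> real"
  assumes sym: "\<And>i j. i < n \<Longrightarrow> j < n \<Longrightarrow> a i j = a j i"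
    and test: "\<And>c d. c \<noteq> 0 \<or> d \<noteq> 0 \<Longrightarrow> (\<exists>i<n. c * x i + d * y i \<noteq> 0) \<and>
      t * (\<Sum>i<n. (c * x i + d * y i)\<^sup>2) \<le>
        (\<Sum>i<n. (c * x i + d * y i) * (\<Sum>j<n. a i j * (c * x j + d * y j)))"
    and n: "n \<ge> 2"
  shows "t \<le> matrix_eigenvalues n a ! 1"
proof -
  obtain u where "eigenbasis n a u (matrix_eigenvalues n a)" using eigenbasis_exists[of n a] sym by blast
  then interpret eigenbasis n a u "matrix_eigenvalues n a" .
  let ?l = "\<lambda>k. matrix_eigenvalues n a ! k"
  define c where "c = (\<lambda>x k. \<Sum>i<n. u k i * x i)"
  have c_eq: "(\<Sum>i<n. u k i * x i) = c x k" for x k by (simp add: c_def)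
  note exp = rayleigh_expansion(3,4)[of n u a ?l, OF complete eigenvector, unfolded c_eq]
  define \<alpha> \<beta> where "\<alpha> = c x 0" and "\<beta> = c y 0"
  obtain p q :: real where pq: "p \<noteq> 0 \<or> q \<noteq> 0" "p * \<alpha> + q * \<beta> = 0"
  proof (cases "\<alpha> = 0")
    case True
    then show ?thesis using that[of 1 0] by simp
  next
    case False
    then show ?thesis using that[of "- \<beta>" \<alpha>] by simp
  qed
  define z where "z = (\<lambda>i. p * x i + q * y i)"
  have "c z 0 = p * \<alpha> + q * \<beta>"
    by (simp add: c_def z_def \<alpha>_def \<beta>_def sum.distrib sum_distrib_left algebra_simps)
  then have c0: "c z 0 = 0" using pq by simp
  have ex: "\<exists>i<n. z i \<noteq> 0" and le: "t * (\<Sum>i<n. (z i)\<^sup>2) \<le> (\<Sum>i<n. z i * (\<Sum>j<n. a i j * z j))"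
    using test[OF pq(1)] by (simp_all add: z_def)
  have "?l k * (c z k)\<^sup>2 \<le> ?l 1 * (c z k)\<^sup>2" if "k < n" for k
    using desc[of 1 k] c0 that by (cases "k = 0") (auto intro: mult_right_mono)
  then have "(\<Sum>k<n. ?l k * (c z k)\<^sup>2) \<le> (\<Sum>k<n. ?l 1 * (c z k)\<^sup>2)" by (intro sum_mono) auto
  then have "t * (\<Sum>i<n. (z i)\<^sup>2) \<le> ?l 1 * (\<Sum>i<n. (z i)\<^sup>2)"
    using le exp[of z] by (simp add: sum_distrib_left)
  moreover have "(\<Sum>i<n. (z i)\<^sup>2) > 0"
  proof -
    obtain i where "i < n" "z i \<noteq> 0" using ex by auto
    then show ?thesis by (intro sum_pos2[of _ i]) auto
  qed
  ultimately show ?thesis by simp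
qed

text \<open>
  Otherwise the support of \<open>w\<close> would be left by some nonzero entry, and the eigenvalue equation
  would fail at a zero of \<open>w\<close>.
\<close>

lemma nonneg_eigenvector_pos:
  fixes a :: "nat \<Rightarrow> nat \<Rightarrow> real"
  assumes nonneg: "\<And>i j. i < n \<Longrightarrow> j < n \<Longrightarrow> i \<noteq> j \<Longrightarrow> a i j \<ge> 0"
    and irr: "\<And>S. S \<subseteq> {..<n} \<Longrightarrow> S \<noteq> {} \<Longrightarrow> S \<noteq> {..<n} \<Longrightarrow> \<exists>i \<in> {..<n} - S. \<exists>j \<in> S. a i j > 0"
    and w: "\<And>i. i < n \<Longrightarrow> w i \<ge> 0" "\<exists>i<n. w i \<noteq> 0"
    and eig: "\<And>i. i < n \<Longrightarrow> (\<Sum>j<n. a i j * w j) = l * w i"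
  shows "i < n \<Longrightarrow> w i > 0"
proof (rule ccontr)
  assume "i < n" "\<not> w i > 0"
  let ?S = "{i. i < n \<and> w i > 0}"
  have "?S \<noteq> {}" using w by force
  moreover have "?S \<noteq> {..<n}" using \<open>i < n\<close> \<open>\<not> w i > 0\<close> by auto
  ultimately obtain i j where ij: "i < n" "\<not> w i > 0" "j < n" "w j > 0" "a i j > 0"
    using irr[of ?S] by auto
  have wi: "w i = 0" using w(1)[OF ij(1)] ij(2) by simp
  have "0 < (\<Sum>j<n. a i j * w j)"
  proof (rule sum_pos2[of _ j])
    fix k assume "k \<in> {..<n}"
    then show "0 \<le> a i k * w k" using nonneg[of i k] w(1)[of k] ij wi by (cases "i = k") auto
  qed (use ij in auto)
  then show False using eig[OF ij(1)] wi by simp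
qed

text \<open>
  If the second basis vector has constant sign, then up to sign it is positive. The first one, being orthogonal
  to it, then changes sign, and pairing its absolute value with the positive vector shows
  that the two eigenvalues coincide.
\<close>

lemma second_eigenvector_changes_sign:
  fixes a :: "nat \<Rightarrow> nat \<Rightarrow> real"
  assumes sym: "\<And>i j. i < n \<Longrightarrow> j < n \<Longrightarrow> a i j = a j i"
    and nonneg: "\<And>i j. i < n \<Longrightarrow> j < n \<Longrightarrow> a i j \<ge> 0"
    and irr: "\<And>S. S \<subseteq> {..<n} \<Longrightarrow> S \<noteq> {} \<Longrightarrow> S \<noteq> {..<n} \<Longrightarrow> \<exists>i \<in> {..<n} - S. \<exists>j \<in> S. a i j > 0"
    and n: "n \<ge> 2"
  obtains x where "\<exists>i<n. x i > 0" "\<exists>i<n. x i < 0"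
    "\<And>i. i < n \<Longrightarrow> (\<Sum>j<n. a i j * x j) = matrix_eigenvalues n a ! 1 * x i"
proof -
  obtain u where "eigenbasis n a u (matrix_eigenvalues n a)" using eigenbasis_exists[of n a] sym by blast
  then interpret eigenbasis n a u "matrix_eigenvalues n a" .
  let ?l = "\<lambda>k. matrix_eigenvalues n a ! k"
  have ne: "\<exists>i<n. u k i \<noteq> 0" if "k < n" for k
  proof (rule ccontr)
    assume "\<not> ?thesis"
    then have "(\<Sum>i<n. u k i * u k i) = 0" by simp
    then show False using orthonormal[OF that that] by simp
  qed
  show ?thesis
  proof (cases "(\<exists>i<n. u 1 i > 0) \<and> (\<exists>i<n. u 1 i < 0)")
    case True
    then show ?thesis using that[of "u 1"] eigenvector[of 1] n by auto
  next
    case False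
    define s :: real where "s = (if \<exists>i<n. u 1 i > 0 then 1 else -1)"
    define w where "w = (\<lambda>i. s * u 1 i)"
    have w0: "w i \<ge> 0" if "i < n" for i
    proof (cases "\<exists>i<n. u 1 i > 0")
      case True
      then have "\<not> u 1 i < 0" using False that by blast
      then show ?thesis unfolding w_def s_def using True by simp
    next
      case False
      then have "\<not> u 1 i > 0" using that by blast
      moreover have "s = -1" by (simp only: s_def False if_False)
      ultimately show ?thesis by (simp add: w_def)
    qed
    have wne: "\<exists>i<n. w i \<noteq> 0" using ne[of 1] n by (auto simp: w_def s_def)
    have weig: "(\<Sum>j<n. a i j * w j) = ?l 1 * w i" if "i < n" for i
    proof -
      have "(\<Sum>j<n. a i j * w j) = s * (\<Sum>j<n. a i j * u 1 j)"
        by (simp add: w_def sum_distrib_left mult_ac)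
      then show ?thesis using eigenvector[of 1 i] n that by (simp add: w_def)
    qed
    have wpos: "w i > 0" if "i < n" for i
      using nonneg_eigenvector_pos[of n a w "?l 1"] nonneg irr w0 wne weig that by blast
    have orth: "(\<Sum>i<n. w i * u 0 i) = 0"
      using orthonormal[of 1 0] n by (simp add: w_def sum_distrib_left[symmetric] mult.assoc)
    obtain i0 where i0: "i0 < n" "u 0 i0 \<noteq> 0" using ne[of 0] n by auto
    have pos: "\<exists>i<n. u 0 i > 0"
    proof (rule ccontr)
      assume "\<not> ?thesis"
      then have le: "u 0 i \<le> 0" if "i < n" for i using that by (meson not_less)
      have "0 < (\<Sum>i<n. w i * - u 0 i)"
      proof (rule sum_pos2[of _ i0])
        have "u 0 i0 < 0" using le[OF i0(1)] i0(2) by simp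
        then show "0 < w i0 * - u 0 i0" using wpos[OF i0(1)] by (simp add: mult_pos_neg)
        show "0 \<le> w i * - u 0 i" if "i \<in> {..<n}" for i
          using wpos[of i] le[of i] that by (simp add: mult_nonneg_nonpos)
      qed (use i0 in auto)
      then show False using orth by (simp add: sum_negf)
    qed
    have neg: "\<exists>i<n. u 0 i < 0"
    proof (rule ccontr)
      assume "\<not> ?thesis"
      then have le: "u 0 i \<ge> 0" if "i < n" for i using that by (meson not_less)
      have "0 < (\<Sum>i<n. w i * u 0 i)"
      proof (rule sum_pos2[of _ i0])
        have "u 0 i0 > 0" using le[OF i0(1)] i0(2) by simp
        then show "0 < w i0 * u 0 i0" using wpos[OF i0(1)] by simp
        show "0 \<le> w i * u 0 i" if "i \<in> {..<n}" for i
          using wpos[of i] le[of i] that by simp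
      qed (use i0 in auto)
      then show False using orth by simp
    qed
    have abs: "?l 0 * \<bar>u 0 i\<bar> \<le> (\<Sum>j<n. a i j * \<bar>u 0 j\<bar>)" if "i < n" for i
    proof -
      have "?l 0 * \<bar>u 0 i\<bar> \<le> \<bar>?l 0 * u 0 i\<bar>" by (simp add: abs_mult mult_right_mono)
      also have "\<dots> = \<bar>\<Sum>j<n. a i j * u 0 j\<bar>" using eigenvector[of 0 i] that by simp
      also have "\<dots> \<le> (\<Sum>j<n. \<bar>a i j * u 0 j\<bar>)" by (rule sum_abs)
      also have "\<dots> = (\<Sum>j<n. a i j * \<bar>u 0 j\<bar>)"
        using nonneg that by (intro sum.cong) (auto simp: abs_mult)
      finally show ?thesis .
    qed
    have "?l 0 * (\<Sum>i<n. w i * \<bar>u 0 i\<bar>) \<le> (\<Sum>i<n. w i * (\<Sum>j<n. a i j * \<bar>u 0 j\<bar>))"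
      unfolding sum_distrib_left
    proof (intro sum_mono)
      fix i assume "i \<in> {..<n}"
      then have "w i * (?l 0 * \<bar>u 0 i\<bar>) \<le> w i * (\<Sum>j<n. a i j * \<bar>u 0 j\<bar>)"
        using abs w0 by (intro mult_left_mono) auto
      then show "?l 0 * (w i * \<bar>u 0 i\<bar>) \<le> (\<Sum>j<n. w i * (a i j * \<bar>u 0 j\<bar>))"
        by (simp add: sum_distrib_left mult_ac)
    qed
    also have "\<dots> = (\<Sum>i<n. \<Sum>j<n. a j i * w i * \<bar>u 0 j\<bar>)"
      unfolding sum_distrib_left using sym by (intro sum.cong refl) (simp add: mult_ac)
    also have "\<dots> = (\<Sum>j<n. (\<Sum>i<n. a j i * w i) * \<bar>u 0 j\<bar>)"
      by (subst sum.swap) (simp add: sum_distrib_right)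
    also have "\<dots> = ?l 1 * (\<Sum>i<n. w i * \<bar>u 0 i\<bar>)"
      using weig by (simp add: sum_distrib_left mult_ac)
    finally have "?l 0 * (\<Sum>i<n. w i * \<bar>u 0 i\<bar>) \<le> ?l 1 * (\<Sum>i<n. w i * \<bar>u 0 i\<bar>)" .
    moreover have "(\<Sum>i<n. w i * \<bar>u 0 i\<bar>) > 0"
      using i0 wpos by (intro sum_pos2[of _ i0]) (simp_all add: less_imp_le)
    ultimately have "?l 0 = ?l 1" using desc[of 0 1] n by simp
    then show ?thesis using that[of "u 0"] pos neg eigenvector[of 0] n by auto
  qed
qed

text \<open>
  The absolute value of a first eigenvector has at least the same Rayleigh quotient, hence the
  maximal one, and is therefore itself an eigenvector. Diagonal entries may be negative, since they
  contribute the same to both quotients.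
\<close>

lemma perron_vector:
  fixes a :: "nat \<Rightarrow> nat \<Rightarrow> real"
  assumes sym: "\<And>i j. i < n \<Longrightarrow> j < n \<Longrightarrow> a i j = a j i"
    and nonneg: "\<And>i j. i < n \<Longrightarrow> j < n \<Longrightarrow> i \<noteq> j \<Longrightarrow> a i j \<ge> 0"
    and irr: "\<And>S. S \<subseteq> {..<n} \<Longrightarrow> S \<noteq> {} \<Longrightarrow> S \<noteq> {..<n} \<Longrightarrow> \<exists>i \<in> {..<n} - S. \<exists>j \<in> S. a i j > 0"
    and n: "n \<ge> 1"
  obtains t w where "\<And>i. i < n \<Longrightarrow> w i > 0" "\<And>i. i < n \<Longrightarrow> (\<Sum>j<n. a i j * w j) = t * w i"
    "\<And>x. (\<Sum>i<n. x i * (\<Sum>j<n. a i j * x j)) \<le> t * (\<Sum>i<n. (x i)\<^sup>2)"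
proof -
  obtain u where "eigenbasis n a u (matrix_eigenvalues n a)" using eigenbasis_exists[of n a] sym by blast
  then interpret eigenbasis n a u "matrix_eigenvalues n a" .
  let ?l = "\<lambda>k. matrix_eigenvalues n a ! k"
  define t where "t = ?l 0"
  define c where "c = (\<lambda>x k. \<Sum>i<n. u k i * x i)"
  have c_eq: "(\<Sum>i<n. u k i * x i) = c x k" for x k by (simp add: c_def)
  note exp = rayleigh_expansion[of n u a ?l, OF complete eigenvector, unfolded c_eq]
  have bound: "(\<Sum>i<n. x i * (\<Sum>j<n. a i j * x j)) \<le> t * (\<Sum>i<n. (x i)\<^sup>2)" for x
  proof -
    have "(\<Sum>k<n. ?l k * (c x k)\<^sup>2) \<le> (\<Sum>k<n. t * (c x k)\<^sup>2)"
      using desc[of 0] by (intro sum_mono mult_right_mono) (auto simp: t_def)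
    then show ?thesis using exp(3)[of x] exp(4)[of x] by (simp add: sum_distrib_left[of t])
  qed
  define w where "w = (\<lambda>i. \<bar>u 0 i\<bar>)"
  have norm: "(\<Sum>i<n. (w i)\<^sup>2) = 1"
    using orthonormal[of 0 0] n by (simp add: w_def power2_eq_square)
  have "t = (\<Sum>i<n. u 0 i * (\<Sum>j<n. a i j * u 0 j))"
  proof -
    have "(\<Sum>i<n. u 0 i * (\<Sum>j<n. a i j * u 0 j)) = (\<Sum>i<n. t * (u 0 i * u 0 i))"
      using eigenvector[of 0] n by (intro sum.cong refl) (simp add: t_def)
    also have "\<dots> = t" using orthonormal[of 0 0] n by (simp add: sum_distrib_left[symmetric])
    finally show ?thesis by simp
  qed
  also have "\<dots> \<le> (\<Sum>i<n. w i * (\<Sum>j<n. a i j * w j))"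
    unfolding sum_distrib_left
  proof (intro sum_mono)
    fix i j assume "i \<in> {..<n}" "j \<in> {..<n}"
    then show "u 0 i * (a i j * u 0 j) \<le> w i * (a i j * w j)"
    proof (cases "i = j")
      case False
      then have "a i j * (u 0 i * u 0 j) \<le> a i j * \<bar>u 0 i * u 0 j\<bar>"
        using nonneg \<open>i \<in> {..<n}\<close> \<open>j \<in> {..<n}\<close> by (intro mult_left_mono) auto
      then show ?thesis by (simp add: w_def abs_mult mult_ac)
    qed (simp add: w_def mult_ac)
  qed
  finally have "(\<Sum>k<n. t * (c w k)\<^sup>2) \<le> (\<Sum>k<n. ?l k * (c w k)\<^sup>2)"
    using norm exp(3)[of w] exp(4)[of w] by (simp flip: sum_distrib_left)
  then have "(\<Sum>k<n. (t - ?l k) * (c w k)\<^sup>2) \<le> 0"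
    by (simp add: sum_subtractf left_diff_distrib)
  moreover have nn: "(t - ?l k) * (c w k)\<^sup>2 \<ge> 0" if "k < n" for k
    using desc[of 0 k] that by (simp add: t_def)
  then have "(\<Sum>k<n. (t - ?l k) * (c w k)\<^sup>2) \<ge> 0" by (intro sum_nonneg) auto
  ultimately have "(\<Sum>k<n. (t - ?l k) * (c w k)\<^sup>2) = 0" by simp
  then have z: "(t - ?l k) * (c w k)\<^sup>2 = 0" if "k < n" for k
    using nn that by (subst (asm) sum_nonneg_eq_0_iff) auto
  have eig: "(\<Sum>j<n. a i j * w j) = t * w i" if "i < n" for i
  proof -
    have "(\<Sum>j<n. a i j * w j) = (\<Sum>k<n. ?l k * c w k * u k i)" using exp(2) that by blast
    also have "\<dots> = (\<Sum>k<n. t * (c w k * u k i))" using z by (intro sum.cong refl) force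
    also have "\<dots> = t * w i" using exp(1)[where x = w and i = i] that by (simp add: sum_distrib_left)
    finally show ?thesis .
  qed
  have "\<exists>i<n. w i \<noteq> 0"
  proof (rule ccontr)
    assume "\<not> ?thesis"
    then have "(\<Sum>i<n. (w i)\<^sup>2) = 0" by simp
    then show False using norm by simp
  qed
  then have "w i > 0" if "i < n" for i
    using nonneg_eigenvector_pos[of n a w t] nonneg irr eig that by (auto simp: w_def)
  then show ?thesis using that bound eig by blast
qed

section \<open>Hubs and linear forests\<close>

lemma sum_neighbours_swap:
  fixes f :: "'v \<Rightarrow> real"
  assumes "finite A" "finite B" "\<And>u v. E u v \<Longrightarrow> E v u"
  shows "(\<Sum>u\<in>A. \<Sum>v | v \<in> B \<and> E u v. f v) = (\<Sum>v\<in>B. real (card {u \<in> A. E v u}) * f v)"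
proof -
  have "(\<Sum>u\<in>A. \<Sum>v | v \<in> B \<and> E u v. f v) = (\<Sum>v\<in>B. \<Sum>u | u \<in> A \<and> E u v. f v)"
    using assms(1,2) by (rule sum.swap_restrict)
  also have "\<dots> = (\<Sum>v\<in>B. real (card {u \<in> A. E v u}) * f v)"
  proof (rule sum.cong[OF refl])
    fix v
    have "{u \<in> A. E u v} = {u \<in> A. E v u}" using assms(3) by blast
    then show "(\<Sum>u | u \<in> A \<and> E u v. f v) = real (card {u \<in> A. E v u}) * f v" by simp
  qed
  finally show ?thesis .
qed

context outer_graph
begin

lemma finite_subset_V: "S \<subseteq> V \<Longrightarrow> finite S"
  using finite_V finite_subset by blast

lemma degree_sum_le:
  assumes "S \<subseteq> V"
  shows "(\<Sum>v\<in>S. card {w \<in> S. E v w}) \<le> 4 * card S"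
  using finite_subset_V[OF assms] assms
proof (induction "card S" arbitrary: S)
  case 0
  then show ?case by simp
next
  case (Suc m)
  then have "S \<noteq> {}" by auto
  then obtain v where v: "v \<in> S" "card {w \<in> S. E v w} \<le> 2" using low_degree Suc.prems by blast
  let ?S = "S - {v}"
  have fin: "finite ?S" using Suc.prems by simp
  have "card {w \<in> S. E u w} = card {w \<in> ?S. E u w} + (if E v u then 1 else 0)" if "u \<in> ?S" for u
  proof -
    have "{w \<in> S. E u w} = {w \<in> ?S. E u w} \<union> (if E v u then {v} else {})"
      using v E_sym by auto
    then show ?thesis using fin by (auto simp: card_insert_if)
  qed
  then have "(\<Sum>u\<in>?S. card {w \<in> S. E u w}) = (\<Sum>u\<in>?S. card {w \<in> ?S. E u w} + (if E v u then 1 else 0))"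
    by simp
  also have "\<dots> = (\<Sum>u\<in>?S. card {w \<in> ?S. E u w}) + card {u \<in> ?S. E v u}"
    using fin by (simp add: sum.distrib sum.If_cases Int_def)
  also have "{u \<in> ?S. E v u} = {w \<in> S. E v w}" using E_irrefl by auto
  also have "(\<Sum>u\<in>?S. card {w \<in> ?S. E u w}) \<le> 4 * card ?S"
  proof (rule Suc.hyps(1)[OF _ fin])
    show "m = card ?S" using Suc.hyps(2) v Suc.prems(1) by simp
    show "?S \<subseteq> V" using Suc.prems(2) by auto
  qed
  finally have "(\<Sum>u\<in>?S. card {w \<in> S. E u w}) \<le> 4 * card ?S + 2" using v(2) by linarith
  moreover have "(\<Sum>u\<in>S. card {w \<in> S. E u w}) = card {w \<in> S. E v w} + (\<Sum>u\<in>?S. card {w \<in> S. E u w})"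
    using Suc.prems(1) v(1) by (rule sum.remove)
  moreover have "card S = Suc (card ?S)" using Suc.prems(1) v(1) by (rule card.remove)
  ultimately show ?case using v(2) by linarith
qed

lemma common_nbrs_subset: "B \<subseteq> V \<Longrightarrow> u \<noteq> v \<Longrightarrow> card {w \<in> {w \<in> B. E u w}. E v w} \<le> 2"
  using common_nbrs[of u v] card_mono[of "{w \<in> V. E u w \<and> E v w}" "{w \<in> {w \<in> B. E u w}. E v w}"] finite_V
  by (force intro: order_trans)

text \<open>
  Let \<open>h\<close> carry the largest entry \<open>c\<close> and let \<open>N\<close> and \<open>R\<close> be its neighbours and its other
  non-neighbours in \<open>P\<close>, \<open>d\<close> and \<open>k\<close> their numbers. Every vertex other than \<open>h\<close> has at most two neighbours in \<open>N\<close>.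
  As \<open>P\<close> spans at most \<open>2 |P|\<close> edges, the entries of \<open>y\<close> sum to at most \<open>4 \<mu> c\<close>, and counting walks of length two from \<open>h\<close>
  gives \<open>\<mu>\<^sup>2 \<le> d + 8 \<mu>\<close>, so \<open>k\<close> is of order \<open>\<mu>\<close>. This makes all entries besides \<open>c\<close> of
  order \<open>c / \<mu>\<close>, and smaller still on \<open>R\<close>. Counting the walks again with these bounds yields
  \<open>\<mu>\<^sup>2 - 2 \<mu> \<le> d + k / 2 = |P| - 1 - k / 2\<close>, which leaves room only for \<open>k = 0\<close> and \<open>|P| = q\<close>.
\<close>

lemma spectral_hub:
  fixes y :: "'v \<Rightarrow> real" and \<mu> :: real
  assumes PV: "P \<subseteq> V" and ne: "P \<noteq> {}" and pos: "\<And>u. u \<in> P \<Longrightarrow> y u > 0"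
    and sub: "\<And>u. u \<in> P \<Longrightarrow> \<mu> * y u \<le> (\<Sum>v | v \<in> P \<and> E u v. y v)"
    and \<mu>: "\<mu> \<ge> 1000" and cardP: "card P \<le> q" and q: "real q \<le> \<mu>\<^sup>2 - 2 * \<mu> + 5 / 4"
  shows "\<exists>h\<in>P. card P = q \<and> (\<forall>u\<in>P - {h}. E h u \<and> y u \<le> y h / (\<mu> - 44))"
proof -
  have fin: "finite P" using finite_subset_V[OF PV] .
  obtain h where h: "h \<in> P" "\<And>u. u \<in> P \<Longrightarrow> y u \<le> y h"
  proof -
    have "Max (y ` P) \<in> y ` P" using fin ne by simp
    then obtain h where "h \<in> P" "y h = Max (y ` P)" by auto
    then show ?thesis using that fin by simp
  qed
  define c where "c = y h"
  have c: "c > 0" using pos h by (simp add: c_def)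
  define N where "N = {v \<in> P. E h v}"
  define R where "R = P - {h} - N"
  have finN: "finite N" "finite R" using fin by (auto simp: N_def R_def)
  have hN: "h \<notin> N" using E_irrefl by (auto simp: N_def)
  have split: "P = insert h (N \<union> R)" "N \<inter> R = {}" "h \<notin> N" "h \<notin> R"
    using h(1) hN by (auto simp: N_def R_def)
  have subs: "N \<subseteq> V" "R \<subseteq> V" "N \<subseteq> P" "R \<subseteq> P" using PV by (auto simp: N_def R_def)
  define d where "d = real (card N)"
  define k where "k = real (card R)"
  have cardP': "real (card P) = 1 + d + k"
    using finN split by (subst split(1)) (simp add: card_Un_disjoint d_def k_def)
  have \<mu>0: "\<mu> > 0" using \<mu> by simp
  have \<mu>2: "1000 * \<mu> \<le> \<mu>\<^sup>2" using \<mu> by (simp add: power2_eq_square)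
  have nbrN: "real (card {v \<in> N. E u v}) \<le> 2" if "u \<noteq> h" for u
    using common_nbrs_subset[OF PV, of h u] that by (auto simp: N_def)
  define S where "S = (\<Sum>u\<in>P. y u)"
  have "\<mu> * S \<le> (\<Sum>u\<in>P. \<Sum>v | v \<in> P \<and> E u v. y v)"
    unfolding S_def sum_distrib_left by (intro sum_mono sub)
  also have "\<dots> = (\<Sum>v\<in>P. real (card {u \<in> P. E v u}) * y v)"
    using fin E_sym by (intro sum_neighbours_swap)
  also have "\<dots> \<le> (\<Sum>v\<in>P. real (card {u \<in> P. E v u}) * c)"
    using h by (intro sum_mono mult_left_mono) (auto simp: c_def)
  also have "\<dots> = real (\<Sum>v\<in>P. card {u \<in> P. E v u}) * c" by (simp add: sum_distrib_right)
  also have "\<dots> \<le> real (4 * card P) * c"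
    using degree_sum_le[OF PV] c by (intro mult_right_mono of_nat_mono) auto
  also have "\<dots> \<le> (4 * \<mu>\<^sup>2) * c" using cardP q \<mu> c by (intro mult_right_mono) auto
  finally have "\<mu> * S \<le> \<mu> * (4 * \<mu> * c)" by (simp add: power2_eq_square mult_ac)
  then have S: "S \<le> 4 * \<mu> * c" using \<mu>0 by simp
  have N_eq: "{v. v \<in> P \<and> E h v} = N" by (auto simp: N_def)
  have \<mu>c: "\<mu> * c \<le> (\<Sum>v\<in>N. y v)" using sub[OF h(1)] by (simp add: c_def N_eq)
  have step_N: "\<mu> * (\<Sum>v\<in>N. y v) \<le> (\<Sum>u\<in>P. real (card {v \<in> N. E u v}) * y u)"
  proof -
    have "\<mu> * (\<Sum>v\<in>N. y v) \<le> (\<Sum>v\<in>N. \<Sum>u | u \<in> P \<and> E v u. y u)"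
      unfolding sum_distrib_left using subs by (intro sum_mono sub) auto
    also have "\<dots> = (\<Sum>u\<in>P. real (card {v \<in> N. E u v}) * y u)"
      using fin finN E_sym by (intro sum_neighbours_swap)
    finally show ?thesis .
  qed
  have card_hN: "real (card {v \<in> N. E h v}) = d"
  proof -
    have "{v \<in> N. E h v} = N" by (auto simp: N_def)
    then show ?thesis by (simp add: d_def)
  qed
  have sum_P: "(\<Sum>u\<in>P. f u) = f h + (\<Sum>u\<in>P - {h}. f u)" for f :: "'v \<Rightarrow> real"
    using fin h by (simp add: sum.remove)
  have "(\<Sum>u\<in>P - {h}. real (card {v \<in> N. E u v}) * y u) \<le> (\<Sum>u\<in>P - {h}. 2 * y u)"
    using nbrN pos by (intro sum_mono mult_right_mono) (auto intro: less_imp_le)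
  also have "\<dots> \<le> 2 * S" using c by (simp add: S_def sum_P sum_distrib_left c_def)
  finally have "\<mu> * (\<Sum>v\<in>N. y v) \<le> d * c + 2 * S"
    using step_N by (simp add: sum_P card_hN c_def)
  then have "\<mu> * (\<mu> * c) \<le> d * c + 8 * \<mu> * c"
    using mult_left_mono[OF \<mu>c, of \<mu>] \<mu>0 S by linarith
  then have "\<mu>\<^sup>2 * c \<le> (d + 8 * \<mu>) * c" by (simp add: power2_eq_square algebra_simps)
  then have d_ge: "\<mu>\<^sup>2 \<le> d + 8 * \<mu>" using c by simp
  have k_le: "k \<le> 7 * \<mu>" using cardP' cardP q d_ge \<mu> by linarith
  have "d > 0" using d_ge \<mu>2 \<mu> by linarith
  then have "N \<noteq> {}" by (auto simp: d_def)
  then have neP: "P - {h} \<noteq> {}" using subs hN by auto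
  define M where "M = Max (y ` (P - {h}))"
  have M: "y u \<le> M" if "u \<in> P - {h}" for u using that fin by (simp add: M_def)
  obtain m where m: "m \<in> P - {h}" "y m = M"
  proof -
    have "M \<in> y ` (P - {h})" unfolding M_def using fin neP by (intro Max_in) auto
    then show ?thesis using that by auto
  qed
  have M0: "M > 0" using m pos by force
  \<comment> \<open>Each vertex of R has at most two neighbours in N, and R spans at most 2k edges.\<close>
  define T where "T = (\<Sum>u\<in>R. y u)"
  have "\<mu> * T \<le> (\<Sum>u\<in>R. \<Sum>v | v \<in> P \<and> E u v. y v)"
    unfolding T_def sum_distrib_left using subs by (intro sum_mono sub) auto
  also have "\<dots> \<le> (\<Sum>u\<in>R. \<Sum>v | v \<in> P \<and> E u v. M)"
  proof (intro sum_mono)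
    fix u v assume "u \<in> R" "v \<in> {v \<in> P. E u v}"
    then have "v \<noteq> h" using E_sym by (auto simp: R_def N_def)
    then show "y v \<le> M" using M \<open>v \<in> {v \<in> P. E u v}\<close> by auto
  qed
  also have "\<dots> = (\<Sum>u\<in>R. real (card {v \<in> P. E u v})) * M" by (simp add: sum_distrib_right)
  also have "(\<Sum>u\<in>R. real (card {v \<in> P. E u v})) \<le> (\<Sum>u\<in>R. 2 + real (card {v \<in> R. E u v}))"
  proof (intro sum_mono)
    fix u assume u: "u \<in> R"
    have "{v \<in> P. E u v} \<subseteq> {v \<in> N. E u v} \<union> {v \<in> R. E u v}"
      using u E_sym by (auto simp: R_def N_def)
    then have "card {v \<in> P. E u v} \<le> card ({v \<in> N. E u v} \<union> {v \<in> R. E u v})"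
      using finN by (intro card_mono) auto
    also have "\<dots> \<le> card {v \<in> N. E u v} + card {v \<in> R. E u v}" by (rule card_Un_le)
    finally have "real (card {v \<in> P. E u v}) \<le> real (card {v \<in> N. E u v}) + real (card {v \<in> R. E u v})"
      by linarith
    moreover have "real (card {v \<in> N. E u v}) \<le> 2" using u split by (intro nbrN) auto
    ultimately show "real (card {v \<in> P. E u v}) \<le> 2 + real (card {v \<in> R. E u v})" by linarith
  qed
  also have "\<dots> \<le> 6 * k"
  proof -
    have "real (\<Sum>u\<in>R. card {v \<in> R. E u v}) \<le> real (4 * card R)"
      using degree_sum_le[OF subs(2)] by (rule of_nat_mono)
    then show ?thesis by (simp add: sum.distrib k_def)
  qed
  finally have \<mu>T: "\<mu> * T \<le> 6 * k * M" using M0 by simp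
  \<comment> \<open>From here on, \<open>42 = 6 * 7\<close> and \<open>44 = 42 + 2\<close>.\<close>
  have "6 * k * M \<le> 6 * (7 * \<mu>) * M" using k_le M0 by (intro mult_right_mono mult_left_mono) auto
  then have "\<mu> * T \<le> \<mu> * (42 * M)" using \<mu>T by (simp add: mult_ac)
  then have T: "T \<le> 42 * M" using \<mu>0 by simp
  have loc: "\<mu> * y u \<le> (if E h u then c else 0) + 44 * M" if u: "u \<in> P - {h}" for u
  proof -
    have "\<mu> * y u \<le> (\<Sum>v | v \<in> P \<and> E u v. y v)" using sub u by auto
    also have "\<dots> \<le> (\<Sum>v\<in>{v. v = h \<and> E h u} \<union> {v \<in> N. E u v} \<union> R. y v)"
      using fin finN pos E_sym subs h
      by (intro sum_mono2) (auto simp: N_def R_def intro: less_imp_le)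
    also have "\<dots> \<le> (\<Sum>v\<in>{v. v = h \<and> E h u}. y v) + (\<Sum>v\<in>{v \<in> N. E u v}. y v) + (\<Sum>v\<in>R. y v)"
    proof -
      have "(\<Sum>v\<in>A \<union> B. y v) \<le> (\<Sum>v\<in>A. y v) + (\<Sum>v\<in>B. y v)" if "A \<subseteq> P" "B \<subseteq> P" for A B
      proof -
        have "finite A" "finite B" using that fin finite_subset by blast+
        moreover have "(\<Sum>v\<in>A \<inter> B. y v) \<ge> 0" using that pos by (intro sum_nonneg) (auto intro: less_imp_le)
        ultimately show ?thesis by (simp add: sum_Un)
      qed
      note Un = this
      have in_P: "{v. v = h \<and> E h u} \<subseteq> P" "{v \<in> N. E u v} \<subseteq> P" using subs h by auto
      then have "{v. v = h \<and> E h u} \<union> {v \<in> N. E u v} \<subseteq> P" by simp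
      from Un[OF this subs(4)] Un[OF in_P] show ?thesis by linarith
    qed
    also have "(\<Sum>v\<in>{v. v = h \<and> E h u}. y v) = (if E h u then c else 0)" by (auto simp: c_def)
    also have "(\<Sum>v\<in>{v \<in> N. E u v}. y v) \<le> real (card {v \<in> N. E u v}) * M"
      using M subs hN by (intro sum_bounded_above) auto
    also have "real (card {v \<in> N. E u v}) * M \<le> 2 * M"
      using nbrN[of u] u M0 by (intro mult_right_mono) auto
    finally show ?thesis using T by (simp add: T_def)
  qed
  have "\<mu> * M \<le> c + 44 * M" using loc[OF m(1)] m(2) c by (auto split: if_splits)
  then have "(\<mu> - 44) * M \<le> c" by (simp add: algebra_simps)
  then have M_le: "M \<le> c / (\<mu> - 44)" using \<mu> by (simp add: pos_le_divide_eq mult.commute)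
  have T_le: "T \<le> k * c / 4"
  proof -
    have yR: "y u \<le> c / 4" if "u \<in> R" for u
    proof -
      have "\<mu> * y u \<le> 44 * M" using loc[of u] that by (auto simp: R_def N_def)
      also have "\<dots> \<le> 44 * (c / (\<mu> - 44))" using M_le by simp
      also have "\<dots> \<le> \<mu> * (c / 4)"
      proof -
        have "c / (\<mu> - 44) \<le> c / 1" using \<mu> c by (intro divide_left_mono) auto
        moreover have "44 * c \<le> \<mu> / 4 * c" using \<mu> c by (intro mult_right_mono) auto
        ultimately show ?thesis by simp
      qed
      finally show ?thesis using \<mu>0 by simp
    qed
    have "T \<le> real (card R) * (c / 4)" unfolding T_def using yR by (intro sum_bounded_above) auto
    then show ?thesis by (simp add: k_def)
  qed
  have "(\<Sum>u\<in>P - {h}. real (card {v \<in> N. E u v}) * y u) \<le> (\<Sum>u\<in>P - {h}. 2 * y u)"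
    using nbrN pos by (intro sum_mono mult_right_mono) (auto intro: less_imp_le)
  also have "(\<Sum>u\<in>P - {h}. 2 * y u) = 2 * (\<Sum>v\<in>N. y v) + 2 * T"
  proof -
    have "P - {h} = N \<union> R" using split by auto
    then show ?thesis using finN split by (simp add: sum.union_disjoint T_def sum_distrib_left)
  qed
  finally have "\<mu> * (\<Sum>v\<in>N. y v) \<le> d * c + (2 * (\<Sum>v\<in>N. y v) + 2 * T)"
    using step_N by (simp add: sum_P card_hN c_def)
  then have "(\<mu> - 2) * (\<Sum>v\<in>N. y v) \<le> d * c + k * c / 2"
    using T_le by (simp add: algebra_simps)
  moreover have "(\<mu> - 2) * (\<mu> * c) \<le> (\<mu> - 2) * (\<Sum>v\<in>N. y v)"
    using \<mu>c \<mu> by (intro mult_left_mono) auto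
  ultimately have "(\<mu>\<^sup>2 - 2 * \<mu>) * c \<le> (d + k / 2) * c"
    by (simp add: power2_eq_square algebra_simps)
  then have main: "\<mu>\<^sup>2 - 2 * \<mu> \<le> d + k / 2" using c by simp
  have kq: "real q - real (card P) + k / 2 \<le> 1 / 4"
    using main cardP' q by linarith
  have "real (card P) \<le> real q" "k \<ge> 0" using cardP by (simp_all add: k_def)
  then have "k < 1" "real q < real (card P) + 1" using kq by linarith+
  then have "card R = 0" and card_eq: "card P = q" using cardP by (simp_all add: k_def)
  then have "R = {}" using finN by simp
  have "\<forall>u\<in>P - {h}. E h u \<and> y u \<le> y h / (\<mu> - 44)"
  proof
    fix u assume u: "u \<in> P - {h}"
    then have "u \<in> N" using split(1) \<open>R = {}\<close> by blast
    then show "E h u \<and> y u \<le> y h / (\<mu> - 44)"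
      using order_trans[OF M[OF u] M_le] by (simp add: N_def c_def)
  qed
  then show ?thesis using h(1) card_eq by blast
qed

end

text \<open>
  Only consecutive members of the list may be adjacent.
\<close>

fun skip_free :: "('v \<Rightarrow> 'v \<Rightarrow> bool) \<Rightarrow> 'v list \<Rightarrow> bool" where
  "skip_free E [] = True"
| "skip_free E (x # xs) = ((\<forall>y\<in>set (tl xs). \<not> E x y) \<and> skip_free E xs)"

lemma skip_free_append:
  "distinct (xs @ ys) \<Longrightarrow> skip_free E (xs @ ys) \<longleftrightarrow> skip_free E xs \<and> skip_free E ys \<and>
     (\<forall>x\<in>set xs. \<forall>y\<in>set ys. E x y \<longrightarrow> x = last xs \<and> y = hd ys)"
proof (induction xs)
  case (Cons a xs)
  have IH: "skip_free E (xs @ ys) \<longleftrightarrow> skip_free E xs \<and> skip_free E ys \<and>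
     (\<forall>x\<in>set xs. \<forall>y\<in>set ys. E x y \<longrightarrow> x = last xs \<and> y = hd ys)"
    using Cons by auto
  have dist: "distinct ((a # xs) @ ys)" by (rule Cons.prems)
  show ?case
  proof (cases xs)
    case Nil
    show ?thesis
    proof (cases ys)
      case (Cons y zs)
      then have "y \<notin> set zs" using dist by simp
      then have "(\<forall>z\<in>set zs. \<not> E a z) \<longleftrightarrow> (\<forall>z\<in>set ys. E a z \<longrightarrow> z = y)"
        unfolding Cons by (simp, blast)
      then show ?thesis by (simp add: Nil Cons conj_ac)
    qed (simp add: Nil)
  next
    case (Cons b zs)
    then have "last xs \<noteq> a" using dist last_in_set[of xs] by (metis Un_iff distinct.simps(2) list.distinct(1) set_append append_Cons)
    then have "(\<forall>z\<in>set ys. \<not> E a z) \<longleftrightarrow> (\<forall>z\<in>set ys. E a z \<longrightarrow> a = last xs \<and> z = hd ys)"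
      by blast
    then show ?thesis using IH by (simp add: Cons ball_Un conj_ac)
  qed
qed simp

lemma skip_free_nth:
  "skip_free E xs \<Longrightarrow> i < j \<Longrightarrow> j < length xs \<Longrightarrow> E (xs ! i) (xs ! j) \<Longrightarrow> j = Suc i"
proof (induction xs arbitrary: i j)
  case (Cons x xs)
  then obtain j' where j: "j = Suc j'" by (cases j) auto
  show ?case
  proof (cases i)
    case 0
    show ?thesis
    proof (rule ccontr)
      assume "j \<noteq> Suc i"
      then have "xs ! j' \<in> set (tl xs)"
        using Cons.prems j 0 by (cases xs; cases j') auto
      then show False using Cons.prems j 0 by auto
    qed
  next
    case (Suc i')
    then show ?thesis using Cons.IH[of i' j'] Cons.prems j by simp
  qed
qed simp

context outer_graph
begin

text \<open>
  Remove a vertex \<open>v\<close> with at most one neighbour \<open>u\<close> and order the rest. At \<open>u\<close> the list is broken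
  on at least one side, since \<open>u\<close> has at most one further neighbour; insert \<open>v\<close> there.
\<close>

lemma linear_forest_ordering:
  assumes "S \<subseteq> V" and "\<And>v. v \<in> S \<Longrightarrow> card {w \<in> S. E v w} \<le> 2"
    and "\<And>T. T \<subseteq> S \<Longrightarrow> T \<noteq> {} \<Longrightarrow> \<exists>v\<in>T. card {w \<in> T. E v w} \<le> 1"
  shows "\<exists>xs. distinct xs \<and> set xs = S \<and> skip_free E xs"
  using assms
proof (induction "card S" arbitrary: S)
  case 0
  then have "S = {}" using finite_subset_V by auto
  then show ?case by (intro exI[of _ "[]"]) simp
next
  case (Suc m)
  have fin: "finite S" using Suc.prems finite_subset_V by auto
  have "S \<noteq> {}" using Suc.hyps(2) by auto
  then obtain v where v: "v \<in> S" "card {w \<in> S. E v w} \<le> 1" using Suc.prems(3)[of S] by auto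
  let ?S = "S - {v}"
  have deg: "card {w \<in> ?S. E u w} \<le> 2" if "u \<in> ?S" for u
  proof -
    have "card {w \<in> ?S. E u w} \<le> card {w \<in> S. E u w}" using fin by (intro card_mono) auto
    then show ?thesis using Suc.prems(2)[of u] that by auto
  qed
  have "m = card ?S" using Suc.hyps(2) v fin by simp
  moreover have "?S \<subseteq> V" using Suc.prems(1) by auto
  moreover have "\<exists>v\<in>T. card {w \<in> T. E v w} \<le> 1" if "T \<subseteq> ?S" "T \<noteq> {}" for T
    using Suc.prems(3)[of T] that by blast
  ultimately obtain xs where xs: "distinct xs" "set xs = ?S" "skip_free E xs"
    using Suc.hyps(1)[of ?S] deg by blast
  have tl: "y \<in> set ys" if "y \<in> set (tl ys)" for y and ys :: "'v list"
    using that by (cases ys) auto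
  show ?case
  proof (cases "\<exists>u\<in>S. E v u")
    case False
    then have "\<not> E v y" if "y \<in> set (tl xs)" for y using tl[OF that] xs(2) by blast
    then have "skip_free E (v # xs)" using xs(3) by simp
    then show ?thesis using xs v by (intro exI[of _ "v # xs"]) auto
  next
    case True
    then obtain u where u: "u \<in> S" "E v u" by auto
    have only_u: "w = u" if "w \<in> S" "E v w" for w
    proof (rule ccontr)
      assume "w \<noteq> u"
      then have "card {u, w} \<le> card {w \<in> S. E v w}" using fin u that by (intro card_mono) auto
      then show False using v \<open>w \<noteq> u\<close> by simp
    qed
    have "u \<in> set xs" using u xs E_irrefl by auto
    then obtain A B where AB: "xs = A @ u # B" by (meson split_list)
    have sets: "set A \<subseteq> S" "set B \<subseteq> S" "v \<notin> set A" "v \<notin> set B" "u \<noteq> v" "u \<notin> set A" "u \<notin> set B"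
      using xs AB by auto
    have nv: "\<not> E v w" "\<not> E w v" if "w \<in> set A \<union> set B" for w
      using only_u[of w] sets that E_sym by blast+
    have sf1: "skip_free E (A @ [u])" "skip_free E B"
      and cr1: "\<And>x y. x \<in> set (A @ [u]) \<Longrightarrow> y \<in> set B \<Longrightarrow> E x y \<Longrightarrow> x = u \<and> y = hd B"
      using skip_free_append[of "A @ [u]" B E] xs AB by auto
    have sf2: "skip_free E A" "skip_free E (u # B)"
      and cr2: "\<And>x y. x \<in> set A \<Longrightarrow> y \<in> set (u # B) \<Longrightarrow> E x y \<Longrightarrow> x = last A \<and> y = u"
      using skip_free_append[of A "u # B" E] xs AB by auto
    have d: "distinct (A @ u # B)" using xs AB by simp
    show ?thesis
    proof (cases "B \<noteq> [] \<and> E u (hd B)")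
      case False
      have "\<not> E v y" if "y \<in> set (tl B)" for y using tl[OF that] nv(1) by blast
      then have sfv: "skip_free E (v # B)" using sf1(2) by simp
      have cross: "\<forall>x\<in>set (A @ [u]). \<forall>y\<in>set (v # B). E x y \<longrightarrow> x = u \<and> y = v"
      proof (intro ballI impI)
        fix x y assume xy: "x \<in> set (A @ [u])" "y \<in> set (v # B)" "E x y"
        have "y \<notin> set B"
        proof
          assume "y \<in> set B"
          then have "x = u" "y = hd B" "B \<noteq> []" using cr1[OF xy(1) _ xy(3)] by auto
          then show False using False xy(3) by simp
        qed
        then have "y = v" using xy(2) by simp
        moreover have "x \<notin> set A" using nv(2)[of x] xy(3) \<open>y = v\<close> by blast
        ultimately show "x = u \<and> y = v" using xy(1) by simp
      qed
      have dist: "distinct ((A @ [u]) @ (v # B))" using d sets by simp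
      have "skip_free E ((A @ [u]) @ (v # B))"
        unfolding skip_free_append[OF dist] last_snoc list.sel using sf1(1) sfv cross by (intro conjI)
      moreover have "set ((A @ [u]) @ (v # B)) = S" using xs(2) v(1) unfolding AB by auto
      ultimately show ?thesis using dist by blast
    next
      case True
      have "\<not> E u (last A)" if "A \<noteq> []"
      proof
        assume "E u (last A)"
        have m: "last A \<in> set A" "hd B \<in> set B" using that True by simp_all
        then have "card {v, hd B, last A} \<le> card {w \<in> S. E u w}"
          using fin u E_sym sets True \<open>E u (last A)\<close> v by (intro card_mono) auto
        moreover have "card {v, hd B, last A} = 3"
          using m sets d by (auto simp: card_insert_if)
        ultimately show False using Suc.prems(2)[OF u(1)] by simp
      qed
      then have nA: "\<not> E x u" if "x \<in> set A" for x
        using cr2[of x u] that E_sym by (cases "A = []") auto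
      have sfv: "skip_free E (v # u # B)" using sf2(2) nv(1) by simp
      have cross: "\<forall>x\<in>set A. \<forall>y\<in>set (v # u # B). E x y \<longrightarrow> x = last A \<and> y = v"
      proof (intro ballI impI)
        fix x y assume xy: "x \<in> set A" "y \<in> set (v # u # B)" "E x y"
        have "y \<noteq> v" using nv(2)[of x] xy by blast
        then have "y = u" using cr2[OF xy(1) _ xy(3)] xy(2) by simp
        then show "x = last A \<and> y = v" using nA[OF xy(1)] xy(3) by simp
      qed
      have dist: "distinct (A @ (v # u # B))" using d sets by simp
      have "skip_free E (A @ (v # u # B))"
        unfolding skip_free_append[OF dist] list.sel using sf2(1) sfv cross by (intro conjI)
      moreover have "set (A @ (v # u # B)) = S" using xs(2) v(1) unfolding AB by auto
      ultimately show ?thesis using dist by blast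
    qed
  qed
qed

text \<open>
  Three neighbours of \<open>v\<close> inside the neighbourhood of \<open>h\<close> would be common neighbours of \<open>v\<close> and \<open>h\<close>,
  and a cycle there would form a wheel with \<open>h\<close>, in which every degree is at least three.
\<close>

lemma neighbourhood_ordering:
  assumes "h \<in> V" "S \<subseteq> V" "\<And>v. v \<in> S \<Longrightarrow> E h v"
  shows "\<exists>xs. distinct xs \<and> set xs = S \<and> skip_free E xs"
proof (rule linear_forest_ordering[OF assms(2)])
  have h: "h \<notin> S" using assms(3) E_irrefl by blast
  show "card {w \<in> S. E v w} \<le> 2" if "v \<in> S" for v
  proof -
    have "{w \<in> S. E v w} \<subseteq> {w \<in> V. E h w \<and> E v w}" using assms by auto
    then have "card {w \<in> S. E v w} \<le> card {w \<in> V. E h w \<and> E v w}"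
      using finite_V by (intro card_mono) auto
    also have "\<dots> \<le> 2" using h that by (intro common_nbrs) auto
    finally show ?thesis .
  qed
  show "\<exists>v\<in>T. card {w \<in> T. E v w} \<le> 1" if T: "T \<subseteq> S" "T \<noteq> {}" for T
  proof -
    have fin: "finite T" using T assms finite_subset_V by (meson order_trans)
    have "insert h T \<subseteq> V" using T assms by auto
    then obtain v where v: "v \<in> insert h T" "card {w \<in> insert h T. E v w} \<le> 2"
      using low_degree[of "insert h T"] by auto
    show ?thesis
    proof (cases "v = h")
      case False
      then have vT: "v \<in> T" using v by simp
      then have "E v h" using T assms E_sym by blast
      then have "{w \<in> insert h T. E v w} = insert h {w \<in> T. E v w}" by auto
      then have "card {w \<in> insert h T. E v w} = Suc (card {w \<in> T. E v w})"
        using fin h T(1) card_insert_disjoint[of "{w \<in> T. E v w}" h] by fastforce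
      then have "card {w \<in> T. E v w} \<le> 1" using v(2) by linarith
      then show ?thesis using vT by blast
    next
      case True
      have "T \<subseteq> {w \<in> insert h T. E v w}" using True T assms by auto
      then have "card T \<le> card {w \<in> insert h T. E v w}" using fin by (intro card_mono) auto
      then have "card T \<le> 2" using v by simp
      obtain x where x: "x \<in> T" using T by auto
      have "{w \<in> T. E x w} \<subseteq> T - {x}" using E_irrefl by auto
      then have "card {w \<in> T. E x w} \<le> card (T - {x})" using fin by (intro card_mono) auto
      also have "\<dots> \<le> 1" using \<open>card T \<le> 2\<close> x fin by simp
      finally show ?thesis using x by auto
    qed
  qed
qed

end

section \<open>The hooked fan and its Perron vector\<close>

text \<open>
  Adjacency of the fan on \<open>{..<q}\<close> with the path \<open>0, \<dots>, q - 2\<close> and the hub \<open>q - 1\<close>.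
\<close>

definition fan_adj :: "nat \<Rightarrow> nat \<Rightarrow> nat \<Rightarrow> bool" where
  "fan_adj q i j \<longleftrightarrow> i < q \<and> j < q \<and> i \<noteq> j \<and> (i = q - 1 \<or> j = q - 1 \<or> i = Suc j \<or> j = Suc i)"

lemma fan_adj_sym: "fan_adj q i j \<Longrightarrow> fan_adj q j i"
  by (auto simp: fan_adj_def)

lemma finite_fan_nbrs [simp]: "finite {j. fan_adj q i j}"
  by (rule finite_subset[of _ "{..<q}"]) (auto simp: fan_adj_def)

lemma sum_fan_nbrs_hub:
  assumes "q \<ge> 1"
  shows "sum f {j. fan_adj q (q - 1) j} = sum f {..<q - 1}"
  using assms by (intro sum.cong) (auto simp: fan_adj_def)

lemma sum_fan_nbrs_path:
  fixes f :: "nat \<Rightarrow> real"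
  assumes "i < q - 1"
  shows "sum f {j. fan_adj q i j} =
    f (q - 1) + (if i = 0 then 0 else f (i - 1)) + (if Suc i < q - 1 then f (Suc i) else 0)"
proof -
  have "{j. fan_adj q i j} = insert (q - 1) ((if i = 0 then {} else {i - 1}) \<union> (if Suc i < q - 1 then {Suc i} else {}))"
    using assms by (auto simp: fan_adj_def split: if_splits)
  then show ?thesis using assms by (auto simp: sum.insert_if)
qed

text \<open>
  The fan with its adjacency matrix reduced by 1 in the diagonal entry of the path end 0. The
  Perron vector \<open>w\<close> is normalised to be 1 at the hub.
\<close>

locale hooked_fan =
  fixes q :: nat and \<theta> :: real and w :: "nat \<Rightarrow> real"
  assumes q3: "q \<ge> 4" and \<theta>_large: "\<theta> \<ge> 10000"
    and w_pos: "i < q \<Longrightarrow> w i > 0" and w_hub: "w (q - 1) = 1"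
    and w_eq: "i < q \<Longrightarrow> (\<Sum>j | fan_adj q i j. w j) = \<theta> * w i + (if i = 0 then w 0 else 0)"
    and q_le: "real q \<le> \<theta>\<^sup>2 - 2 * \<theta> + 5 / 4"

text \<open>
  The lower bound for \<open>\<theta>\<close> comes from the vector that is \<open>\<surd>q - 1\<close> at the hub and 1 on
  the path, an eigenvector for \<open>1 + \<surd>q\<close> up to the defects at the ends of the path, which cost 3 in the quadratic form.
\<close>

lemma hooked_fan_exists:
  assumes q: "q \<ge> 200000000"
  obtains \<theta> w where "hooked_fan q \<theta> w"
proof -
  define b where "b = (\<lambda>i j. (if fan_adj q i j then 1 else 0) - (if i = 0 \<and> j = 0 then 1 else (0::real)))"
  have b_sum: "(\<Sum>j<q. b i j * x j) = (\<Sum>j | fan_adj q i j. x j) - (if i = 0 then x 0 else 0)"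
    if "i < q" for i and x :: "nat \<Rightarrow> real"
  proof -
    have "(\<Sum>j<q. b i j * x j) = (\<Sum>j<q. if fan_adj q i j then x j else 0) - (\<Sum>j<q. if i = 0 \<and> j = 0 then x j else 0)"
      unfolding sum_subtractf[symmetric] by (intro sum.cong refl) (simp add: b_def)
    moreover have "(\<Sum>j<q. if fan_adj q i j then x j else 0) = (\<Sum>j | fan_adj q i j. x j)"
      by (simp add: sum.If_cases) (intro sum.cong, auto simp: fan_adj_def)
    moreover have "(\<Sum>j<q. if i = 0 \<and> j = 0 then x j else 0) = (if i = 0 then x 0 else 0)"
      using q by simp
    ultimately show ?thesis by simp
  qed
  have sym: "b i j = b j i" for i j by (auto simp: b_def fan_adj_def)
  have nonneg: "b i j \<ge> 0" if "i \<noteq> j" for i j using that by (auto simp: b_def)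
  have irr: "\<exists>i\<in>{..<q} - S. \<exists>j\<in>S. b i j > 0" if S: "S \<subseteq> {..<q}" "S \<noteq> {}" "S \<noteq> {..<q}" for S
  proof (cases "q - 1 \<in> S")
    case True
    obtain i where "i < q" "i \<notin> S" using S by auto
    then have "i \<in> {..<q} - S" "b i (q - 1) > 0" using True q by (auto simp: b_def fan_adj_def)
    then show ?thesis using True by blast
  next
    case False
    obtain j where "j \<in> S" using S by auto
    then have "j < q" "j \<noteq> q - 1" using False S by auto
    then have "b (q - 1) j > 0" using q by (auto simp: b_def fan_adj_def)
    then show ?thesis using False \<open>j \<in> S\<close> q by (intro bexI[of _ "q - 1"] bexI[of _ j]) auto
  qed
  have "\<exists>\<theta> w. (\<forall>i<q. w i > 0) \<and> (\<forall>i<q. (\<Sum>j<q. b i j * w j) = \<theta> * w i) \<and>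
    (\<forall>x. (\<Sum>i<q. x i * (\<Sum>j<q. b i j * x j)) \<le> \<theta> * (\<Sum>i<q. (x i)\<^sup>2))"
  proof (rule perron_vector[of q b])
    show "b i j = b j i" for i j by (rule sym)
    show "b i j \<ge> 0" if "i \<noteq> j" for i j using that by (rule nonneg)
    show "\<exists>i\<in>{..<q} - S. \<exists>j\<in>S. b i j > 0" if "S \<subseteq> {..<q}" "S \<noteq> {}" "S \<noteq> {..<q}" for S
      using that by (rule irr)
    show "q \<ge> 1" using q by simp
  qed blast
  then obtain \<theta> w where w: "\<And>i. i < q \<Longrightarrow> w i > 0" "\<And>i. i < q \<Longrightarrow> (\<Sum>j<q. b i j * w j) = \<theta> * w i"
    "\<And>x. (\<Sum>i<q. x i * (\<Sum>j<q. b i j * x j)) \<le> \<theta> * (\<Sum>i<q. (x i)\<^sup>2)"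
    by blast
  define s where "s = sqrt (real q)"
  have s2: "s\<^sup>2 = real q" by (simp add: s_def)
  have s_ge: "s \<ge> 14000"
    unfolding s_def using q by (intro real_le_rsqrt) auto
  obtain m where m: "q = Suc m" "m \<ge> 2" using q by (cases q) auto
  define x where "x = (\<lambda>i. if i = m then s - 1 else (1::real))"
  have xi: "x i * (\<Sum>j<q. b i j * x j) = s + 1 - (if i = 0 then 2 else 0) - (if i = m - 1 then 1 else 0)"
    if "i < m" for i
    using that m by (subst b_sum) (auto simp: sum_fan_nbrs_path x_def)
  have "(\<Sum>i<m. x i * (\<Sum>j<q. b i j * x j)) = (\<Sum>i<m. s + 1 - (if i = 0 then 2 else 0) - (if i = m - 1 then 1 else 0))"
    using xi by (intro sum.cong) auto
  also have "\<dots> = real m * (s + 1) - 3"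
    using m by (simp add: sum_subtractf)
  finally have path: "(\<Sum>i<m. x i * (\<Sum>j<q. b i j * x j)) = real m * (s + 1) - 3" .
  have hub: "x m * (\<Sum>j<q. b m j * x j) = (s - 1) * real m"
    using m sum_fan_nbrs_hub[of q x] by (subst b_sum) (auto simp: x_def)
  have "(\<Sum>i<q. x i * (\<Sum>j<q. b i j * x j)) = real m * (2 * s) - 3"
    using path hub unfolding m(1) sum.lessThan_Suc by (simp add: algebra_simps)
  moreover have "(\<Sum>i<q. (x i)\<^sup>2) = (s - 1)\<^sup>2 + real m"
    unfolding m(1) sum.lessThan_Suc by (simp add: x_def)
  ultimately have ray: "real m * (2 * s) - 3 \<le> \<theta> * ((s - 1)\<^sup>2 + real m)" using w(3)[of x] by simp
  have mr: "real m = s\<^sup>2 - 1" using s2 m by simp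
  define D where "D = 2 * s * (s - 1)"
  have D: "D > 0" using s_ge by (simp add: D_def)
  have "(1 + s) * D - 3 \<le> \<theta> * D"
    using ray unfolding mr D_def by (simp add: algebra_simps power2_eq_square)
  then have "(1 + s - \<theta>) * D \<le> 3" by (simp add: algebra_simps)
  then have gap: "1 + s - \<theta> \<le> 3 / D" using D by (simp add: pos_le_divide_eq)
  have "8 * s * 3 \<le> D" using s_ge unfolding D_def by (simp add: algebra_simps)
  then have "3 / D \<le> 3 / (24 * s)" using s_ge D by (intro divide_left_mono) auto
  then have gap': "1 + s - \<theta> \<le> 1 / (8 * s)" using gap by simp
  have "1 / (8 * s) \<le> 1" using s_ge by simp
  then have \<theta>s: "\<theta> \<ge> s" using gap' by linarith
  have "(s - 1 / (8 * s))\<^sup>2 \<le> (\<theta> - 1)\<^sup>2"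
    using gap' \<open>1 / (8 * s) \<le> 1\<close> s_ge by (intro power_mono) linarith+
  moreover have "(s - 1 / (8 * s))\<^sup>2 = s\<^sup>2 - 1 / 4 + (1 / (8 * s))\<^sup>2"
    using s_ge by (simp add: power2_eq_square field_simps)
  ultimately have "s\<^sup>2 - 1 / 4 \<le> (\<theta> - 1)\<^sup>2" using zero_le_power2[of "1 / (8 * s)"] by linarith
  then have q_le: "real q \<le> \<theta>\<^sup>2 - 2 * \<theta> + 5 / 4"
    unfolding s2 by (simp add: power2_eq_square algebra_simps)
  define c where "c = w (q - 1)"
  have c: "c > 0" using w(1)[of "q - 1"] q by (simp add: c_def)
  have "hooked_fan q \<theta> (\<lambda>i. w i / c)"
  proof
    show "(\<Sum>j | fan_adj q i j. w j / c) = \<theta> * (w i / c) + (if i = 0 then w 0 / c else 0)" if "i < q" for i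
      using w(2)[OF that] b_sum[OF that, of w] c
      by (simp add: sum_divide_distrib[symmetric] field_simps split: if_splits)
    show "w (q - 1) / c = 1" using c by (simp add: c_def)
  qed (use q \<theta>s s_ge w(1) c q_le in auto)
  then show ?thesis by (rule that)
qed

context hooked_fan
begin

lemma w_path_pos: "i < q - 1 \<Longrightarrow> w i > 0"
  by (rule w_pos) simp

lemma zero_on_path: "0 < q - 1"
  using q3 by simp

lemma w_upper:
  assumes "i < q - 1"
  shows "\<theta> * w i \<le> (1001 / 1000)"
proof -
  define M where "M = Max (w ` {..<q - 1})"
  have ne: "w ` {..<q - 1} \<noteq> {}" using q3 by (simp add: lessThan_empty_iff)
  have M: "w j \<le> M" if "j < q - 1" for j using that by (simp add: M_def)
  obtain k where k: "k < q - 1" "w k = M" using Max_in[OF _ ne] by (auto simp: M_def)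
  have "M > 0" using w_pos[of k] k by simp
  have "\<theta> * w k \<le> (\<Sum>j | fan_adj q k j. w j)" using w_eq[of k] w_pos[of 0] k q3 by auto
  also have "\<dots> \<le> 1 + M + M"
    unfolding sum_fan_nbrs_path[OF k(1)] w_hub
    using M[of "k - 1"] M[of "Suc k"] k \<open>M > 0\<close> by (intro add_mono) auto
  finally have "(\<theta> - 2) * M \<le> 1" using k by (simp add: algebra_simps)
  moreover have "\<theta> * M \<le> (1001 / 1000) * (\<theta> - 2) * M" using \<theta>_large \<open>M > 0\<close> by (intro mult_right_mono) auto
  moreover have "\<theta> * w i \<le> \<theta> * M" using M[OF assms] \<theta>_large by (intro mult_left_mono) auto
  ultimately show ?thesis by linarith
qed

lemma w_lower:
  assumes "i < q - 1"
  shows "\<theta> * w i \<ge> (999 / 1000)"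
proof -
  have "w (i - 1) > 0" using assms by (intro w_pos) simp
  moreover have "w (Suc i) > 0" if "Suc i < q - 1" using that by (intro w_pos) simp
  ultimately have "1 \<le> (\<Sum>j | fan_adj q i j. w j)"
    unfolding sum_fan_nbrs_path[OF assms] w_hub by (auto intro: add_nonneg_nonneg simp: less_imp_le)
  also have "\<dots> \<le> \<theta> * w i + w i" using w_eq[of i] w_path_pos[OF assms] assms by auto
  finally have "1 \<le> \<theta> * w i + w i" .
  moreover have "w i \<le> (2 / 10000)"
  proof -
    have "10000 * w i \<le> \<theta> * w i" using \<theta>_large w_path_pos[OF assms] by (intro mult_right_mono) auto
    then show ?thesis using w_upper[OF assms] by simp
  qed
  ultimately show ?thesis by simp
qed

end

text \<open>
  One sign class of an eigenvector for \<open>\<mu>\<close>, placed on the vertices of the fan: \<open>E'\<close> are the edges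
  inside the class, and \<open>c i\<close> is what the edges to the other class subtract at \<open>i\<close>.
  The bound for path vertices is the one provided by \<open>spectral_hub\<close>.
\<close>

locale fan_side = hooked_fan +
  fixes \<mu> :: real and y :: "nat \<Rightarrow> real" and E' :: "nat \<Rightarrow> nat \<Rightarrow> bool" and c :: "nat \<Rightarrow> real"
  assumes \<theta>_le: "\<theta> \<le> \<mu>" and E'_fan: "E' i j \<Longrightarrow> fan_adj q i j" and E'_sym: "E' i j \<Longrightarrow> E' j i"
    and E'_hub: "i < q - 1 \<Longrightarrow> E' i (q - 1)"
    and y_pos: "i < q \<Longrightarrow> y i > 0" and y_hub: "i < q - 1 \<Longrightarrow> y i \<le> y (q - 1) / (\<mu> - 44)"
    and c_nonneg: "i < q \<Longrightarrow> c i \<ge> 0"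
    and y_eq: "i < q \<Longrightarrow> \<mu> * y i = (\<Sum>j | E' i j. y j) - c i"
begin

abbreviation "Y \<equiv> y (q - 1)"

lemma y_path_pos: "i < q - 1 \<Longrightarrow> y i > 0"
  by (rule y_pos) simp

lemma c_path_nonneg: "i < q - 1 \<Longrightarrow> c i \<ge> 0"
  by (rule c_nonneg) simp

lemma Y_pos: "Y > 0"
  using y_pos[of "q - 1"] q3 by simp

lemma \<mu>_large: "\<mu> \<ge> 10000"
  using \<theta>_le \<theta>_large by simp

lemma finite_E': "finite {j. E' i j}"
  using E'_fan by (intro finite_subset[OF _ finite_fan_nbrs[of q i]]) auto

text \<open>
  Evaluate the form of the full fan at \<open>w\<close> and \<open>y\<close> from both sides: once by the equation for \<open>w\<close>, where the
  hook leaves \<open>w 0 * y 0\<close>, and once by the equation for \<open>y\<close>, where missing edges and edges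
  to the other side appear.
\<close>

lemma pairing:
  "(\<mu> - \<theta>) * (\<Sum>i<q. w i * y i) =
    w 0 * y 0 - (\<Sum>i<q. \<Sum>j | fan_adj q i j \<and> \<not> E' i j. w i * y j) - (\<Sum>i<q. w i * c i)"
proof -
  have nbrs: "{j. fan_adj q i j} = {j \<in> {..<q}. fan_adj q i j}" for i by (auto simp: fan_adj_def)
  have nbrs': "{j \<in> {..<q}. fan_adj q j i} = {j. fan_adj q i j}" for i
    using fan_adj_sym by (auto simp: fan_adj_def)
  have "(\<Sum>i<q. w i * (\<Sum>j | fan_adj q i j. y j)) = (\<Sum>i<q. \<Sum>j | j \<in> {..<q} \<and> fan_adj q i j. w i * y j)"
    by (simp only: sum_distrib_left nbrs)
  also have "\<dots> = (\<Sum>j<q. \<Sum>i | i \<in> {..<q} \<and> fan_adj q i j. w i * y j)"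
    by (rule sum.swap_restrict) auto
  also have "\<dots> = (\<Sum>j<q. (\<Sum>i | fan_adj q j i. w i) * y j)"
    by (simp only: nbrs' sum_distrib_right)
  also have "\<dots> = (\<Sum>j<q. \<theta> * (w j * y j) + (if j = 0 then w 0 * y 0 else 0))"
    using w_eq by (intro sum.cong refl) (simp add: algebra_simps)
  also have "\<dots> = \<theta> * (\<Sum>j<q. w j * y j) + w 0 * y 0"
    using q3 by (simp add: sum.distrib sum_distrib_left)
  finally have 1: "(\<Sum>i<q. w i * (\<Sum>j | fan_adj q i j. y j)) = \<theta> * (\<Sum>j<q. w j * y j) + w 0 * y 0" .
  have "w i * (\<Sum>j | fan_adj q i j. y j) = \<mu> * (w i * y i) + w i * c i + (\<Sum>j | fan_adj q i j \<and> \<not> E' i j. w i * y j)"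
    if "i < q" for i
  proof -
    have "{j. fan_adj q i j} = {j. E' i j} \<union> {j. fan_adj q i j \<and> \<not> E' i j}" using E'_fan by auto
    moreover have "finite {j. E' i j}" "finite {j. fan_adj q i j \<and> \<not> E' i j}"
      by (rule finite_E', rule finite_subset[OF _ finite_fan_nbrs[of q i]]) auto
    ultimately have "(\<Sum>j | fan_adj q i j. y j) = (\<Sum>j | E' i j. y j) + (\<Sum>j | fan_adj q i j \<and> \<not> E' i j. y j)"
      by (simp add: sum.union_disjoint disjoint_iff)
    also have "(\<Sum>j | E' i j. y j) = \<mu> * y i + c i" using y_eq[OF that] by simp
    finally show ?thesis by (simp add: sum_distrib_left algebra_simps)
  qed
  then have "(\<Sum>i<q. w i * (\<Sum>j | fan_adj q i j. y j)) =
      \<mu> * (\<Sum>i<q. w i * y i) + (\<Sum>i<q. w i * c i) + (\<Sum>i<q. \<Sum>j | fan_adj q i j \<and> \<not> E' i j. w i * y j)"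
    by (simp add: sum.distrib sum_distrib_left)
  then show ?thesis using 1 by (simp add: algebra_simps)
qed

lemma wy_pos: "(\<Sum>i<q. w i * y i) > 0"
  using q3 w_pos y_pos by (intro sum_pos) (auto simp: lessThan_empty_iff)

lemma wc_nonneg: "i < q \<Longrightarrow> w i * c i \<ge> 0"
  using w_pos c_nonneg by (simp add: less_imp_le)

lemma missing_nonneg: "(\<Sum>i\<in>A. \<Sum>j | fan_adj q i j \<and> \<not> E' i j. w i * y j) \<ge> 0"
  using w_pos y_pos by (intro sum_nonneg) (auto simp: fan_adj_def less_imp_le)

text \<open>
  As \<open>\<mu> \<ge> \<theta>\<close>, all deviations from the fan together must be paid for by \<open>w 0 * y 0\<close>.
\<close>

lemma budget: "(\<Sum>i<q. \<Sum>j | fan_adj q i j \<and> \<not> E' i j. w i * y j) + (\<Sum>i<q. w i * c i) \<le> w 0 * y 0"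
proof -
  have "(\<mu> - \<theta>) * (\<Sum>i<q. w i * y i) \<ge> 0" using wy_pos \<theta>_le by simp
  then show ?thesis using pairing by linarith
qed

lemma y_upper:
  assumes "i < q - 1"
  shows "\<mu> * y i \<le> (1005 / 1000) * Y"
proof -
  have "y i * (\<mu> - 44) \<le> Y" using y_hub[OF assms] \<mu>_large by (simp add: pos_le_divide_eq)
  moreover have "\<mu> * y i \<le> ((1005 / 1000) * (\<mu> - 44)) * y i"
    using \<mu>_large y_path_pos[OF assms] by (intro mult_right_mono) auto
  ultimately show ?thesis by (simp add: algebra_simps)
qed

lemma hook_cost: "\<theta> * \<mu> * (w 0 * y 0) \<le> (1007 / 1000) * Y"
proof -
  have "(\<theta> * w 0) * (\<mu> * y 0) \<le> (1001 / 1000) * ((1005 / 1000) * Y)"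
    using y_path_pos[OF zero_on_path] \<mu>_large
    by (intro mult_mono[OF w_upper[OF zero_on_path] y_upper[OF zero_on_path]] mult_nonneg_nonneg) simp_all
  then show ?thesis using Y_pos by (simp add: mult_ac)
qed

lemma crossing_hub: "\<mu> * c (q - 1) \<le> (1 / 1000) * Y"
proof -
  have "w (q - 1) * c (q - 1) \<le> (\<Sum>i<q. w i * c i)"
    using q3 wc_nonneg by (intro member_le_sum) auto
  then have "c (q - 1) \<le> w 0 * y 0" using budget missing_nonneg[of "{..<q}"] w_hub by simp
  then have "\<theta> * \<mu> * c (q - 1) \<le> \<theta> * \<mu> * (w 0 * y 0)"
    using \<theta>_large \<mu>_large by (intro mult_left_mono) auto
  then have "\<theta> * (\<mu> * c (q - 1)) \<le> (1007 / 1000) * Y" using hook_cost by (simp add: mult_ac)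
  moreover have "10000 * (\<mu> * c (q - 1)) \<le> \<theta> * (\<mu> * c (q - 1))"
    using \<theta>_large \<mu>_large c_nonneg[of "q - 1"] q3 by (intro mult_right_mono) auto
  ultimately show ?thesis using Y_pos by simp
qed

lemma crossing_sum: "\<mu> * (\<Sum>i<q - 1. c i) \<le> (101 / 100) * Y"
proof -
  have "(999 / 1000) * (\<Sum>i<q - 1. c i) \<le> (\<Sum>i<q - 1. \<theta> * (w i * c i))"
    unfolding sum_distrib_left
  proof (intro sum_mono)
    fix i assume "i \<in> {..<q - 1}"
    then have "(999 / 1000) * c i \<le> (\<theta> * w i) * c i"
      using w_lower[of i] c_path_nonneg[of i] by (intro mult_right_mono) auto
    then show "(999 / 1000) * c i \<le> \<theta> * (w i * c i)" by (simp add: mult_ac)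
  qed
  also have "\<dots> = \<theta> * (\<Sum>i<q - 1. w i * c i)" by (simp add: sum_distrib_left)
  also have "(\<Sum>i<q - 1. w i * c i) \<le> (\<Sum>i<q. w i * c i)"
    using wc_nonneg by (intro sum_mono2) auto
  also have "\<dots> \<le> w 0 * y 0" using budget missing_nonneg[of "{..<q}"] by simp
  finally have "(999 / 1000) * (\<Sum>i<q - 1. c i) \<le> \<theta> * (w 0 * y 0)" using \<theta>_large by simp
  then have "\<mu> * ((999 / 1000) * (\<Sum>i<q - 1. c i)) \<le> \<mu> * (\<theta> * (w 0 * y 0))"
    using \<mu>_large by (intro mult_left_mono) auto
  then show ?thesis using hook_cost Y_pos by (simp add: mult_ac)
qed

lemma crossing_le:
  assumes "i < q - 1"
  shows "\<mu> * c i \<le> (101 / 100) * Y"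
proof -
  have "c i \<le> (\<Sum>i<q - 1. c i)" using assms c_path_nonneg by (intro member_le_sum) auto
  then have "\<mu> * c i \<le> \<mu> * (\<Sum>i<q - 1. c i)" using \<mu>_large by (intro mult_left_mono) auto
  then show ?thesis using crossing_sum by simp
qed

text \<open>
  The hub alone gives \<open>\<mu> * y i \<ge> Y - c i\<close>, and the budget makes \<open>c i\<close> negligible.
\<close>

lemma y_lower:
  assumes "i < q - 1"
  shows "\<mu> * y i \<ge> (999 / 1000) * Y"
proof -
  have "Y \<le> (\<Sum>j | E' i j. y j)"
    using E'_hub[OF assms] E'_fan y_pos finite_E'
    by (intro member_le_sum) (auto simp: fan_adj_def less_imp_le)
  then have "\<mu> * y i \<ge> Y - c i" using y_eq[of i] assms by simp
  moreover have "10000 * c i \<le> \<mu> * c i" using \<mu>_large c_path_nonneg[OF assms] by (intro mult_right_mono) auto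
  ultimately show ?thesis using crossing_le[OF assms] Y_pos by simp
qed

text \<open>
  A missing edge \<open>ij\<close> enters the pairing as \<open>w i * y j + w j * y i\<close>, about twice the budget.
\<close>

lemma all_fan_edges: "E' i j \<longleftrightarrow> fan_adj q i j"
proof
  assume fan: "fan_adj q i j"
  show "E' i j"
  proof (rule ccontr)
    assume no: "\<not> E' i j"
    then have no': "\<not> E' j i" using E'_sym by blast
    have "i \<noteq> q - 1" using fan no' E'_hub[of j] by (auto simp: fan_adj_def)
    moreover have "j \<noteq> q - 1" using fan no E'_hub[of i] by (auto simp: fan_adj_def)
    ultimately have lt: "i < q - 1" "j < q - 1" using fan by (auto simp: fan_adj_def)
    have ij: "i \<noteq> j" using fan by (simp add: fan_adj_def)
    define f where "f = (\<lambda>i. \<Sum>j | fan_adj q i j \<and> \<not> E' i j. w i * y j)"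
    have f_ge: "w i * y j \<le> f i" if "fan_adj q i j" "\<not> E' i j" for i j
      unfolding f_def using that w_pos y_pos finite_subset[OF _ finite_fan_nbrs[of q i]]
      by (intro member_le_sum[of j _ "\<lambda>j. w i * y j"]) (auto simp: fan_adj_def less_imp_le)
    have f0: "f k \<ge> 0" for k
      unfolding f_def using w_pos y_pos by (intro sum_nonneg) (auto simp: fan_adj_def less_imp_le)
    have "f i + f j = sum f {i, j}" using ij by simp
    also have "\<dots> \<le> sum f {..<q}" using lt f0 by (intro sum_mono2) auto
    also have "\<dots> \<le> w 0 * y 0"
      using budget sum_nonneg[of "{..<q}" "\<lambda>i. w i * c i"] wc_nonneg unfolding f_def by force
    finally have "w i * y j + w j * y i \<le> w 0 * y 0"
      using f_ge[OF fan no] f_ge[OF fan_adj_sym[OF fan] no'] by linarith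
    then have "\<theta> * \<mu> * (w i * y j + w j * y i) \<le> \<theta> * \<mu> * (w 0 * y 0)"
      using \<theta>_large \<mu>_large by (intro mult_left_mono) auto
    then have "(\<theta> * w i) * (\<mu> * y j) + (\<theta> * w j) * (\<mu> * y i) \<le> (1007 / 1000) * Y"
      using hook_cost by (simp add: algebra_simps)
    moreover have "(999 / 1000) * ((999 / 1000) * Y) \<le> (\<theta> * w i) * (\<mu> * y j)"
      by (rule mult_mono[OF w_lower[OF lt(1)] y_lower[OF lt(2)]]; use w_lower[OF lt(1)] Y_pos in linarith)
    moreover have "(999 / 1000) * ((999 / 1000) * Y) \<le> (\<theta> * w j) * (\<mu> * y i)"
      by (rule mult_mono[OF w_lower[OF lt(2)] y_lower[OF lt(1)]]; use w_lower[OF lt(2)] Y_pos in linarith)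
    ultimately show False using Y_pos by simp
  qed
qed (rule E'_fan)

end

section \<open>Edges between two fans\<close>

text \<open>
  Both sign classes together; \<open>X i j\<close> says that vertex \<open>i\<close> of the first fan is adjacent to vertex \<open>j\<close>
  of the second.
\<close>

locale two_fans = P: fan_side q \<theta> w \<mu> y E1 c + N: fan_side q \<theta> w \<mu> z E2 d
  for q \<theta> w \<mu> y E1 c z E2 d +
  fixes X :: "nat \<Rightarrow> nat \<Rightarrow> bool"
  assumes X_less: "X i j \<Longrightarrow> i < q \<and> j < q"
    and c_eq: "i < q \<Longrightarrow> c i = (\<Sum>j | X i j. z j)"
    and d_eq: "j < q \<Longrightarrow> d j = (\<Sum>i | X i j. y i)"
begin

lemma two_fans_swap: "two_fans q \<theta> w \<mu> z E2 d y E1 c (\<lambda>i j. X j i)"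
  using X_less c_eq d_eq by unfold_locales auto

lemma finite_X: "finite {j. X i j}" "finite {i. X i j}"
  using X_less by (auto intro: finite_subset[of _ "{..<q}"])

lemma crossing_ge:
  assumes "X i j"
  shows "z j \<le> c i" "y i \<le> d j"
proof -
  have "i < q" "j < q" using X_less[OF assms] by auto
  moreover have "z j \<le> (\<Sum>j | X i j. z j)"
    using assms finite_X X_less N.y_pos by (intro member_le_sum) (auto simp: less_imp_le)
  moreover have "y i \<le> (\<Sum>i | X i j. y i)"
    using assms finite_X X_less P.y_pos by (intro member_le_sum) (auto simp: less_imp_le)
  ultimately show "z j \<le> c i" "y i \<le> d j" using c_eq d_eq by simp_all
qed

text \<open>
  An edge from the hub to \<open>j\<close> bounds \<open>z j\<close> by a small multiple of \<open>Y / \<mu>\<close> and, seen from the other side,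
  \<open>Y\<close> by a small multiple of the entry at the second hub. As \<open>z j\<close> is at least about \<open>1 / \<mu>\<close>
  times that entry, this is impossible.
\<close>

lemma hub_not_crossing_left: "\<not> X (q - 1) j"
proof
  assume X: "X (q - 1) j"
  have \<mu>: "\<mu> \<ge> 10000" by (rule P.\<mu>_large)
  have "\<mu> * z j \<le> \<mu> * c (q - 1)" using crossing_ge(1)[OF X] \<mu> by (intro mult_left_mono) auto
  then have zj: "\<mu> * z j \<le> 1 / 1000 * P.Y" using P.crossing_hub by simp
  have yj: "\<mu> * P.Y \<le> \<mu> * d j" using crossing_ge(2)[OF X] \<mu> by (intro mult_left_mono) auto
  have \<mu>Y: "10000 * P.Y \<le> \<mu> * P.Y" "10000 * N.Y \<le> \<mu> * N.Y"
    using \<mu> P.Y_pos N.Y_pos by (auto intro: mult_right_mono)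
  show False
  proof (cases "j = q - 1")
    case True
    then show False using zj yj N.crossing_hub \<mu>Y P.Y_pos N.Y_pos by simp
  next
    case False
    then have j: "j < q - 1" using X_less[OF X] by auto
    show False using zj yj N.y_lower[OF j] N.crossing_le[OF j] \<mu>Y P.Y_pos N.Y_pos by simp
  qed
qed

lemma X_path:
  assumes "X i j"
  shows "i < q - 1" "j < q - 1"
proof -
  interpret swap: two_fans q \<theta> w \<mu> z E2 d y E1 c "\<lambda>i j. X j i" by (rule two_fans_swap)
  have "i \<noteq> q - 1" using assms hub_not_crossing_left[of j] by auto
  moreover have "j \<noteq> q - 1" using assms swap.hub_not_crossing_left[of i] by auto
  ultimately show "i < q - 1" "j < q - 1" using X_less[OF assms] by auto
qed

text \<open>
  Each crossing edge costs almost the whole budget, up to the ratio of the two hub entries. That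
  ratio cancels when both sides are considered.
\<close>

lemma crossing_count: "real (card {(i, j). X i j}) * (999 / 1000 * N.Y) \<le> 101 / 100 * P.Y"
proof -
  have set: "{(i, j). X i j} = Sigma {..<q - 1} (\<lambda>i. {j. X i j})" using X_path by auto
  have "real (card {(i, j). X i j}) * (999 / 1000 * N.Y) = (\<Sum>(i, j)\<in>{(i, j). X i j}. 999 / 1000 * N.Y)"
    by simp
  also have "\<dots> = (\<Sum>i<q - 1. \<Sum>j | X i j. 999 / 1000 * N.Y)"
    unfolding set using finite_X by (subst sum.Sigma) auto
  also have "\<dots> \<le> (\<Sum>i<q - 1. \<Sum>j | X i j. \<mu> * z j)"
    using N.y_lower X_path by (intro sum_mono) auto
  also have "\<dots> = (\<Sum>i<q - 1. \<mu> * c i)"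
    using c_eq by (intro sum.cong refl) (simp add: sum_distrib_left)
  also have "\<dots> \<le> 101 / 100 * P.Y" using P.crossing_sum by (simp add: sum_distrib_left)
  finally show ?thesis .
qed

lemma at_most_one_crossing:
  assumes "X i j" "X i' j'"
  shows "i = i' \<and> j = j'"
proof (rule ccontr)
  interpret swap: two_fans q \<theta> w \<mu> z E2 d y E1 c "\<lambda>i j. X j i" by (rule two_fans_swap)
  assume "\<not> ?thesis"
  then have ne: "(i, j) \<noteq> (i', j')" "(j, i) \<noteq> (j', i')" by auto
  have fin: "finite {(i, j). X i j}" "finite {(j, i). X i j}"
    using X_less by - (rule finite_subset[of _ "{..<q} \<times> {..<q}"]; auto)+
  have "card {(i, j), (i', j')} \<le> card {(i, j). X i j}" using assms fin by (intro card_mono) auto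
  then have 1: "2 \<le> real (card {(i, j). X i j})" using ne by simp
  have "card {(j, i), (j', i')} \<le> card {(j, i). X i j}" using assms fin by (intro card_mono) auto
  then have 2: "2 \<le> real (card {(j, i). X i j})" using ne by simp
  have "2 * (999 / 1000 * N.Y) \<le> 101 / 100 * P.Y"
    using crossing_count mult_right_mono[OF 1, of "999 / 1000 * N.Y"] N.Y_pos by linarith
  moreover have "2 * (999 / 1000 * P.Y) \<le> 101 / 100 * N.Y"
    using swap.crossing_count mult_right_mono[OF 2, of "999 / 1000 * P.Y"] P.Y_pos by linarith
  ultimately show False using P.Y_pos N.Y_pos by linarith
qed

text \<open>
  An interior path vertex has one more path neighbour than an end. For \<open>w\<close> the gain is even
  doubled by the hook, which lowers the equation at 0; for \<open>y\<close> it is offset by the crossing edge, whose other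
  end carries nearly the same value. In total \<open>w u * y u\<close> exceeds
  \<open>w 0 * y 0\<close> by a factor of about \<open>1 + 2 / \<theta>\<close>.
\<close>

lemma interior_end_costs_more:
  assumes X: "X u v" and u: "0 < u" "Suc u < q - 1"
  shows "w 0 * y 0 < w u * y u"
proof -
  have uv: "u < q - 1" "v < q - 1" using X_path[OF X] by auto
  have \<mu>: "\<mu> \<ge> 10000" and \<theta>: "\<theta> \<ge> 10000" and \<theta>\<mu>: "\<theta> \<le> \<mu>"
    using P.\<mu>_large P.\<theta>_large P.\<theta>_le by auto
  \<comment> \<open>The crossing edge ties the two hub entries together.\<close>
  have ZY: "N.Y \<le> 102 / 100 * P.Y"
  proof -
    have "\<mu> * (999 / 1000 * N.Y) \<le> \<mu> * (\<mu> * z v)"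
      using N.y_lower[OF uv(2)] \<mu> by (intro mult_left_mono) auto
    also have "\<dots> \<le> \<mu> * (\<mu> * c u)" using crossing_ge(1)[OF X] \<mu> by (intro mult_left_mono) auto
    also have "\<dots> \<le> \<mu> * (101 / 100 * P.Y)" using P.crossing_le[OF uv(1)] \<mu> by (intro mult_left_mono) auto
    finally have "999 / 1000 * N.Y \<le> 101 / 100 * P.Y" using \<mu> by simp
    then show ?thesis using P.Y_pos by linarith
  qed
  have X_iff: "X i j \<longleftrightarrow> i = u \<and> j = v" for i j using X at_most_one_crossing[OF X, of i j] by auto
  have Xu: "{j. X u j} = {v}" and X0: "{j. X 0 j} = {}" using u by (auto simp: X_iff)
  have cu: "c u = z v" using c_eq[of u] uv Xu by simp
  have c0: "c 0 = 0" using c_eq[of 0] P.q3 X0 by simp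
  define a b where "a = 1 / \<theta>" and "b = 1 / \<mu>"
  have ab: "0 < b" "b \<le> a" "a \<le> 1 / 10000"
    using \<mu> \<theta> \<theta>\<mu> by (auto simp: a_def b_def intro: divide_left_mono)
  have w_lo: "999 / 1000 * a \<le> w i" and w_hi: "w i \<le> 1001 / 1000 * a" if "i < q - 1" for i
    using P.w_lower[OF that] P.w_upper[OF that] \<theta> by (auto simp: a_def field_simps)
  have y_lo: "999 / 1000 * P.Y * b \<le> y i" and y_hi: "y i \<le> 1005 / 1000 * P.Y * b" if "i < q - 1" for i
    using P.y_lower[OF that] P.y_upper[OF that] \<mu> by (auto simp: b_def field_simps)
  have z_hi: "z v \<le> 1026 / 1000 * P.Y * b"
  proof -
    have "z v \<le> 1005 / 1000 * N.Y * b" using N.y_upper[OF uv(2)] \<mu> by (auto simp: b_def field_simps)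
    also have "\<dots> \<le> 1005 / 1000 * (102 / 100 * P.Y) * b"
      using ZY ab by (intro mult_right_mono mult_left_mono) auto
    also have "\<dots> \<le> 1026 / 1000 * P.Y * b" using P.Y_pos ab by simp
    finally show ?thesis .
  qed
  have eqs: "u \<noteq> 0" "u - 1 < q - 1" "Suc u < q - 1" "0 < q - 1" "1 < q - 1"
    using u P.q3 by auto
  have uq: "u < q" using uv(1) by simp
  have wu: "\<theta> * w u = 1 + w (u - 1) + w (Suc u)"
    using P.w_eq[OF uq] uv(1) eqs by (simp add: sum_fan_nbrs_path P.w_hub[simplified])
  have w0: "\<theta> * w 0 = 1 + w 1 - w 0"
    using P.w_eq[of 0] eqs by (simp add: sum_fan_nbrs_path P.w_hub[simplified])
  have yu: "\<mu> * y u = P.Y + y (u - 1) + y (Suc u) - z v"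
    using P.y_eq[OF uq] uv(1) eqs cu by (simp add: P.all_fan_edges sum_fan_nbrs_path)
  have y0: "\<mu> * y 0 = P.Y + y 1"
    using P.y_eq[of 0] eqs c0 by (simp add: P.all_fan_edges sum_fan_nbrs_path)
  have 1: "1 + 1998 / 1000 * a \<le> \<theta> * w u"
    unfolding wu using w_lo[OF eqs(2)] w_lo[OF eqs(3)] by simp
  have 2: "\<theta> * w 0 \<le> 1 + 2 / 1000 * a"
    unfolding w0 using w_hi[OF eqs(5)] w_lo[OF eqs(4)] by simp
  have 3: "P.Y * (1 + 972 / 1000 * b) \<le> \<mu> * y u"
    unfolding yu using y_lo[OF eqs(2)] y_lo[OF eqs(3)] z_hi by (simp add: algebra_simps)
  have 4: "\<mu> * y 0 \<le> P.Y * (1 + 1005 / 1000 * b)"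
    unfolding y0 using y_hi[OF eqs(5)] by (simp add: algebra_simps)
  have "(1 + 2 / 1000 * a) * (1 + 1005 / 1000 * b) < (1 + 1998 / 1000 * a) * (1 + 972 / 1000 * b)"
  proof -
    define p where "p = a * b"
    have e: "(1 + 2 / 1000 * a) * (1 + 1005 / 1000 * b) = 1 + 2 / 1000 * a + 1005 / 1000 * b + 2010 / 1000000 * p"
      "(1 + 1998 / 1000 * a) * (1 + 972 / 1000 * b) = 1 + 1998 / 1000 * a + 972 / 1000 * b + 1942056 / 1000000 * p"
      by (simp_all add: p_def field_simps)
    have "p \<ge> 0" using ab by (simp add: p_def)
    then show ?thesis unfolding e using ab by linarith
  qed
  then have "P.Y * ((1 + 2 / 1000 * a) * (1 + 1005 / 1000 * b)) < P.Y * ((1 + 1998 / 1000 * a) * (1 + 972 / 1000 * b))"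
    using P.Y_pos by simp
  moreover have "(\<theta> * w 0) * (\<mu> * y 0) \<le> (1 + 2 / 1000 * a) * (P.Y * (1 + 1005 / 1000 * b))"
    by (rule mult_mono[OF 2 4]) (use ab y_lo[OF eqs(4)] P.y_path_pos[OF eqs(4)] \<mu> in simp_all)
  moreover have "(1 + 1998 / 1000 * a) * (P.Y * (1 + 972 / 1000 * b)) \<le> (\<theta> * w u) * (\<mu> * y u)"
    by (rule mult_mono[OF 1 3]) (use 1 ab P.Y_pos in simp_all)
  ultimately have "(\<theta> * w 0) * (\<mu> * y 0) < (\<theta> * w u) * (\<mu> * y u)" by (simp add: mult_ac)
  then have "(\<theta> * \<mu>) * (w 0 * y 0) < (\<theta> * \<mu>) * (w u * y u)" by (simp add: mult_ac)
  then show ?thesis using \<mu> \<theta> by simp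
qed

text \<open>
  The paths are assumed to be oriented such that an end of the crossing edge that is a path end has index 0.
  Multiplying the two budgets gives \<open>(w u * y u) * (w v * z v) \<le> (w 0 * y 0) * (w 0 * z 0)\<close>, where the ratio of the hub
  entries has cancelled. If both ends are 0, the sum of the two pairings vanishes.
\<close>

lemma crossing_joins_ends:
  assumes X: "X u v" and u: "u = 0 \<or> Suc u < q - 1" and v: "v = 0 \<or> Suc v < q - 1"
  shows "u = 0 \<and> v = 0 \<and> \<mu> = \<theta>"
proof -
  interpret swap: two_fans q \<theta> w \<mu> z E2 d y E1 c "\<lambda>i j. X j i" by (rule two_fans_swap)
  have uv: "u < q - 1" "v < q - 1" using X_path[OF X] by auto
  have X_iff: "X i j \<longleftrightarrow> i = u \<and> j = v" for i j using X at_most_one_crossing[OF X, of i j] by auto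
  have ci: "c i = (if i = u then z v else 0)" and di: "d i = (if i = v then y u else 0)" if "i < q" for i
    unfolding c_eq[OF that] d_eq[OF that] X_iff by (cases "i = u"; cases "i = v"; simp)+
  have "(\<Sum>i<q. w i * c i) = (\<Sum>i<q. if i = u then w u * z v else 0)"
    using ci by (intro sum.cong) auto
  then have sumc: "(\<Sum>i<q. w i * c i) = w u * z v" using uv by simp
  have "(\<Sum>i<q. w i * d i) = (\<Sum>i<q. if i = v then w v * y u else 0)"
    using di by (intro sum.cong) auto
  then have sumd: "(\<Sum>i<q. w i * d i) = w v * y u" using uv by simp
  have p1: "(\<mu> - \<theta>) * (\<Sum>i<q. w i * y i) = w 0 * y 0 - w u * z v"
    using P.pairing sumc by (simp add: P.all_fan_edges)
  have p2: "(\<mu> - \<theta>) * (\<Sum>i<q. w i * z i) = w 0 * z 0 - w v * y u"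
    using N.pairing sumd by (simp add: N.all_fan_edges)
  have "0 \<le> (\<mu> - \<theta>) * (\<Sum>i<q. w i * y i)" "0 \<le> (\<mu> - \<theta>) * (\<Sum>i<q. w i * z i)"
    using P.\<theta>_le P.wy_pos N.wy_pos by simp_all
  then have b: "w u * z v \<le> w 0 * y 0" "w v * y u \<le> w 0 * z 0" using p1 p2 by simp_all
  have pos: "w u > 0" "w v > 0" "w 0 > 0" "y u > 0" "y 0 > 0" "z v > 0" "z 0 > 0"
    using uv P.q3 P.w_pos P.y_pos N.y_pos by auto
  have prod: "(w u * y u) * (w v * z v) \<le> (w 0 * y 0) * (w 0 * z 0)"
  proof -
    have "(w u * z v) * (w v * y u) \<le> (w 0 * y 0) * (w 0 * z 0)"
      by (rule mult_mono[OF b]) (use pos in simp_all)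
    then show ?thesis by (simp add: mult_ac)
  qed
  have gt_u: "w 0 * y 0 < w u * y u" if "u \<noteq> 0"
    using interior_end_costs_more[OF X] u that by simp
  have gt_v: "w 0 * z 0 < w v * z v" if "v \<noteq> 0"
    using swap.interior_end_costs_more[OF X] v that by simp
  have ge: "w 0 * y 0 \<le> w u * y u" "w 0 * z 0 \<le> w v * z v"
    using gt_u gt_v by (metis order_refl less_imp_le)+
  have "u = 0"
  proof (rule ccontr)
    assume "u \<noteq> 0"
    from gt_u[OF this] have "(w 0 * y 0) * (w 0 * z 0) < (w u * y u) * (w v * z v)"
      by (rule mult_less_le_imp_less[OF _ ge(2)]) (use pos in simp_all)
    then show False using prod by simp
  qed
  moreover have "v = 0"
  proof (rule ccontr)
    assume "v \<noteq> 0"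
    from gt_v[OF this] have "(w 0 * y 0) * (w 0 * z 0) < (w u * y u) * (w v * z v)"
      by (rule mult_le_less_imp_less[OF ge(1)]) (use pos in simp_all)
    then show False using prod by simp
  qed
  ultimately have "(\<mu> - \<theta>) * ((\<Sum>i<q. w i * y i) + (\<Sum>i<q. w i * z i)) = 0"
    using p1 p2 by (simp add: distrib_left)
  moreover have "(\<Sum>i<q. w i * y i) + (\<Sum>i<q. w i * z i) > 0" using P.wy_pos N.wy_pos by simp
  ultimately have "\<mu> = \<theta>" by simp
  with \<open>u = 0\<close> \<open>v = 0\<close> show ?thesis by simp
qed

end

section \<open>A straight-line drawing of the joined fans\<close>

text \<open>
  The paths of both fans run along the real axis, in opposite directions, and together with the joining edge
  they form one path through consecutive integers; the hubs lie at height 1. All vertices are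
  on the boundary of the strip \<open>0 \<le> Im z \<le> 1\<close>, which contains the drawing.
\<close>

definition axis_coord :: "nat \<Rightarrow> nat \<Rightarrow> int" where
  "axis_coord q v = (if v < q then int v else int q - 1 - int v)"

definition strip_point :: "nat \<Rightarrow> nat \<Rightarrow> complex" where
  "strip_point q v = (if v = q - 1 then Complex 0 1 else if v = 2 * q - 1 then Complex (- 1) 1
     else Complex (of_int (axis_coord q v)) 0)"

definition straight :: "('v \<Rightarrow> complex) \<Rightarrow> 'v \<times> 'v \<Rightarrow> real \<Rightarrow> complex" where
  "straight p e = linepath (p (fst e)) (p (snd e))"

lemma verts_joined_fans: "q \<ge> 1 \<Longrightarrow> pverts (joined_fans q) = {..<2 * q}"
proof -
  assume q: "q \<ge> 1"
  have F: "pverts (fan_graph (q - 1)) = {..<q}"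
    using q by (auto simp: fan_graph_def path_graph_def)
  have "v \<in> {..<q} \<union> (\<lambda>i. i + q) ` {..<q}" if "v < 2 * q" for v
    using that by (cases "v < q") (auto intro!: image_eqI[of _ _ "v - q"])
  moreover have "pverts (joined_fans q) = {..<q} \<union> (\<lambda>i. i + q) ` {..<q}"
    unfolding joined_fans_def Let_def by (simp only: F pair_pre_digraph.select_convs)
  ultimately show ?thesis by auto
qed

lemma arcs_fan_graph: "q \<ge> 1 \<Longrightarrow> parcs (fan_graph (q - 1)) = {(i, j). fan_adj q i j}"
  by (auto simp: fan_graph_def path_graph_def fan_adj_def)

lemma arcs_joined_fans:
  assumes "q \<ge> 1"
  shows "(i, j) \<in> parcs (joined_fans q) \<longleftrightarrow>
    fan_adj q i j \<or> (q \<le> i \<and> q \<le> j \<and> fan_adj q (i - q) (j - q)) \<or> (i, j) \<in> {(0, q), (q, 0)}"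
proof -
  have "(i, j) \<in> (\<lambda>(i, j). (i + q, j + q)) ` {(i, j). fan_adj q i j} \<longleftrightarrow>
      q \<le> i \<and> q \<le> j \<and> fan_adj q (i - q) (j - q)"
    by (auto intro!: image_eqI[of _ _ "(i - q, j - q)"])
  then show ?thesis unfolding joined_fans_def Let_def arcs_fan_graph[OF assms] by auto
qed

lemma finite_arcs_joined_fans: "q \<ge> 1 \<Longrightarrow> finite (parcs (joined_fans q))"
  by (rule finite_subset[of _ "{..<2 * q} \<times> {..<2 * q}"])
    (auto simp: arcs_joined_fans fan_adj_def)

lemma pair_graph_joined_fans:
  assumes "q \<ge> 1"
  shows "pair_graph (joined_fans q)"
proof
  show "finite (pverts (joined_fans q))" using assms by (simp add: verts_joined_fans)
  show "finite (parcs (joined_fans q))" using assms by (rule finite_arcs_joined_fans)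
  show "symmetric (with_proj (joined_fans q))"
    using assms fan_adj_sym by (auto simp: symmetric_def arcs_joined_fans intro!: symI)
  show "fst e \<in> pverts (joined_fans q)" "snd e \<in> pverts (joined_fans q)" "fst e \<noteq> snd e"
    if "e \<in> parcs (joined_fans q)" for e
    using that assms by (cases e; auto simp: arcs_joined_fans verts_joined_fans fan_adj_def)+
qed

lemma connected_joined_fans:
  assumes "q \<ge> 2"
  shows "Digraph_Component.connected (with_proj (joined_fans q))"
proof -
  let ?V = "{..<2 * q}" and ?R = "parcs (joined_fans q)"
  have q: "q \<ge> 1" using assms by simp
  have sym: "(j, i) \<in> ?R" if "(i, j) \<in> ?R" for i j
    using that q fan_adj_sym by (auto simp: arcs_joined_fans)
  then have Rs: "?R\<^sup>s = ?R" by (auto simp: symcl_def)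
  have trans: "(i, k) \<in> rtrancl_on ?V ?R" if "(i, j) \<in> rtrancl_on ?V ?R" "(j, k) \<in> rtrancl_on ?V ?R" for i j k
    using that by (rule rtrancl_on_trans)
  have edge: "(i, j) \<in> rtrancl_on ?V ?R" if "(i, j) \<in> ?R" for i j
  proof -
    have "i \<in> ?V" "j \<in> ?V" using that q by (auto simp: arcs_joined_fans fan_adj_def)
    then show ?thesis using that by (meson rtrancl_on_refl rtrancl_on_into_rtrancl_on)
  qed
  have to_0: "(v, 0) \<in> rtrancl_on ?V ?R \<and> (0, v) \<in> rtrancl_on ?V ?R" if v: "v < 2 * q" for v
  proof -
    have h1: "(v, q - 1) \<in> rtrancl_on ?V ?R \<and> (q - 1, v) \<in> rtrancl_on ?V ?R" if "v < q" for v
    proof (cases "v = q - 1")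
      case False
      then have "(v, q - 1) \<in> ?R" "(q - 1, v) \<in> ?R"
        using that q by (auto simp: arcs_joined_fans fan_adj_def)
      then show ?thesis using edge by blast
    qed (use q in auto)
    have h2: "(v, 2 * q - 1) \<in> rtrancl_on ?V ?R \<and> (2 * q - 1, v) \<in> rtrancl_on ?V ?R" if "q \<le> v" "v < 2 * q" for v
    proof (cases "v = 2 * q - 1")
      case False
      then have "(v, 2 * q - 1) \<in> ?R" "(2 * q - 1, v) \<in> ?R"
        using that q by (auto simp: arcs_joined_fans fan_adj_def)
      then show ?thesis using edge by blast
    qed (use q in auto)
    have "(0, q) \<in> ?R" "(q, 0) \<in> ?R" using q by (auto simp: arcs_joined_fans)
    then have e: "(0, q) \<in> rtrancl_on ?V ?R" "(q, 0) \<in> rtrancl_on ?V ?R" using edge by auto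
    show ?thesis
    proof (cases "v < q")
      case True
      then have "(v, q - 1) \<in> rtrancl_on ?V ?R" "(q - 1, v) \<in> rtrancl_on ?V ?R"
        "(0, q - 1) \<in> rtrancl_on ?V ?R" "(q - 1, 0) \<in> rtrancl_on ?V ?R"
        using h1[of v] h1[of 0] q by auto
      then show ?thesis by (meson trans)
    next
      case False
      then have "(v, 2 * q - 1) \<in> rtrancl_on ?V ?R" "(2 * q - 1, v) \<in> rtrancl_on ?V ?R"
        "(q, 2 * q - 1) \<in> rtrancl_on ?V ?R" "(2 * q - 1, q) \<in> rtrancl_on ?V ?R"
        using h2[of v] h2[of q] v q by auto
      then show ?thesis using e by (meson trans)
    qed
  qed
  show ?thesis
    unfolding connected_conv with_proj_simps verts_joined_fans[OF q] Rs
  proof (intro conjI ballI)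
    show "?V \<noteq> {}" using q by (simp add: lessThan_empty_iff)
    show "(u, v) \<in> rtrancl_on ?V ?R" if "u \<in> ?V" "v \<in> ?V" for u v
      using trans[of u 0 v] to_0[of u] to_0[of v] that by simp
  qed
qed

text \<open>
  Real part of the hub that sees the point \<open>a\<close> of the axis.
\<close>

definition hub_coord :: "int \<Rightarrow> real" where
  "hub_coord a = (if a \<ge> 0 then 0 else - 1)"

text \<open>
  \<open>Inl a\<close> stands for the spoke ending in \<open>a\<close>, \<open>Inr a\<close> for the edge from \<open>a\<close> to \<open>a + 1\<close> on the axis.
\<close>

fun edge_shape :: "int + int \<Rightarrow> complex set" where
  "edge_shape (Inl a) = {z. 0 \<le> Im z \<and> Im z \<le> 1 \<and> Re z = hub_coord a * Im z + (1 - Im z) * of_int a}"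
| "edge_shape (Inr a) = {z. Im z = 0 \<and> of_int a \<le> Re z \<and> Re z \<le> of_int a + 1}"

fun edge_ends :: "int + int \<Rightarrow> complex set" where
  "edge_ends (Inl a) = {Complex (hub_coord a) 1, Complex (of_int a) 0}"
| "edge_ends (Inr a) = {Complex (of_int a) 0, Complex (of_int a + 1) 0}"

lemma segment_spoke:
  "closed_segment (Complex e 1) (Complex a 0) = {z. 0 \<le> Im z \<and> Im z \<le> 1 \<and> Re z = e * Im z + (1 - Im z) * a}"
proof (intro equalityI subsetI)
  fix z assume "z \<in> closed_segment (Complex e 1) (Complex a 0)"
  then obtain t where "0 \<le> t" "t \<le> 1" "z = (1 - t) *\<^sub>R Complex e 1 + t *\<^sub>R Complex a 0"
    by (auto simp: closed_segment_def)
  then show "z \<in> {z. 0 \<le> Im z \<and> Im z \<le> 1 \<and> Re z = e * Im z + (1 - Im z) * a}" by simp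
next
  fix z assume "z \<in> {z. 0 \<le> Im z \<and> Im z \<le> 1 \<and> Re z = e * Im z + (1 - Im z) * a}"
  then have "z = (1 - (1 - Im z)) *\<^sub>R Complex e 1 + (1 - Im z) *\<^sub>R Complex a 0" "0 \<le> 1 - Im z" "1 - Im z \<le> 1"
    by (auto simp: complex_eq_iff)
  then show "z \<in> closed_segment (Complex e 1) (Complex a 0)" unfolding closed_segment_def by blast
qed

lemma segment_axis:
  "closed_segment (Complex a 0) (Complex (a + 1) 0) = {z. Im z = 0 \<and> a \<le> Re z \<and> Re z \<le> a + 1}"
proof (intro equalityI subsetI)
  fix z assume "z \<in> closed_segment (Complex a 0) (Complex (a + 1) 0)"
  then obtain t where "0 \<le> t" "t \<le> 1" "z = (1 - t) *\<^sub>R Complex a 0 + t *\<^sub>R Complex (a + 1) 0"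
    by (auto simp: closed_segment_def)
  moreover have "(1 - t) * a + t * (a + 1) = a + t" by (simp add: algebra_simps)
  ultimately show "z \<in> {z. Im z = 0 \<and> a \<le> Re z \<and> Re z \<le> a + 1}" by simp
next
  fix z assume "z \<in> {z. Im z = 0 \<and> a \<le> Re z \<and> Re z \<le> a + 1}"
  then have "z = (1 - (Re z - a)) *\<^sub>R Complex a 0 + (Re z - a) *\<^sub>R Complex (a + 1) 0" "0 \<le> Re z - a" "Re z - a \<le> 1"
    by (auto simp: complex_eq_iff algebra_simps)
  then show "z \<in> closed_segment (Complex a 0) (Complex (a + 1) 0)" unfolding closed_segment_def by blast
qed

lemma edge_ends_subset_shape: "edge_ends k \<subseteq> edge_shape k"
  by (cases k) auto

text \<open>
  Spokes of the first fan have nonnegative real part and those of the second negative one; the spokes of one fan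
  are distinct segments from the same point.
\<close>

lemma spokes_meet_at_hub:
  assumes "z \<in> edge_shape (Inl a)" "z \<in> edge_shape (Inl b)" "a \<noteq> b"
  shows "z \<in> edge_ends (Inl a)"
proof -
  have z: "0 \<le> Im z" "Im z \<le> 1" "Re z = hub_coord a * Im z + (1 - Im z) * of_int a"
    "Re z = hub_coord b * Im z + (1 - Im z) * of_int b"
    using assms by auto
  have side: "Re z \<ge> 0 \<longleftrightarrow> c \<ge> 0" if "Re z = hub_coord c * Im z + (1 - Im z) * of_int c" for c
  proof (cases "c \<ge> 0")
    case True
    then show ?thesis using that z by (simp add: hub_coord_def)
  next
    case False
    then have "real_of_int c \<le> -1" by linarith
    then have "(1 - Im z) * of_int c \<le> (1 - Im z) * (-1)" using z by (intro mult_left_mono) auto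
    then show ?thesis using that False by (simp add: hub_coord_def)
  qed
  have "hub_coord a = hub_coord b" using side[OF z(3)] side[OF z(4)] by (simp add: hub_coord_def)
  then have "(1 - Im z) * (of_int a - of_int b) = 0" using z(3,4) by (simp add: algebra_simps)
  then have "Im z = 1" using assms(3) by simp
  then show ?thesis using z(3) by (simp add: complex_eq_iff)
qed

lemma edge_shapes_meet:
  assumes "z \<in> edge_shape k" "z \<in> edge_shape l" "k \<noteq> l"
  shows "z \<in> edge_ends k \<union> edge_ends l"
proof (cases k)
  case k: (Inl a)
  show ?thesis
  proof (cases l)
    case l: (Inl b)
    then show ?thesis using spokes_meet_at_hub[of z a b] assms k by auto
  next
    case l: (Inr b)
    then show ?thesis using assms k by (auto simp: complex_eq_iff)
  qed
next
  case k: (Inr a)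
  show ?thesis
  proof (cases l)
    case l: (Inl b)
    then show ?thesis using assms k by (auto simp: complex_eq_iff)
  next
    case l: (Inr b)
    then have z: "Im z = 0" "of_int a \<le> Re z" "Re z \<le> of_int a + 1" "of_int b \<le> Re z" "Re z \<le> of_int b + 1"
      and "a \<noteq> b" using assms k by auto
    then consider "a + 1 \<le> b" | "b + 1 \<le> a" by linarith
    then show ?thesis
    proof cases
      case 1
      then have "real_of_int a + 1 \<le> of_int b" by linarith
      then have "Re z = of_int a + 1" using z by linarith
      then show ?thesis using z k by (simp add: complex_eq_iff)
    next
      case 2
      then have "real_of_int b + 1 \<le> of_int a" by linarith
      then have "Re z = of_int a" using z by linarith
      then show ?thesis using z k by (simp add: complex_eq_iff)
    qed
  qed
qed

lemma lattice_point_on_edge: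
  assumes "z \<in> edge_shape k" "z = Complex 0 1 \<or> z = Complex (- 1) 1 \<or> z = Complex (of_int c) 0"
  shows "z \<in> edge_ends k"
proof (cases k)
  case (Inl a)
  then show ?thesis using assms by (auto simp: complex_eq_iff)
next
  case (Inr a)
  then have "z = Complex (of_int c) 0" "real_of_int a \<le> of_int c" "real_of_int c \<le> of_int a + 1" using assms by auto
  then have "c = a \<or> c = a + 1" by linarith
  then show ?thesis using Inr \<open>z = _\<close> by auto
qed

lemma strip_point_lattice: "\<exists>c. strip_point q v = Complex 0 1 \<or> strip_point q v = Complex (- 1) 1 \<or>
    strip_point q v = Complex (of_int c) 0"
  by (auto simp: strip_point_def)

lemma inj_strip_point: "inj_on (strip_point q) {..<2 * q}"
  by (rule inj_onI) (auto simp: strip_point_def axis_coord_def split: if_splits)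

lemma joined_fans_edge_shape:
  assumes q: "q \<ge> 2" and e: "(u, v) \<in> parcs (joined_fans q)"
  shows "\<exists>k. closed_segment (strip_point q u) (strip_point q v) = edge_shape k \<and>
    {strip_point q u, strip_point q v} = edge_ends k"
proof -
  let ?p = "strip_point q" and ?a = "axis_coord q"
  define P where "P = (\<lambda>u v. \<exists>k. closed_segment (?p u) (?p v) = edge_shape k \<and> {?p u, ?p v} = edge_ends k)"
  have swap: "P v u \<Longrightarrow> P u v" for u v
    unfolding P_def by (simp add: closed_segment_commute insert_commute)
  have axis: "P u v" if "u \<notin> {q - 1, 2 * q - 1}" "v \<notin> {q - 1, 2 * q - 1}" "?a v = ?a u + 1" for u v
    unfolding P_def using that segment_axis[of "of_int (?a u)"]
    by (intro exI[of _ "Inr (?a u)"]) (simp add: strip_point_def)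
  have spoke: "P u v" if "v \<notin> {q - 1, 2 * q - 1}" "?p u = Complex (hub_coord (?a v)) 1" for u v
    unfolding P_def using that segment_spoke[of "hub_coord (?a v)" "of_int (?a v)"]
    by (intro exI[of _ "Inl (?a v)"]) (simp add: strip_point_def)
  have dir: "P u v" if "fan_adj q u v" "u = q - 1 \<or> u = Suc v \<and> v \<noteq> q - 1 \<and> u \<noteq> q - 1" for u v
    using that(2)
  proof
    assume "u = q - 1"
    then show ?thesis using that(1) q
      by (intro spoke) (auto simp: fan_adj_def strip_point_def axis_coord_def hub_coord_def)
  next
    assume "u = Suc v \<and> v \<noteq> q - 1 \<and> u \<noteq> q - 1"
    then show ?thesis using that(1) q
      by (intro swap[OF axis]) (auto simp: fan_adj_def axis_coord_def)
  qed
  have dir': "P u v" if "q \<le> u" "q \<le> v" "fan_adj q (u - q) (v - q)"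
    "u - q = q - 1 \<or> u - q = Suc (v - q) \<and> v - q \<noteq> q - 1 \<and> u - q \<noteq> q - 1" for u v
    using that(4)
  proof
    assume "u - q = q - 1"
    then have u: "u = 2 * q - 1" and v: "v < 2 * q - 1" using that q by (auto simp: fan_adj_def)
    then show ?thesis using that q
      by (intro spoke) (auto simp: strip_point_def axis_coord_def hub_coord_def)
  next
    assume *: "u - q = Suc (v - q) \<and> v - q \<noteq> q - 1 \<and> u - q \<noteq> q - 1"
    then have "u = Suc v" "u < 2 * q - 1" using that q by (auto simp: fan_adj_def)
    then show ?thesis using that q by (intro axis) (auto simp: axis_coord_def)
  qed
  have "q \<ge> 1" using q by simp
  from e consider (1) "fan_adj q u v" | (2) "q \<le> u" "q \<le> v" "fan_adj q (u - q) (v - q)"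
    | (3) "u = 0" "v = q" | (4) "u = q" "v = 0"
    unfolding arcs_joined_fans[OF \<open>q \<ge> 1\<close>] by auto
  then have "P u v"
  proof cases
    case 1
    then show ?thesis using dir[of u v] swap[OF dir[of v u]] fan_adj_sym[OF 1]
      by (auto simp: fan_adj_def)
  next
    case 2
    then show ?thesis using dir'[of u v] swap[OF dir'[of v u]] fan_adj_sym[OF 2(3)]
      by (auto simp: fan_adj_def)
  next
    case 3
    then show ?thesis using q by (intro swap[OF axis]) (auto simp: axis_coord_def)
  next
    case 4
    then show ?thesis using q by (intro axis) (auto simp: axis_coord_def)
  qed
  then show ?thesis unfolding P_def .
qed

text \<open>
  The complement of a convex set containing the drawing belongs to the outer face, so every vertex on
  the boundary of the strip lies on the outer face.
\<close>

lemma outerplanar_joined_fans: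
  assumes q: "q \<ge> 2"
  shows "outerplanar (joined_fans q)"
proof -
  let ?G = "joined_fans q" and ?p = "strip_point q" and ?\<gamma> = "straight (strip_point q)"
  have q1: "q \<ge> 1" using q by simp
  have V: "pverts ?G = {..<2 * q}" using q1 by (rule verts_joined_fans)
  have inV: "u < 2 * q" "v < 2 * q" "u \<noteq> v" if "(u, v) \<in> parcs ?G" for u v
    using that q by (auto simp: arcs_joined_fans[OF q1] fan_adj_def)
  have im: "path_image (?\<gamma> (u, v)) = closed_segment (?p u) (?p v)" for u v by (simp add: straight_def)
  have ne: "?p u \<noteq> ?p v" if "(u, v) \<in> parcs ?G" for u v
    using inV[OF that] inj_onD[OF inj_strip_point, of q u v] by auto
  have vertex_on_edge: "path_image (?\<gamma> (u, v)) \<inter> ?p ` pverts ?G = {?p u, ?p v}" if e: "(u, v) \<in> parcs ?G" for u v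
  proof -
    obtain k where k: "closed_segment (?p u) (?p v) = edge_shape k" "{?p u, ?p v} = edge_ends k"
      using joined_fans_edge_shape[OF q e] by auto
    have "z \<in> edge_ends k" if "z \<in> edge_shape k" "z \<in> ?p ` pverts ?G" for z
      using lattice_point_on_edge[OF that(1)] that(2) strip_point_lattice[of q] by blast
    moreover have "edge_ends k \<subseteq> ?p ` pverts ?G" unfolding k(2)[symmetric] V using inV[OF e] by auto
    ultimately show ?thesis unfolding im k using edge_ends_subset_shape[of k] by blast
  qed
  have edges_meet: "path_image (?\<gamma> (u, v)) \<inter> path_image (?\<gamma> (x, y)) \<subseteq> ?p ` pverts ?G"
    if e: "(u, v) \<in> parcs ?G" "(x, y) \<in> parcs ?G" "{u, v} \<noteq> {x, y}" for u v x y
  proof -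
    obtain k where k: "closed_segment (?p u) (?p v) = edge_shape k" "{?p u, ?p v} = edge_ends k"
      using joined_fans_edge_shape[OF q e(1)] by auto
    obtain l where l: "closed_segment (?p x) (?p y) = edge_shape l" "{?p x, ?p y} = edge_ends l"
      using joined_fans_edge_shape[OF q e(2)] by auto
    have "?p ` {u, v} \<noteq> ?p ` {x, y}"
      using inj_on_image_eq_iff[OF inj_strip_point[of q], of "{u, v}" "{x, y}"] inV[OF e(1)] inV[OF e(2)] e(3)
      by simp
    then have "edge_ends k \<noteq> edge_ends l" using k(2) l(2) by simp
    then have "k \<noteq> l" by auto
    then have "edge_shape k \<inter> edge_shape l \<subseteq> edge_ends k \<union> edge_ends l" using edge_shapes_meet by blast
    moreover have "edge_ends k \<union> edge_ends l \<subseteq> ?p ` pverts ?G"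
      unfolding k(2)[symmetric] l(2)[symmetric] V using inV[OF e(1)] inV[OF e(2)] by auto
    ultimately show ?thesis unfolding im k l by blast
  qed
  have "plane_drawing ?G ?p ?\<gamma>"
    unfolding plane_drawing_def
  proof (intro conjI ballI)
    show "inj_on ?p (pverts ?G)" unfolding V by (rule inj_strip_point)
    fix e assume e: "e \<in> parcs ?G"
    show "case e of (u, v) \<Rightarrow> arc (?\<gamma> (u, v)) \<and> pathstart (?\<gamma> (u, v)) = ?p u \<and>
        pathfinish (?\<gamma> (u, v)) = ?p v \<and> ?\<gamma> (v, u) = reversepath (?\<gamma> (u, v)) \<and>
        path_image (?\<gamma> (u, v)) \<inter> ?p ` pverts ?G = {?p u, ?p v}"
      using e ne vertex_on_edge by (cases e) (auto simp: straight_def)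
    show "case e of (u, v) \<Rightarrow> \<forall>(x, y)\<in>parcs ?G. {u, v} \<noteq> {x, y} \<longrightarrow>
        path_image (?\<gamma> (u, v)) \<inter> path_image (?\<gamma> (x, y)) \<subseteq> ?p ` pverts ?G"
      using e edges_meet by (cases e) blast
  qed
  moreover have "?p ` pverts ?G \<subseteq> frontier (outside (drawing_image ?G ?p ?\<gamma>))"
  proof
    let ?D = "drawing_image ?G ?p ?\<gamma>" and ?T = "{z. 0 \<le> Im z} \<inter> {z. Im z \<le> 1}"
    have conv: "convex ?T" by (intro convex_Int convex_halfspace_Im_ge convex_halfspace_Im_le)
    have pT: "?p v \<in> ?T" for v by (simp add: strip_point_def)
    have "path_image (?\<gamma> e) \<subseteq> ?T" for e
      using closed_segment_subset[OF pT pT conv] by (cases e) (simp add: im)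
    then have "?D \<subseteq> ?T" unfolding drawing_image_def using pT by blast
    then have out: "- ?T \<subseteq> outside ?D" using conv by (intro outside_subset_convex)
    fix z assume z: "z \<in> ?p ` pverts ?G"
    then have "z \<in> ?D" by (auto simp: drawing_image_def)
    then have "z \<notin> outside ?D" using outside_no_overlap[of ?D] by blast
    moreover have "z \<in> closure (outside ?D)"
    proof -
      have "Im z = 0 \<or> Im z = 1" using z by (auto simp: strip_point_def)
      then obtain s :: real where s: "Im z = 0 \<and> s = -1 \<or> Im z = 1 \<and> s = 1" by auto
      have "z \<in> closure (- ?T)"
      proof (rule closure_approachable[THEN iffD2], intro allI impI)
        fix e :: real assume "e > 0"
        then have "z + Complex 0 (s * e / 2) \<in> - ?T" using s by auto
        moreover have "dist (z + Complex 0 (s * e / 2)) z < e"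
          using s \<open>e > 0\<close> by (auto simp: dist_norm cmod_def)
        ultimately show "\<exists>y\<in>- ?T. dist y z < e" by blast
      qed
      then show ?thesis using closure_mono[OF out] by blast
    qed
    ultimately show "z \<in> frontier (outside ?D)"
      using interior_subset by (auto simp: frontier_def)
  qed
  ultimately show ?thesis unfolding outerplanar_def by blast
qed

lemma joined_fans_in_class:
  assumes "q \<ge> 2"
  shows "joined_fans q \<in> connected_outerplanar_graphs (2 * q)"
  using assms pair_graph_joined_fans[of q] verts_joined_fans[of q] connected_joined_fans outerplanar_joined_fans
  by (simp add: connected_outerplanar_graphs_def)

section \<open>The extremal graph\<close>

definition adj_weight :: "nat pair_pre_digraph \<Rightarrow> nat \<Rightarrow> nat \<Rightarrow> real" where
  "adj_weight G i j = (if (i, j) \<in> parcs G then 1 else 0)"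

lemma graph_eigenvalue_2:
  "pverts G = {..<n} \<Longrightarrow> graph_eigenvalue 2 G = matrix_eigenvalues n (adj_weight G) ! 1"
  by (simp add: graph_eigenvalue_def adjacency_eigenvalues_def adjacency_mat_def matrix_eigenvalues_def
      adj_weight_def)

lemma sum_adj_weight:
  "(\<Sum>j<n. adj_weight G i j * x j) = (\<Sum>j | j < n \<and> (i, j) \<in> parcs G. x j)"
proof -
  have "(\<Sum>j<n. adj_weight G i j * x j) = (\<Sum>j<n. if (i, j) \<in> parcs G then x j else 0)"
    by (intro sum.cong) (auto simp: adj_weight_def)
  then show ?thesis by (simp add: sum.If_cases Int_def)
qed

text \<open>
  A path from \<open>S\<close> to its complement has a first edge that leaves \<open>S\<close>.
\<close>

lemma connected_cut_edge:
  assumes conn: "Digraph_Component.connected (with_proj G)" and graph: "pair_graph G"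
    and S: "S \<subseteq> pverts G" "S \<noteq> {}" "S \<noteq> pverts G"
  shows "\<exists>i \<in> pverts G - S. \<exists>j \<in> S. (i, j) \<in> parcs G"
proof -
  have sym: "(j, i) \<in> parcs G" if "(i, j) \<in> parcs G" for i j
    using graph that by (auto simp: pair_graph_def pair_pseudo_graph_def pair_sym_digraph_def
        pair_sym_digraph_axioms_def symmetric_def sym_def)
  then have Rs: "(parcs G)\<^sup>s = parcs G" by (auto simp: symcl_def)
  obtain s t where s: "s \<in> S" and t: "t \<in> pverts G" "t \<notin> S" using S by auto
  have "(s, t) \<in> rtrancl_on (pverts G) (parcs G)"
    using conn s t S unfolding connected_conv with_proj_simps Rs by auto
  then have "t \<notin> S \<longrightarrow> (\<exists>i \<in> pverts G - S. \<exists>j \<in> S. (i, j) \<in> parcs G)"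
  proof (induction rule: rtrancl_on_induct)
    case base
    then show ?case using s by simp
  next
    case (step y z)
    then show ?case using sym by (cases "y \<in> S") auto
  qed
  then show ?thesis using t by simp
qed

lemma sum_lessThan_double:
  fixes f :: "nat \<Rightarrow> real"
  shows "sum f {..<2 * q} = sum f {..<q} + (\<Sum>i<q. f (q + i))"
proof -
  have "{..<2 * q} = {..<q} \<union> {q..<2 * q}" by auto
  then have "sum f {..<2 * q} = sum f {..<q} + sum f {q..<2 * q}"
    by (simp add: sum.union_disjoint ivl_disj_int)
  also have "sum f {q..<2 * q} = (\<Sum>i<q. f (q + i))"
    by (rule sum.reindex_bij_witness[of _ "\<lambda>i. q + i" "\<lambda>i. i - q"]) auto
  finally show ?thesis .
qed

text \<open>
  At the vector that is \<open>c w\<close> on the first fan and \<open>d w\<close> on the second, the quadratic form exceeds \<open>\<theta>\<close> times the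
  squared norm by \<open>(c + d)\<^sup>2 (w 0)\<^sup>2\<close>: the hooks contribute \<open>c\<^sup>2 + d\<^sup>2\<close> and the joining edge \<open>2 c d\<close>.
\<close>

lemma (in hooked_fan) second_eigenvalue_joined_fans_ge: "\<theta> \<le> graph_eigenvalue 2 (joined_fans q)"
proof -
  let ?J = "joined_fans q"
  have q1: "q \<ge> 1" using q3 by simp
  note V = verts_joined_fans[OF q1] and A = arcs_joined_fans[OF q1]
  define x where "x = (\<lambda>i. if i < q then w i else 0)"
  define y where "y = (\<lambda>i. if i < q then 0 else w (i - q))"
  have "\<theta> \<le> matrix_eigenvalues (2 * q) (adj_weight ?J) ! 1"
  proof (rule second_eigenvalue_ge)
    show "adj_weight ?J i j = adj_weight ?J j i" for i j
      using fan_adj_sym[of q] by (auto simp: adj_weight_def A)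
    show "2 \<le> 2 * q" using q1 by simp
    fix c d :: real assume cd: "c \<noteq> 0 \<or> d \<noteq> 0"
    define z where "z = (\<lambda>i. c * x i + d * y i)"
    have z1: "z i = c * w i" if "i < q" for i using that by (simp add: z_def x_def y_def)
    have z2: "z (q + i) = d * w i" for i by (simp add: z_def x_def y_def)
    have s1: "(\<Sum>j<2 * q. adj_weight ?J i j * z j) = c * (\<theta> * w i) + (if i = 0 then (c + d) * w 0 else 0)"
      if "i < q" for i
    proof -
      have eq: "{j. j < 2 * q \<and> (i, j) \<in> parcs ?J} = {j. fan_adj q i j} \<union> (if i = 0 then {q} else {})"
        using that q1 by (auto simp: A fan_adj_def)
      have "(\<Sum>j<2 * q. adj_weight ?J i j * z j) = (\<Sum>j | fan_adj q i j. z j) + (if i = 0 then z q else 0)"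
        unfolding sum_adj_weight eq by (subst sum.union_disjoint) (auto simp: fan_adj_def[of _ _ q])
      also have "(\<Sum>j | fan_adj q i j. z j) = c * (\<Sum>j | fan_adj q i j. w j)"
        unfolding sum_distrib_left by (intro sum.cong refl) (auto simp: fan_adj_def z1)
      finally show ?thesis using z2[of 0] w_eq[OF that] by (simp add: algebra_simps)
    qed
    have s2: "(\<Sum>j<2 * q. adj_weight ?J (q + i) j * z j) = d * (\<theta> * w i) + (if i = 0 then (c + d) * w 0 else 0)"
      if "i < q" for i
    proof -
      have eq: "{j. j < 2 * q \<and> (q + i, j) \<in> parcs ?J} = (+) q ` {j. fan_adj q i j} \<union> (if i = 0 then {0} else {})"
        using that q1 by (auto simp: A fan_adj_def image_iff le_iff_add)
      have "(\<Sum>j<2 * q. adj_weight ?J (q + i) j * z j) =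
          (\<Sum>j\<in>(+) q ` {j. fan_adj q i j}. z j) + (if i = 0 then z 0 else 0)"
        unfolding sum_adj_weight eq using q1 by (subst sum.union_disjoint) auto
      also have "(\<Sum>j\<in>(+) q ` {j. fan_adj q i j}. z j) = d * (\<Sum>j | fan_adj q i j. w j)"
        unfolding sum_distrib_left by (subst sum.reindex) (auto simp: z2)
      finally show ?thesis using z1[of 0] w_eq[OF that] q1 by (simp add: algebra_simps)
    qed
    have t1: "z i * (\<Sum>j<2 * q. adj_weight ?J i j * z j) =
        \<theta> * (z i)\<^sup>2 + (if i = 0 then c * (c + d) * (w 0)\<^sup>2 else 0)" if "i < q" for i
      unfolding s1[OF that] z1[OF that] by (cases "i = 0") (simp_all add: power2_eq_square algebra_simps)
    have t2: "z (q + i) * (\<Sum>j<2 * q. adj_weight ?J (q + i) j * z j) =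
        \<theta> * (z (q + i))\<^sup>2 + (if i = 0 then d * (c + d) * (w 0)\<^sup>2 else 0)" if "i < q" for i
      unfolding s2[OF that] z2 by (cases "i = 0") (simp_all add: power2_eq_square algebra_simps)
    have "(\<Sum>i<2 * q. z i * (\<Sum>j<2 * q. adj_weight ?J i j * z j)) =
      (\<Sum>i<q. \<theta> * (z i)\<^sup>2 + (if i = 0 then c * (c + d) * (w 0)\<^sup>2 else 0)) +
      (\<Sum>i<q. \<theta> * (z (q + i))\<^sup>2 + (if i = 0 then d * (c + d) * (w 0)\<^sup>2 else 0))"
      unfolding sum_lessThan_double[of "\<lambda>i. z i * (\<Sum>j<2 * q. adj_weight ?J i j * z j)"]
      by (intro arg_cong2[of _ _ _ _ "(+)"] sum.cong refl t1 t2) simp_all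
    also have "\<dots> = \<theta> * (\<Sum>i<2 * q. (z i)\<^sup>2) + (c + d)\<^sup>2 * (w 0)\<^sup>2"
      unfolding sum_lessThan_double[of "\<lambda>i. (z i)\<^sup>2"] using q1
      by (simp add: sum.distrib sum_distrib_left[symmetric] power2_eq_square algebra_simps)
    finally have "\<theta> * (\<Sum>i<2 * q. (z i)\<^sup>2) \<le> (\<Sum>i<2 * q. z i * (\<Sum>j<2 * q. adj_weight ?J i j * z j))"
      by simp
    moreover have "\<exists>i<2 * q. z i \<noteq> 0"
    proof (cases "c = 0")
      case True
      then show ?thesis using cd z2[of 0] w_pos[of 0] q1 by (intro exI[of _ q]) auto
    next
      case False
      then show ?thesis using z1[of 0] w_pos[of 0] q1 by (intro exI[of _ 0]) auto
    qed
    ultimately show "(\<exists>i<2 * q. c * x i + d * y i \<noteq> 0) \<and> \<theta> * (\<Sum>i<2 * q. (c * x i + d * y i)\<^sup>2) \<le>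
        (\<Sum>i<2 * q. (c * x i + d * y i) * (\<Sum>j<2 * q. adj_weight ?J i j * (c * x j + d * y j)))"
      by (simp add: z_def)
  qed
  then show ?thesis using graph_eigenvalue_2[OF V] by simp
qed

context outer_graph
begin

text \<open>
  A numbering of \<open>P\<close> that turns its induced subgraph into a subgraph of the fan with all spokes.
\<close>

definition fan_layout :: "nat \<Rightarrow> 'v set \<Rightarrow> 'v \<Rightarrow> (nat \<Rightarrow> 'v) \<Rightarrow> bool" where
  "fan_layout q P h \<phi> \<longleftrightarrow> bij_betw \<phi> {..<q} P \<and> \<phi> (q - 1) = h \<and>
     (\<forall>i<q. \<forall>j<q. E (\<phi> i) (\<phi> j) \<longrightarrow> fan_adj q i j) \<and> (\<forall>i<q - 1. E (\<phi> i) h)"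

lemma fan_layout_exists:
  assumes "P \<subseteq> V" "h \<in> P" "card P = q" "q \<ge> 1" "\<And>u. u \<in> P - {h} \<Longrightarrow> E h u"
  obtains \<phi> where "fan_layout q P h \<phi>"
proof -
  obtain xs where xs: "distinct xs" "set xs = P - {h}" "skip_free E xs"
    using neighbourhood_ordering[of h "P - {h}"] assms by auto
  have fin: "finite P" using assms finite_subset_V by auto
  have len: "length xs = q - 1"
    using distinct_card[OF xs(1)] xs(2) assms fin by simp
  define \<phi> where "\<phi> = (\<lambda>i. if i < q - 1 then xs ! i else h)"
  have inj: "inj_on \<phi> {..<q}"
  proof (rule inj_onI)
    fix i j assume ij: "i \<in> {..<q}" "j \<in> {..<q}" "\<phi> i = \<phi> j"
    have "\<phi> k = h \<longleftrightarrow> k = q - 1" if "k < q" for k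
    proof (cases "k < q - 1")
      case True
      then have "xs ! k \<in> P - {h}" using nth_mem[of k xs] len xs(2) by simp
      then show ?thesis using True by (auto simp: \<phi>_def)
    qed (use that in \<open>auto simp: \<phi>_def\<close>)
    note h_iff = this
    show "i = j"
    proof (cases "i < q - 1 \<and> j < q - 1")
      case True
      then show ?thesis using ij xs(1) len by (simp add: \<phi>_def nth_eq_iff_index_eq)
    next
      case False
      then show ?thesis using ij h_iff[of i] h_iff[of j] by auto
    qed
  qed
  have img: "\<phi> i \<in> P" if "i < q" for i
    using assms(2) nth_mem[of i xs] len xs(2) by (auto simp: \<phi>_def)
  then have "\<phi> ` {..<q} \<subseteq> P" by auto
  moreover have "card (\<phi> ` {..<q}) = card P" using inj assms by (simp add: card_image)
  ultimately have "\<phi> ` {..<q} = P" using fin by (simp add: card_subset_eq)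
  then have "bij_betw \<phi> {..<q} P" using inj by (simp add: bij_betw_def)
  moreover have "fan_adj q i j" if ij: "i < q" "j < q" "E (\<phi> i) (\<phi> j)" for i j
  proof -
    have "i \<noteq> j" using ij E_irrefl by auto
    show ?thesis
    proof (cases "i < q - 1 \<and> j < q - 1")
      case True
      then have "E (xs ! i) (xs ! j)" "E (xs ! j) (xs ! i)" using ij(3) E_sym by (auto simp: \<phi>_def)
      then have "j = Suc i \<or> i = Suc j"
        using skip_free_nth[OF xs(3), of i j] skip_free_nth[OF xs(3), of j i] \<open>i \<noteq> j\<close> True len
        by (metis nat_neq_iff)
      then show ?thesis using ij \<open>i \<noteq> j\<close> by (auto simp: fan_adj_def)
    next
      case False
      then show ?thesis using ij \<open>i \<noteq> j\<close> by (auto simp: fan_adj_def)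
    qed
  qed
  moreover have "E (\<phi> i) h" if "i < q - 1" for i
  proof -
    have "\<phi> i \<in> P - {h}" using that nth_mem[of i xs] len xs(2) by (simp add: \<phi>_def)
    then show ?thesis using assms(5) E_sym by blast
  qed
  ultimately show ?thesis using that[of \<phi>] by (simp add: fan_layout_def \<phi>_def)
qed

lemma fan_layout_reverse:
  assumes "fan_layout q P h \<phi>" "q \<ge> 2"
  shows "fan_layout q P h (\<lambda>i. \<phi> (if i < q - 1 then q - 2 - i else i))"
proof -
  let ?r = "\<lambda>i. if i < q - 1 then q - 2 - i else i"
  have "bij_betw ?r {..<q} {..<q}"
    by (rule bij_betw_byWitness[of _ ?r]) (use assms(2) in \<open>auto split: if_splits\<close>)
  then have "bij_betw (\<phi> \<circ> ?r) {..<q} P"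
    using assms(1) bij_betw_trans by (auto simp: fan_layout_def)
  moreover have "fan_adj q i j" if "i < q" "j < q" "E (\<phi> (?r i)) (\<phi> (?r j))" for i j
  proof -
    have "fan_adj q (?r i) (?r j)"
      using assms that unfolding fan_layout_def by (simp split: if_splits)
    then show ?thesis using that(1,2) assms(2) by (auto simp: fan_adj_def split: if_splits)
  qed
  ultimately show ?thesis using assms unfolding fan_layout_def by (auto simp: comp_def)
qed

lemma fan_layout_orientation:
  assumes "fan_layout q P h \<phi>" "q \<ge> 2" "a \<in> P" "a \<noteq> h"
  obtains \<psi> u where "fan_layout q P h \<psi>" "u < q - 1" "\<psi> u = a" "u = 0 \<or> Suc u < q - 1"
proof -
  obtain u where u: "u < q" "\<phi> u = a" using assms by (auto simp: fan_layout_def bij_betw_def)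
  then have "u \<noteq> q - 1" using assms by (auto simp: fan_layout_def)
  then have uq: "u < q - 1" using u by simp
  show ?thesis
  proof (cases "Suc u < q - 1")
    case True
    then show ?thesis using that assms u uq by blast
  next
    case False
    then have "u = q - 2" using uq by simp
    then show ?thesis using that[OF fan_layout_reverse[OF assms(1,2)], of 0] u uq by simp
  qed
qed

end

text \<open>
  An eigenvector without zeros whose sign classes both have a hub in the sense of \<open>spectral_hub\<close>.
\<close>

locale split_eigenvector = outer_graph V E + hooked_fan q \<theta> w
  for V :: "'v set" and E q \<theta> w +
  fixes \<mu> :: real and x :: "'v \<Rightarrow> real" and P N :: "'v set" and hP hN :: 'v
  assumes PN: "P \<union> N = V" "P \<inter> N = {}" and \<theta>_le: "\<theta> \<le> \<mu>"
    and pos: "u \<in> P \<Longrightarrow> x u > 0" and neg: "u \<in> N \<Longrightarrow> x u < 0"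
    and eig: "u \<in> V \<Longrightarrow> (\<Sum>v | v \<in> V \<and> E u v. x v) = \<mu> * x u"
    and hP: "u \<in> P - {hP} \<Longrightarrow> x u \<le> x hP / (\<mu> - 44)"
    and hN: "u \<in> N - {hN} \<Longrightarrow> - x u \<le> - x hN / (\<mu> - 44)"
begin

lemma split_eigenvector_swap: "split_eigenvector V E q \<theta> w \<mu> (\<lambda>v. - x v) N P hN hP"
proof
  show "(\<Sum>v | v \<in> V \<and> E u v. - x v) = \<mu> * - x u" if "u \<in> V" for u
    using eig[OF that] by (simp add: sum_negf)
qed (use PN \<theta>_le pos neg hP hN in auto)

lemma sum_layout:
  assumes "fan_layout q S h \<phi>"
  shows "(\<Sum>j | j < q \<and> E u (\<phi> j). f (\<phi> j)) = (\<Sum>v | v \<in> S \<and> E u v. f v)"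
proof -
  have b: "inj_on \<phi> {..<q}" "\<phi> ` {..<q} = S" using assms by (auto simp: fan_layout_def bij_betw_def)
  have "{v. v \<in> S \<and> E u v} = \<phi> ` {j. j < q \<and> E u (\<phi> j)}" using b(2) by auto
  moreover have "inj_on \<phi> {j. j < q \<and> E u (\<phi> j)}" using b(1) by (rule inj_on_subset) auto
  ultimately show ?thesis by (simp add: sum.reindex)
qed

lemma fan_side_P:
  assumes \<phi>: "fan_layout q P hP \<phi>"
  shows "fan_side q \<theta> w \<mu> (\<lambda>i. x (\<phi> i)) (\<lambda>i j. i < q \<and> j < q \<and> E (\<phi> i) (\<phi> j))
    (\<lambda>i. \<Sum>v | v \<in> N \<and> E (\<phi> i) v. - x v)"
proof
  have mem: "\<phi> i \<in> P" if "i < q" for i using \<phi> that by (auto simp: fan_layout_def bij_betw_def)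
  have inj: "inj_on \<phi> {..<q}" using \<phi> by (auto simp: fan_layout_def bij_betw_def)
  have hub: "\<phi> (q - 1) = hP" using \<phi> by (simp add: fan_layout_def)
  show "\<theta> \<le> \<mu>" by (rule \<theta>_le)
  show "fan_adj q i j" if "i < q \<and> j < q \<and> E (\<phi> i) (\<phi> j)" for i j
    using \<phi> that by (simp add: fan_layout_def)
  show "j < q \<and> i < q \<and> E (\<phi> j) (\<phi> i)" if "i < q \<and> j < q \<and> E (\<phi> i) (\<phi> j)" for i j
    using that E_sym by blast
  show "i < q \<and> q - 1 < q \<and> E (\<phi> i) (\<phi> (q - 1))" if "i < q - 1" for i
    using \<phi> that by (auto simp: fan_layout_def)
  show "0 < x (\<phi> i)" if "i < q" for i using mem[OF that] by (rule pos)
  show "x (\<phi> i) \<le> x (\<phi> (q - 1)) / (\<mu> - 44)" if "i < q - 1" for i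
  proof -
    have iq: "i < q" "q - 1 < q" "i \<noteq> q - 1" using that by simp_all
    have "\<phi> i \<noteq> hP" using inj_on_eq_iff[OF inj, of i "q - 1"] iq unfolding hub by simp
    then show ?thesis using hP[of "\<phi> i"] mem[OF iq(1)] unfolding hub by simp
  qed
  show "0 \<le> (\<Sum>v | v \<in> N \<and> E (\<phi> i) v. - x v)" for i
    using neg by (intro sum_nonneg) (auto simp: less_imp_le)
  show "\<mu> * x (\<phi> i) = (\<Sum>j | i < q \<and> j < q \<and> E (\<phi> i) (\<phi> j). x (\<phi> j)) - (\<Sum>v | v \<in> N \<and> E (\<phi> i) v. - x v)"
    if "i < q" for i
  proof -
    have "{v. v \<in> V \<and> E (\<phi> i) v} = {v. v \<in> P \<and> E (\<phi> i) v} \<union> {v. v \<in> N \<and> E (\<phi> i) v}" using PN by auto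
    moreover have "finite {v. v \<in> P \<and> E (\<phi> i) v}" "finite {v. v \<in> N \<and> E (\<phi> i) v}"
      using finite_V PN by (auto intro: finite_subset[of _ V])
    ultimately have "\<mu> * x (\<phi> i) = (\<Sum>v | v \<in> P \<and> E (\<phi> i) v. x v) + (\<Sum>v | v \<in> N \<and> E (\<phi> i) v. x v)"
      using eig[of "\<phi> i"] mem[OF that] PN by (subst (asm) eq_commute) (auto simp: sum.union_disjoint disjoint_iff)
    then show ?thesis using that sum_layout[OF \<phi>, where u = "\<phi> i" and f = x] by (simp add: sum_negf)
  qed
qed

lemma two_fans_layouts:
  assumes \<phi>: "fan_layout q P hP \<phi>" and \<psi>: "fan_layout q N hN \<psi>"
  shows "two_fans q \<theta> w \<mu> (\<lambda>i. x (\<phi> i)) (\<lambda>i j. i < q \<and> j < q \<and> E (\<phi> i) (\<phi> j))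
    (\<lambda>i. \<Sum>v | v \<in> N \<and> E (\<phi> i) v. - x v)
    (\<lambda>i. - x (\<psi> i)) (\<lambda>i j. i < q \<and> j < q \<and> E (\<psi> i) (\<psi> j))
    (\<lambda>i. \<Sum>v | v \<in> P \<and> E (\<psi> i) v. x v) (\<lambda>i j. i < q \<and> j < q \<and> E (\<phi> i) (\<psi> j))"
proof -
  interpret swap: split_eigenvector V E q \<theta> w \<mu> "\<lambda>v. - x v" N P hN hP by (rule split_eigenvector_swap)
  interpret P: fan_side q \<theta> w \<mu> "\<lambda>i. x (\<phi> i)" "\<lambda>i j. i < q \<and> j < q \<and> E (\<phi> i) (\<phi> j)"
    "\<lambda>i. \<Sum>v | v \<in> N \<and> E (\<phi> i) v. - x v" by (rule fan_side_P[OF \<phi>])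
  have "fan_side q \<theta> w \<mu> (\<lambda>i. - x (\<psi> i)) (\<lambda>i j. i < q \<and> j < q \<and> E (\<psi> i) (\<psi> j))
    (\<lambda>i. \<Sum>v | v \<in> P \<and> E (\<psi> i) v. x v)"
    using swap.fan_side_P[OF \<psi>] by simp
  then interpret N: fan_side q \<theta> w \<mu> "\<lambda>i. - x (\<psi> i)" "\<lambda>i j. i < q \<and> j < q \<and> E (\<psi> i) (\<psi> j)"
    "\<lambda>i. \<Sum>v | v \<in> P \<and> E (\<psi> i) v. x v" .
  show ?thesis
  proof
    show "(\<Sum>v | v \<in> N \<and> E (\<phi> i) v. - x v) = (\<Sum>j | i < q \<and> j < q \<and> E (\<phi> i) (\<psi> j). - x (\<psi> j))"
      if "i < q" for i
      using that sum_layout[OF \<psi>, where u = "\<phi> i" and f = "\<lambda>v. - x v"] by simp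
    show "(\<Sum>v | v \<in> P \<and> E (\<psi> j) v. x v) = (\<Sum>i | i < q \<and> j < q \<and> E (\<phi> i) (\<psi> j). x (\<phi> i))"
      if "j < q" for j
    proof -
      have "{i. i < q \<and> j < q \<and> E (\<phi> i) (\<psi> j)} = {i. i < q \<and> E (\<psi> j) (\<phi> i)}" using that E_sym by auto
      then show ?thesis using sum_layout[OF \<phi>, where u = "\<psi> j" and f = x] by simp
    qed
  qed auto
qed

text \<open>
  The layouts one starts with show that the edge \<open>ab\<close> avoids the hubs; only then can the paths be
  oriented so that its ends are interior or first.
\<close>

lemma joined_at_ends:
  assumes \<phi>0: "fan_layout q P hP \<phi>0" and \<psi>0: "fan_layout q N hN \<psi>0"
    and e: "a \<in> P" "b \<in> N" "E a b"
  obtains \<phi> \<psi> where "bij_betw \<phi> {..<q} P" "bij_betw \<psi> {..<q} N"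
    "\<And>i j. i < q \<Longrightarrow> j < q \<Longrightarrow> E (\<phi> i) (\<phi> j) \<longleftrightarrow> fan_adj q i j"
    "\<And>i j. i < q \<Longrightarrow> j < q \<Longrightarrow> E (\<psi> i) (\<psi> j) \<longleftrightarrow> fan_adj q i j"
    "\<And>i j. i < q \<Longrightarrow> j < q \<Longrightarrow> E (\<phi> i) (\<psi> j) \<longleftrightarrow> i = 0 \<and> j = 0"
    "\<mu> = \<theta>"
proof -
  have q2: "q \<ge> 2" using q3 by simp
  have "a \<noteq> hP \<and> b \<noteq> hN"
  proof -
    obtain i j where ij: "i < q" "\<phi>0 i = a" "j < q" "\<psi>0 j = b"
      using \<phi>0 \<psi>0 e(1,2) by (auto simp: fan_layout_def bij_betw_def)
    have "i < q - 1" "j < q - 1"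
      using two_fans.X_path[OF two_fans_layouts[OF \<phi>0 \<psi>0], of i j] ij e(3) by auto
    then have "i \<noteq> q - 1" "j \<noteq> q - 1" "q - 1 < q" by simp_all
    moreover have inj: "inj_on \<phi>0 {..<q}" "inj_on \<psi>0 {..<q}" and "\<phi>0 (q - 1) = hP" "\<psi>0 (q - 1) = hN"
      using \<phi>0 \<psi>0 by (auto simp: fan_layout_def bij_betw_def)
    ultimately show ?thesis
      using ij inj_on_eq_iff[OF inj(1), of i "q - 1"] inj_on_eq_iff[OF inj(2), of j "q - 1"] by simp
  qed
  then obtain \<phi> u \<psi> v where \<phi>: "fan_layout q P hP \<phi>" "u < q - 1" "\<phi> u = a" "u = 0 \<or> Suc u < q - 1"
    and \<psi>: "fan_layout q N hN \<psi>" "v < q - 1" "\<psi> v = b" "v = 0 \<or> Suc v < q - 1"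
    using fan_layout_orientation[OF \<phi>0 q2 e(1)] fan_layout_orientation[OF \<psi>0 q2 e(2)] by metis
  interpret tf: two_fans q \<theta> w \<mu> "\<lambda>i. x (\<phi> i)" "\<lambda>i j. i < q \<and> j < q \<and> E (\<phi> i) (\<phi> j)"
    "\<lambda>i. \<Sum>v | v \<in> N \<and> E (\<phi> i) v. - x v"
    "\<lambda>i. - x (\<psi> i)" "\<lambda>i j. i < q \<and> j < q \<and> E (\<psi> i) (\<psi> j)"
    "\<lambda>i. \<Sum>v | v \<in> P \<and> E (\<psi> i) v. x v" "\<lambda>i j. i < q \<and> j < q \<and> E (\<phi> i) (\<psi> j)"
    by (rule two_fans_layouts[OF \<phi>(1) \<psi>(1)])
  have X: "u < q \<and> v < q \<and> E (\<phi> u) (\<psi> v)"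
    using less_imp_diff_less[of u q] \<phi>(2,3) \<psi>(2,3) e(3) by auto
  have uv: "u = 0" "v = 0" "\<mu> = \<theta>" using tf.crossing_joins_ends[OF X \<phi>(4) \<psi>(4)] by auto
  show ?thesis
  proof (rule that[of \<phi> \<psi>])
    show "bij_betw \<phi> {..<q} P" "bij_betw \<psi> {..<q} N" using \<phi>(1) \<psi>(1) by (auto simp: fan_layout_def)
    show "E (\<phi> i) (\<phi> j) \<longleftrightarrow> fan_adj q i j" if "i < q" "j < q" for i j
      using tf.P.all_fan_edges[of i j] that by simp
    show "E (\<psi> i) (\<psi> j) \<longleftrightarrow> fan_adj q i j" if "i < q" "j < q" for i j
      using tf.N.all_fan_edges[of i j] that by simp
    show "E (\<phi> i) (\<psi> j) \<longleftrightarrow> i = 0 \<and> j = 0" if "i < q" "j < q" for i j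
      using tf.at_most_one_crossing[OF X, of i j] that X uv by auto
    show "\<mu> = \<theta>" by (rule uv(3))
  qed
qed

end

lemma digraph_iso_if_relabelling:
  assumes G: "pair_graph G" and g: "bij_betw g (pverts H) (pverts G)"
    and arcs: "\<And>i j. (i, j) \<in> parcs H \<Longrightarrow> i \<in> pverts H \<and> j \<in> pverts H"
    and iff: "\<And>i j. i \<in> pverts H \<Longrightarrow> j \<in> pverts H \<Longrightarrow> (i, j) \<in> parcs H \<longleftrightarrow> (g i, g j) \<in> parcs G"
  shows "digraph_iso (with_proj G) (with_proj H)"
proof -
  interpret pair_graph G by (rule G)
  define h where "h = the_inv_into (pverts H) g"
  have hg: "h (g i) = i" if "i \<in> pverts H" for i
    using g that by (simp add: h_def bij_betw_def the_inv_into_f_f)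
  have gh: "g (h v) = v" "h v \<in> pverts H" if "v \<in> pverts G" for v
    using g that f_the_inv_into_f[of g "pverts H" v] the_inv_into_into[of g "pverts H" v "pverts H"]
    by (auto simp: h_def bij_betw_def)
  have inj: "inj_on h (pverts G)" using gh by (metis inj_onI)
  let ?f = "\<lparr>iso_verts = h, iso_arcs = map_prod h h, iso_head = snd, iso_tail = fst\<rparr>"
  have "inj_on (map_prod h h) (parcs G)"
  proof (rule inj_on_subset[OF map_prod_inj_on[OF inj inj]])
    show "parcs G \<subseteq> pverts G \<times> pverts G" using in_arcsD1 in_arcsD2 by auto
  qed
  then have "pre_digraph.digraph_isomorphism (with_proj G) ?f"
    using inj wf_digraph_axioms by (simp add: pre_digraph.digraph_isomorphism_def)
  moreover have "h ` pverts G = pverts H"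
  proof (intro equalityI subsetI)
    show "i \<in> pverts H" if "i \<in> h ` pverts G" for i using that gh(2) by auto
    show "i \<in> h ` pverts G" if "i \<in> pverts H" for i
      by (rule image_eqI[of _ _ "g i"]) (use hg[OF that] bij_betwE[OF g] that in simp_all)
  qed
  moreover have "map_prod h h ` parcs G = parcs H"
  proof (intro equalityI subsetI)
    fix e assume "e \<in> map_prod h h ` parcs G"
    then obtain u v where uv: "(u, v) \<in> parcs G" "e = (h u, h v)" by auto
    note u = in_arcsD1[OF uv(1)] and v = in_arcsD2[OF uv(1)]
    show "e \<in> parcs H" using iff[OF gh(2)[OF u] gh(2)[OF v]] uv gh(1)[OF u] gh(1)[OF v] by simp
  next
    fix e assume "e \<in> parcs H"
    then obtain i j where e: "e = (i, j)" "(i, j) \<in> parcs H" by (cases e) auto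
    have ij: "i \<in> pverts H" "j \<in> pverts H" using arcs[OF e(2)] by simp_all
    show "e \<in> map_prod h h ` parcs G"
      by (rule image_eqI[of _ _ "(g i, g j)"]) (use iff[OF ij] e hg[OF ij(1)] hg[OF ij(2)] in simp_all)
  qed
  ultimately show ?thesis
    unfolding digraph_iso_def by (intro exI[of _ ?f]) (simp add: app_iso_def with_proj_def)
qed

text \<open>
  One sign class has at most \<open>q\<close> vertices, hence exactly \<open>q\<close> by \<open>spectral_hub\<close>; then the other
  has at most \<open>q\<close> as well. So the eigenvector has no zeros, and connectedness provides an edge
  between the classes.
\<close>

lemma (in hooked_fan) extremal_graph:
  assumes G: "G \<in> connected_outerplanar_graphs (2 * q)" and le: "\<theta> \<le> graph_eigenvalue 2 G"
  shows "graph_eigenvalue 2 G = \<theta> \<and> digraph_iso (with_proj G) (with_proj (joined_fans q))"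
proof -
  have graph: "pair_graph G" and V: "pverts G = {..<2 * q}"
    and conn: "Digraph_Component.connected (with_proj G)" and out: "outerplanar G"
    using G by (auto simp: connected_outerplanar_graphs_def)
  have q1: "q \<ge> 1" using q3 by simp
  define E where "E = (\<lambda>u v. (u, v) \<in> parcs G)"
  define \<mu> where "\<mu> = graph_eigenvalue 2 G"
  interpret og: outer_graph "{..<2 * q}" E
    using outer_graph_if_outerplanar[OF graph out] by (simp add: V E_def)
  have \<mu>: "\<mu> = matrix_eigenvalues (2 * q) (adj_weight G) ! 1"
    using graph_eigenvalue_2[OF V] by (simp add: \<mu>_def)
  have "\<exists>x. (\<exists>i<2 * q. x i > 0) \<and> (\<exists>i<2 * q. x i < 0) \<and>
      (\<forall>i<2 * q. (\<Sum>j<2 * q. adj_weight G i j * x j) = \<mu> * x i)"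
  proof (rule second_eigenvector_changes_sign[of "2 * q" "adj_weight G"])
    show "adj_weight G i j = adj_weight G j i" for i j
      using og.E_sym[of i j] og.E_sym[of j i] by (auto simp: adj_weight_def E_def)
    show "adj_weight G i j \<ge> 0" for i j by (simp add: adj_weight_def)
    show "\<exists>i\<in>{..<2 * q} - S. \<exists>j\<in>S. adj_weight G i j > 0"
      if "S \<subseteq> {..<2 * q}" "S \<noteq> {}" "S \<noteq> {..<2 * q}" for S
      using connected_cut_edge[OF conn graph, of S] that by (auto simp: V adj_weight_def)
    show "2 \<le> 2 * q" using q1 by simp
  qed (auto simp: \<mu>)
  then obtain x where x: "\<exists>i<2 * q. x i > 0" "\<exists>i<2 * q. x i < 0"
    "\<And>i. i < 2 * q \<Longrightarrow> (\<Sum>j<2 * q. adj_weight G i j * x j) = \<mu> * x i" by blast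
  have eig: "(\<Sum>v | v \<in> {..<2 * q} \<and> E u v. x v) = \<mu> * x u" if "u \<in> {..<2 * q}" for u
    using x(3)[of u] that by (simp add: sum_adj_weight E_def)
  define P where "P = {u \<in> {..<2 * q}. x u > 0}"
  define N where "N = {u \<in> {..<2 * q}. x u < 0}"
  have PN: "P \<subseteq> {..<2 * q}" "N \<subseteq> {..<2 * q}" "P \<noteq> {}" "N \<noteq> {}" "P \<inter> N = {}"
    using x(1,2) by (auto simp: P_def N_def)
  have fin: "finite P" "finite N" by (auto simp: P_def N_def)
  have "card (P \<union> N) \<le> card {..<2 * q}" using PN by (intro card_mono) auto
  then have cards: "card P + card N \<le> 2 * q" using fin PN by (simp add: card_Un_disjoint)
  have \<theta>\<mu>: "\<theta> \<le> \<mu>" using le by (simp add: \<mu>_def)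
  have q_\<mu>: "real q \<le> \<mu>\<^sup>2 - 2 * \<mu> + 5 / 4"
  proof -
    have "(\<theta> - 1)\<^sup>2 \<le> (\<mu> - 1)\<^sup>2" using \<theta>\<mu> \<theta>_large by (intro power_mono) auto
    then show ?thesis using q_le by (simp add: power2_eq_square algebra_simps)
  qed
  have \<mu>_large: "\<mu> \<ge> 1000" using \<theta>\<mu> \<theta>_large by simp
  \<comment> \<open>The sign s lets one argument serve both classes.\<close>
  have sub: "\<mu> * (s * x u) \<le> (\<Sum>v | v \<in> S \<and> E u v. s * x v)"
    if "s = 1 \<and> S = P \<or> s = -1 \<and> S = N" "u \<in> S" for s :: real and S u
  proof -
    have "u \<in> {..<2 * q}" using that PN by auto
    then have "\<mu> * (s * x u) = (\<Sum>v | v \<in> {..<2 * q} \<and> E u v. s * x v)"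
      using eig[of u] by (simp add: sum_distrib_left[symmetric] mult_ac)
    also have "\<dots> = - (\<Sum>v | v \<in> {..<2 * q} \<and> E u v. - (s * x v))" by (simp add: sum_negf)
    also have "\<dots> \<le> - (\<Sum>v | v \<in> S \<and> E u v. - (s * x v))"
    proof -
      have "(\<Sum>v | v \<in> {..<2 * q} \<and> E u v. s * x v) \<le> (\<Sum>v | v \<in> S \<and> E u v. s * x v)"
      proof -
        have "(\<Sum>v | v \<in> {..<2 * q} \<and> E u v. s * x v) = (\<Sum>v | v \<in> S \<and> E u v. s * x v) +
            (\<Sum>v\<in>{v. v \<in> {..<2 * q} \<and> E u v} - {v. v \<in> S \<and> E u v}. s * x v)"
          using that PN by (subst sum.subset_diff[of "{v. v \<in> S \<and> E u v}"]) auto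
        moreover have "(\<Sum>v\<in>{v. v \<in> {..<2 * q} \<and> E u v} - {v. v \<in> S \<and> E u v}. s * x v) \<le> 0"
          using that by (intro sum_nonpos) (auto simp: P_def N_def not_less)
        ultimately show ?thesis by simp
      qed
      then show ?thesis by (simp add: sum_negf)
    qed
    finally show ?thesis by (simp add: sum_negf)
  qed
  have hub: "\<exists>h\<in>S. card S = q \<and> (\<forall>u\<in>S - {h}. E h u \<and> s * x u \<le> s * x h / (\<mu> - 44))"
    if s: "s = 1 \<and> S = P \<or> s = -1 \<and> S = N" and card_S: "card S \<le> q" for s :: real and S
  proof -
    have S: "S \<subseteq> {..<2 * q}" "S \<noteq> {}" using s PN by auto
    have sx: "s * x u > 0" if "u \<in> S" for u using s that by (auto simp: P_def N_def)
    show ?thesis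
    proof (rule og.spectral_hub)
      show "S \<subseteq> {..<2 * q}" "S \<noteq> {}" by (fact S)+
      show "s * x u > 0" if "u \<in> S" for u using that by (rule sx)
      show "\<mu> * (s * x u) \<le> (\<Sum>v | v \<in> S \<and> E u v. s * x v)" if "u \<in> S" for u
        using s that by (rule sub)
    qed (fact \<mu>_large card_S q_\<mu>)+
  qed
  have "card P \<le> q \<and> card N \<le> q"
  proof (cases "card P \<le> q")
    case True
    then show ?thesis using hub[of 1 P] cards by auto
  next
    case False
    then show ?thesis using hub[of "-1" N] cards by auto
  qed
  then obtain hP hN where
    hP: "hP \<in> P" "card P = q" "\<And>u. u \<in> P - {hP} \<Longrightarrow> E hP u" "\<And>u. u \<in> P - {hP} \<Longrightarrow> x u \<le> x hP / (\<mu> - 44)"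
    and hN: "hN \<in> N" "card N = q" "\<And>u. u \<in> N - {hN} \<Longrightarrow> E hN u"
      "\<And>u. u \<in> N - {hN} \<Longrightarrow> - x u \<le> - x hN / (\<mu> - 44)"
    using hub[of 1 P] hub[of "-1" N] by auto
  have "card (P \<union> N) = 2 * q" using hP(2) hN(2) fin PN by (simp add: card_Un_disjoint)
  then have un: "P \<union> N = {..<2 * q}" using PN card_subset_eq[of "{..<2 * q}" "P \<union> N"] by auto
  interpret sp: split_eigenvector "{..<2 * q}" E q \<theta> w \<mu> x P N hP hN
    by unfold_locales (use un PN \<theta>\<mu> eig hP hN in \<open>auto simp: P_def N_def\<close>)
  obtain \<phi>0 where \<phi>0: "og.fan_layout q P hP \<phi>0"
    using og.fan_layout_exists[OF PN(1) hP(1,2) q1 hP(3)] by blast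
  obtain \<psi>0 where \<psi>0: "og.fan_layout q N hN \<psi>0"
    using og.fan_layout_exists[OF PN(2) hN(1,2) q1 hN(3)] by blast
  have "P \<noteq> {..<2 * q}" using PN un by auto
  then obtain b a where "b \<in> {..<2 * q} - P" "a \<in> P" "(b, a) \<in> parcs G"
    using connected_cut_edge[OF conn graph, of P] PN by (auto simp: V)
  then have e: "a \<in> P" "b \<in> N" "E a b" using un og.E_sym[of b a] by (auto simp: E_def)
  obtain \<phi> \<psi> where l: "bij_betw \<phi> {..<q} P" "bij_betw \<psi> {..<q} N"
    "\<And>i j. i < q \<Longrightarrow> j < q \<Longrightarrow> E (\<phi> i) (\<phi> j) \<longleftrightarrow> fan_adj q i j"
    "\<And>i j. i < q \<Longrightarrow> j < q \<Longrightarrow> E (\<psi> i) (\<psi> j) \<longleftrightarrow> fan_adj q i j"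
    "\<And>i j. i < q \<Longrightarrow> j < q \<Longrightarrow> E (\<phi> i) (\<psi> j) \<longleftrightarrow> i = 0 \<and> j = 0" "\<mu> = \<theta>"
    using sp.joined_at_ends[OF \<phi>0 \<psi>0 e] by blast
  define g where "g = (\<lambda>i. if i < q then \<phi> i else \<psi> (i - q))"
  have "bij_betw g {..<q} P" using l(1) by (subst bij_betw_cong[of _ g \<phi>]) (auto simp: g_def)
  moreover have "bij_betw g {q..<2 * q} N"
  proof -
    have "bij_betw (\<lambda>i. i - q) {q..<2 * q} {..<q}"
      by (rule bij_betw_byWitness[of _ "\<lambda>i. i + q"]) auto
    then have "bij_betw (\<psi> \<circ> (\<lambda>i. i - q)) {q..<2 * q} N" using l(2) by (rule bij_betw_trans)
    then show ?thesis by (subst bij_betw_cong[of _ g "\<psi> \<circ> (\<lambda>i. i - q)"]) (auto simp: g_def)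
  qed
  ultimately have "bij_betw g ({..<q} \<union> {q..<2 * q}) (P \<union> N)" using PN by (intro bij_betw_combine) auto
  moreover have "{..<q} \<union> {q..<2 * q} = {..<2 * q}" by auto
  ultimately have g: "bij_betw g {..<2 * q} {..<2 * q}" using un by simp
  have "digraph_iso (with_proj G) (with_proj (joined_fans q))"
  proof (rule digraph_iso_if_relabelling[OF graph, of g])
    show "bij_betw g (pverts (joined_fans q)) (pverts G)" using g V verts_joined_fans[OF q1] by simp
    show "i \<in> pverts (joined_fans q) \<and> j \<in> pverts (joined_fans q)" if "(i, j) \<in> parcs (joined_fans q)" for i j
      using that q1 by (auto simp: arcs_joined_fans[OF q1] verts_joined_fans[OF q1] fan_adj_def)
    show "(i, j) \<in> parcs (joined_fans q) \<longleftrightarrow> (g i, g j) \<in> parcs G"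
      if "i \<in> pverts (joined_fans q)" "j \<in> pverts (joined_fans q)" for i j
    proof -
      have ij: "i < 2 * q" "j < 2 * q" using that verts_joined_fans[OF q1] by auto
      have "E (g i) (g j) \<longleftrightarrow> (i, j) \<in> parcs (joined_fans q)"
      proof (cases "i < q")
        case i: True
        show ?thesis
        proof (cases "j < q")
          case j: True
          then show ?thesis using i q1 l(3)[of i j] by (auto simp: g_def arcs_joined_fans[OF q1])
        next
          case j: False
          then show ?thesis using i ij q1 l(5)[of i "j - q"]
            by (auto simp: g_def arcs_joined_fans[OF q1] fan_adj_def)
        qed
      next
        case i: False
        show ?thesis
        proof (cases "j < q")
          case j: True
          have "E (g i) (g j) \<longleftrightarrow> E (g j) (g i)" using og.E_sym by blast
          then show ?thesis using i j ij q1 l(5)[of j "i - q"]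
            by (auto simp: g_def arcs_joined_fans[OF q1] fan_adj_def)
        next
          case j: False
          then show ?thesis using i ij q1 l(4)[of "i - q" "j - q"]
            by (auto simp: g_def arcs_joined_fans[OF q1] fan_adj_def[of q i j])
        qed
      qed
      then show ?thesis by (simp add: E_def)
    qed
  qed
  then show ?thesis using l(6) by (simp add: \<mu>_def)
qed

theorem theorem2:
  shows "\<exists>n\<^sub>0. \<forall>n q. n = 2 * q \<and> n \<ge> n\<^sub>0 \<longrightarrow>
    is_arg_max (graph_eigenvalue 2) (\<lambda>G. G \<in> connected_outerplanar_graphs n) (joined_fans q) \<and>
    (\<forall>G. is_arg_max (graph_eigenvalue 2) (\<lambda>G. G \<in> connected_outerplanar_graphs n) G \<longrightarrow>
         digraph_iso (with_proj G) (with_proj (joined_fans q)))"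
  \<comment> \<open>So large that \<open>\<theta> \<ge> 10000\<close>, which brings the error factors for the entries of \<open>w\<close> and \<open>y\<close> close to 1.\<close>
proof (intro exI[of _ 400000000] allI impI)
  fix n q :: nat assume n: "n = 2 * q \<and> 400000000 \<le> n"
  then have q: "q \<ge> 200000000" by simp
  obtain \<theta> w where "hooked_fan q \<theta> w" using hooked_fan_exists[OF q] .
  then interpret hooked_fan q \<theta> w .
  have J: "joined_fans q \<in> connected_outerplanar_graphs n"
    using joined_fans_in_class[of q] q n by simp
  have J_ge: "\<theta> \<le> graph_eigenvalue 2 (joined_fans q)" by (rule second_eigenvalue_joined_fans_ge)
  have ext: "graph_eigenvalue 2 G = \<theta> \<and> digraph_iso (with_proj G) (with_proj (joined_fans q))"
    if "G \<in> connected_outerplanar_graphs n" "\<theta> \<le> graph_eigenvalue 2 G" for G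
    using extremal_graph[of G] that n by simp
  show "is_arg_max (graph_eigenvalue 2) (\<lambda>G. G \<in> connected_outerplanar_graphs n) (joined_fans q) \<and>
    (\<forall>G. is_arg_max (graph_eigenvalue 2) (\<lambda>G. G \<in> connected_outerplanar_graphs n) G \<longrightarrow>
         digraph_iso (with_proj G) (with_proj (joined_fans q)))"
  proof (intro conjI allI impI)
    show "is_arg_max (graph_eigenvalue 2) (\<lambda>G. G \<in> connected_outerplanar_graphs n) (joined_fans q)"
      unfolding is_arg_max_def
    proof (intro conjI notI J)
      assume "\<exists>G. G \<in> connected_outerplanar_graphs n \<and> graph_eigenvalue 2 (joined_fans q) < graph_eigenvalue 2 G"
      then obtain G where G: "G \<in> connected_outerplanar_graphs n"
        "graph_eigenvalue 2 (joined_fans q) < graph_eigenvalue 2 G" by blast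
      then have "graph_eigenvalue 2 G = \<theta>" using ext[of G] J_ge by simp
      then show False using G J_ge by simp
    qed
    fix G assume "is_arg_max (graph_eigenvalue 2) (\<lambda>G. G \<in> connected_outerplanar_graphs n) G"
    then have "G \<in> connected_outerplanar_graphs n"
      "graph_eigenvalue 2 (joined_fans q) \<le> graph_eigenvalue 2 G"
      using J unfolding is_arg_max_def by (auto simp: not_less)
    then show "digraph_iso (with_proj G) (with_proj (joined_fans q))" using ext[of G] J_ge by simp
  qed
qed

end
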